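(* Let $V$ be a complex vector space of dimension $N+1$ and let $1\le r\le N$. Consider the determinantal variety $X_r\subset\mathbb{P}(V\otimes V)\cong\mathbb{P}^{N(N+2)}$ of $(N+1)\times(N+1)$ matrices of rank at most $r$, and its subvarieties $S_r$ and $A_r$ of symmetric, respectively skew-symmetric, matrices of rank at most $r$. Then $$(X_r)_{S_r}^\vee=\overline{\{B\mid \mathrm{rank}(B)=N+1-r\text{ and }C_{N+1-r}(B)\text{ is symmetric}\}}.$$ Furthermore $(X_r)_{A_r}^\vee=(X_r)_{S_r}^\vee$ for $r$ even and $(X_r)_{A_r}^\vee=\emptyset$ for $r$ odd.
   Context: For a square matrix $B$ of size $N+1$ and $1\le p\le N+1$, the $p$th compound matrix $C_p(B)$ is the $\binom{N+1}{p}\times\binom{N+1}{p}$ matrix with rows and columns indexed by the $p$-element subsets $I,J$ of $\{1,\ldots,N+1\}$ (in lexicographic order) and entries $C_p(B)_{I,J}=\det(B[I;J])$, where $B[I;J]$ is the submatrix with rows $I$ and columns $J$. For projective varieties $Z\subset X\subset\mathbb{P}^m$, with $T_xX$ the embedded projective tangent space at a smooth point, the conormal variety of $X$ relative to $Z$ is $W_{X,Z}=\overline{\{(x,H)\in\mathbb{P}^m\times(\mathbb{P}^m)^\vee\mid x\in X_{\rm sm}\cap Z,\ H\supset T_xX\}}$, and the dual variety of $X$ relative to $Z$ is $X_Z^\vee=\mathrm{pr}_2(W_{X,Z})$ (empty if $Z\subset X_{\rm sing}$). The dual space $\mathbb{P}(V\otimes V)^\vee$ is identified with the projective space of $(N+1)\times(N+1)$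 matrices via the pairing $(A,B)\mapsto\sum_{i,j}a_{ij}b_{ij}$. *)

theory Defs
  imports
    "HOL-Library.Function_Algebras"
    "HOL-Library.Extended_Nat"
    "HOL-Analysis.Derivative"
    "Jordan_Normal_Form.DL_Rank_Submatrix"
begin

section \<open>Projective space and the Zariski topology\<close>

text \<open>
  For a finite set \<open>I\<close>, complex projective space of dimension \<open>card I - 1\<close> has homogeneous
  coordinates indexed by \<open>I\<close>. A coordinate vector is a function that is \<open>0\<close> outside \<open>I\<close>, and a
  point is the class of all nonzero multiples of a nonzero vector. A point of the dual space is the
  class of the coefficient vector of a hyperplane, so the dual space is again \<open>proj_space I\<close>.
\<close>

definition coord_vectors :: "'i set \<Rightarrow> ('i \<Rightarrow> complex) set" where
  "coord_vectors I = {x. \<forall>i. i \<notin> I \<longrightarrow> x i = 0}"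

definition proj_point :: "('i \<Rightarrow> complex) \<Rightarrow> ('i \<Rightarrow> complex) set" where
  "proj_point x = {(\<lambda>i. c * x i) | c. c \<noteq> 0}"

definition proj_space :: "'i set \<Rightarrow> ('i \<Rightarrow> complex) set set" where
  "proj_space I = proj_point ` (coord_vectors I - {\<lambda>i. 0})"

definition exponents :: "'i set \<Rightarrow> nat \<Rightarrow> ('i \<Rightarrow> nat) set" where
  "exponents I d = {\<alpha>. (\<forall>i. i \<notin> I \<longrightarrow> \<alpha> i = 0) \<and> (\<Sum>i\<in>I. \<alpha> i) = d}"

definition monomial_at :: "'i set \<Rightarrow> ('i \<Rightarrow> nat) \<Rightarrow> ('i \<Rightarrow> complex) \<Rightarrow> complex" where
  "monomial_at I \<alpha> x = (\<Prod>i\<in>I. x i ^ \<alpha> i)"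

text \<open>Homogeneous polynomials of arbitrary degree, as polynomial functions.\<close>

definition forms :: "'i set \<Rightarrow> (('i \<Rightarrow> complex) \<Rightarrow> complex) set" where
  "forms I = {F. \<exists>d c. F = (\<lambda>x. \<Sum>\<alpha>\<in>exponents I d. c \<alpha> * monomial_at I \<alpha> x)}"

definition biforms ::
  "'i set \<Rightarrow> 'j set \<Rightarrow> (('i \<Rightarrow> complex) \<Rightarrow> ('j \<Rightarrow> complex) \<Rightarrow> complex) set" where
  "biforms I J = {F. \<exists>d e c. F = (\<lambda>x y. \<Sum>\<alpha>\<in>exponents I d. \<Sum>\<beta>\<in>exponents J e.
     c \<alpha> \<beta> * monomial_at I \<alpha> x * monomial_at J \<beta> y)}"

definition zariski_closed :: "'i set \<Rightarrow> ('i \<Rightarrow> complex) set set \<Rightarrow> bool" where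
  "zariski_closed I Z \<longleftrightarrow>
     (\<exists>\<F> \<subseteq> forms I. Z = {p \<in> proj_space I. \<forall>F\<in>\<F>. \<forall>x\<in>p. F x = 0})"

definition zariski_closed_prod ::
  "'i set \<Rightarrow> 'j set \<Rightarrow> (('i \<Rightarrow> complex) set \<times> ('j \<Rightarrow> complex) set) set \<Rightarrow> bool" where
  "zariski_closed_prod I J W \<longleftrightarrow>
     (\<exists>\<F> \<subseteq> biforms I J.
        W = {(p, q) \<in> proj_space I \<times> proj_space J. \<forall>F\<in>\<F>. \<forall>x\<in>p. \<forall>y\<in>q. F x y = 0})"

definition zariski_closure :: "'i set \<Rightarrow> ('i \<Rightarrow> complex) set set \<Rightarrow> ('i \<Rightarrow> complex) set set" where
  "zariski_closure I S = zariski_closed I hull S"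

definition zariski_closure_prod ::
  "'i set \<Rightarrow> 'j set \<Rightarrow> (('i \<Rightarrow> complex) set \<times> ('j \<Rightarrow> complex) set) set \<Rightarrow>
    (('i \<Rightarrow> complex) set \<times> ('j \<Rightarrow> complex) set) set" where
  "zariski_closure_prod I J S = zariski_closed_prod I J hull S"

definition zariski_irreducible :: "'i set \<Rightarrow> ('i \<Rightarrow> complex) set set \<Rightarrow> bool" where
  "zariski_irreducible I Z \<longleftrightarrow> zariski_closed I Z \<and> Z \<noteq> {} \<and>
     (\<forall>A B. zariski_closed I A \<and> zariski_closed I B \<and> Z = A \<union> B \<longrightarrow> Z = A \<or> Z = B)"

section \<open>Smooth points\<close>

text \<open>
  The Krull dimension of the local ring of \<open>X\<close> at \<open>p\<close>: the supremum of the lengths of chains of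
  irreducible closed subsets of \<open>X\<close> that contain \<open>p\<close>.
\<close>

definition local_dim :: "'i set \<Rightarrow> ('i \<Rightarrow> complex) set set \<Rightarrow> ('i \<Rightarrow> complex) set \<Rightarrow> enat" where
  "local_dim I X p = Sup {enat k | k. \<exists>C.
     (\<forall>j\<le>k. zariski_irreducible I (C j) \<and> p \<in> C j \<and> C j \<subseteq> X) \<and> (\<forall>j<k. C j \<subset> C (Suc j))}"

definition partial_deriv :: "'i \<Rightarrow> (('i \<Rightarrow> complex) \<Rightarrow> complex) \<Rightarrow> ('i \<Rightarrow> complex) \<Rightarrow> complex" where
  "partial_deriv i F x = deriv (\<lambda>t. F (x(i := t))) (x i)"

definition vanishing_forms ::
  "'i set \<Rightarrow> ('i \<Rightarrow> complex) set set \<Rightarrow> (('i \<Rightarrow> complex) \<Rightarrow> complex) set" where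
  "vanishing_forms I X = {F \<in> forms I. \<forall>p\<in>X. \<forall>x\<in>p. F x = 0}"

definition tangent_space ::
  "'i set \<Rightarrow> ('i \<Rightarrow> complex) set set \<Rightarrow> ('i \<Rightarrow> complex) set \<Rightarrow> ('i \<Rightarrow> complex) set set" where
  "tangent_space I X p = {q \<in> proj_space I. \<forall>F \<in> vanishing_forms I X. \<forall>x\<in>p. \<forall>y\<in>q.
     (\<Sum>i\<in>I. partial_deriv i F x * y i) = 0}"

text \<open>
  A point is smooth iff the dimension of the embedded tangent space equals the local dimension. The
  vector space spanned by the representatives of the points of a projective linear subspace has
  dimension one more than that subspace; hence the \<open>+ 1\<close>.
\<close>

definition smooth_locus :: "'i set \<Rightarrow> ('i \<Rightarrow> complex) set set \<Rightarrow> ('i \<Rightarrow> complex) set set" where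
  "smooth_locus I X = {p \<in> X.
     enat (vector_space.dim (\<lambda>(c::complex) x i. c * x i) (\<Union> (tangent_space I X p)))
       = local_dim I X p + 1}"

section \<open>Relative conormal and dual varieties\<close>

definition hyperplane :: "'i set \<Rightarrow> ('i \<Rightarrow> complex) set \<Rightarrow> ('i \<Rightarrow> complex) set set" where
  "hyperplane I h = {p \<in> proj_space I. \<forall>x\<in>p. \<forall>b\<in>h. (\<Sum>i\<in>I. x i * b i) = 0}"

definition conormal_variety ::
  "'i set \<Rightarrow> ('i \<Rightarrow> complex) set set \<Rightarrow> ('i \<Rightarrow> complex) set set \<Rightarrow>
    (('i \<Rightarrow> complex) set \<times> ('i \<Rightarrow> complex) set) set" where
  "conormal_variety I X Z = zariski_closure_prod I I
     {(p, h) \<in> proj_space I \<times> proj_space I.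
        p \<in> smooth_locus I X \<inter> Z \<and> tangent_space I X p \<subseteq> hyperplane I h}"

definition dual_variety ::
  "'i set \<Rightarrow> ('i \<Rightarrow> complex) set set \<Rightarrow> ('i \<Rightarrow> complex) set set \<Rightarrow> ('i \<Rightarrow> complex) set set" where
  "dual_variety I X Z = snd ` conormal_variety I X Z"

section \<open>Determinantal varieties and compound matrices\<close>

text \<open>
  The homogeneous coordinates on the projective space of \<open>n \<times> n\<close> matrices are the matrix entries,
  indexed from \<open>0\<close>; the matrix with coordinate vector \<open>a\<close> is \<open>mat n n a\<close>.
\<close>

definition entries :: "nat \<Rightarrow> (nat \<times> nat) set" where
  "entries n = {..<n} \<times> {..<n}"

definition mat_rank :: "complex mat \<Rightarrow> nat" where
  "mat_rank A = vec_space.rank (dim_row A) A"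

definition symmetric_matrix :: "complex mat \<Rightarrow> bool" where
  "symmetric_matrix A \<longleftrightarrow> transpose_mat A = A"

definition skew_symmetric_matrix :: "complex mat \<Rightarrow> bool" where
  "skew_symmetric_matrix A \<longleftrightarrow> transpose_mat A = - A"

definition det_variety :: "nat \<Rightarrow> nat \<Rightarrow> (nat \<times> nat \<Rightarrow> complex) set set" where
  "det_variety n r = {p \<in> proj_space (entries n). \<forall>a\<in>p. mat_rank (mat n n a) \<le> r}"

definition sym_det_variety :: "nat \<Rightarrow> nat \<Rightarrow> (nat \<times> nat \<Rightarrow> complex) set set" where
  "sym_det_variety n r = {p \<in> det_variety n r. \<forall>a\<in>p. symmetric_matrix (mat n n a)}"

definition skew_det_variety :: "nat \<Rightarrow> nat \<Rightarrow> (nat \<times> nat \<Rightarrow> complex) set set" where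
  "skew_det_variety n r = {p \<in> det_variety n r. \<forall>a\<in>p. skew_symmetric_matrix (mat n n a)}"

text \<open>
  \<open>subseqs [0..<n]\<close> lists the increasing sequences containing \<open>0\<close> before those that do not, and
  recursively so; its members of length \<open>p\<close> are therefore the \<open>p\<close>-element subsets of \<open>{0..<n}\<close> in
  lexicographic order.
\<close>

definition p_subsets :: "nat \<Rightarrow> nat \<Rightarrow> nat set list" where
  "p_subsets n p = map set (filter (\<lambda>xs. length xs = p) (subseqs [0..<n]))"

lemma length_filter_subseqs:
  "length (filter (\<lambda>ys. length ys = p) (subseqs xs)) = length xs choose p"
proof (induction xs arbitrary: p)
  case Nil
  show ?case by (cases p) auto
next
  case (Cons x xs)
  show ?case
    using Cons.IH Cons.IH[of 0] by (cases p) (simp_all add: Let_def filter_map comp_def)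
qed

lemma length_p_subsets: "length (p_subsets n p) = n choose p"
  by (simp add: p_subsets_def length_filter_subseqs)

definition compound_matrix :: "nat \<Rightarrow> complex mat \<Rightarrow> complex mat" where
  "compound_matrix p B = (let L = p_subsets (dim_row B) p in
     mat (dim_row B choose p) (dim_row B choose p)
       (\<lambda>(i, j). det (submatrix B (L ! i) (L ! j))))"

end

theory Submission
  imports
    Defs
    "HOL-Computational_Algebra.Polynomial"
    "Jordan_Normal_Form.Char_Poly"
begin

text \<open>
  Write \<open>n = N + 1\<close> and \<open>p = n - r\<close>. Let \<open>D\<close> be the set of all \<open>K C K\<^sup>T\<close> with \<open>K\<close> of size \<open>n \<times> p\<close>,
  i.e. of all \<open>B\<close> whose row space and column space lie in a common \<open>p\<close>-dimensional subspace. Both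
  sides of the first claim are \<open>D\<close>, and so is the skew dual variety for even \<open>r\<close>. The set \<open>D\<close>
  is closed, being given by \<open>rank [B | B\<^sup>T] \<le> p\<close>; this replaces elimination theory for the
  projection of the conormal variety.

  A matrix of rank \<open>p\<close> has a symmetric compound matrix iff its row and column spaces have the same
  Pluecker coordinates, that is, iff it lies in \<open>D\<close>; a perturbation of \<open>K\<close> and \<open>C\<close> shows that such
  matrices are dense in \<open>D\<close>.

  At a matrix of rank less than \<open>r\<close> every direction is tangent, so no hyperplane contains the
  tangent space. At a matrix \<open>A\<close> of rank \<open>r\<close> a hyperplane \<open>B\<close> contains the tangent space iff
  \<open>A\<^sup>T B = 0\<close> and \<open>A B\<^sup>T = 0\<close>; for (skew-)symmetric \<open>A\<close> this means that the row and column spaces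
  of \<open>B\<close> lie in the kernel of \<open>A\<close>, and every \<open>p\<close>-dimensional space is such a kernel, except that
  skew-symmetric matrices have even rank.

  Smoothness of the rank \<open>r\<close> points requires the Krull dimension. Chains are bounded by
  comparing Hilbert functions with the parametrization \<open>[I; c] [a b]\<close> of the generic matrix of rank
  \<open>r\<close>, and the same parametrization, restricted to coordinate subspaces of the parameters, yields
  a chain of the maximal length.
\<close>

section \<open>Forms as polynomial functions\<close>

text \<open>Closure, irreducibility and tangency are all phrased through forms, so most topological
  steps reduce to polynomials in one variable: a form restricted to a polynomial curve is such a
  polynomial, and it is zero once it vanishes off a finite set of parameters. Perturbations of the
  shape A + t I supply the curves, since det (A + t I) is the value of a characteristic polynomial.

  Smoothness compares a tangent dimension with the lengths of all chains through a point, so the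
  upper bound must handle unknown irreducible sets. Counting independent forms does this: a chain of
  length k forces growth of order d^k in the degree d, while a parametrization with M parameters
  permits only order d^M. Here M + 1 = r(2n - r) is the number of positions in the first r rows or
  columns, the dimension of the affine cone.

  The symmetric and skew cases are one argument for matrices with transpose eps A. They differ only
  in an invertible J for which J diag(I, 0) has this symmetry: the identity for eps = 1, and a
  signed antidiagonal block of even size r for eps = -1.\<close>

text \<open>A named constant keeps the simplification rules of the interpretation from firing on
  arbitrary products under a lambda.\<close>

definition fun_scale :: "complex \<Rightarrow> ('a \<Rightarrow> complex) \<Rightarrow> 'a \<Rightarrow> complex" where
  "fun_scale c x = (\<lambda>i. c * x i)"

interpretation fun_space: vector_space fun_scale
  by unfold_locales (auto simp: fun_scale_def fun_eq_iff algebra_simps)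

lemma finite_exponents:
  assumes "finite I"
  shows "finite (exponents I d)"
proof -
  have "exponents I d \<subseteq> {\<alpha>. \<forall>i. (i \<in> I \<longrightarrow> \<alpha> i \<in> {..d}) \<and> (i \<notin> I \<longrightarrow> \<alpha> i = 0)}"
    using assms by (auto simp: exponents_def intro!: member_le_sum)
  moreover have "finite {\<alpha>. \<forall>i. (i \<in> I \<longrightarrow> \<alpha> i \<in> {..d}) \<and> (i \<notin> I \<longrightarrow> \<alpha> i = 0)}"
    by (rule finite_set_of_finite_funs) (use assms in auto)
  ultimately show ?thesis by (rule finite_subset)
qed

text \<open>The exponent set is a parameter because the same closure properties serve two gradings:
  total degree (\<open>exponents\<close>) for forms, and degree in each variable separately
  (\<open>box_exponents\<close>) for their pullbacks to a chart. A span gives an induction principle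
  in place of coefficient sums.\<close>

definition poly_span :: "'i set \<Rightarrow> ('i \<Rightarrow> nat) set \<Rightarrow> (('i \<Rightarrow> complex) \<Rightarrow> complex) set" where
  "poly_span I E = fun_space.span (monomial_at I ` E)"

abbreviation hforms :: "'i set \<Rightarrow> nat \<Rightarrow> (('i \<Rightarrow> complex) \<Rightarrow> complex) set" where
  "hforms I d \<equiv> poly_span I (exponents I d)"

lemma poly_span_induct [consumes 1, case_names zero add scale monomial]:
  assumes "F \<in> poly_span I E"
    and "P (\<lambda>x. 0)"
    and "\<And>F G. P F \<Longrightarrow> P G \<Longrightarrow> P (\<lambda>x. F x + G x)"
    and "\<And>c F. P F \<Longrightarrow> P (\<lambda>x. c * F x)"
    and "\<And>\<alpha>. \<alpha> \<in> E \<Longrightarrow> P (monomial_at I \<alpha>)"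
  shows "P F"
proof -
  have "fun_space.subspace {F. P F}"
    using assms(2-4) by (auto simp: fun_space.subspace_def zero_fun_def plus_fun_def fun_scale_def)
  with assms(1,5) show ?thesis
    using fun_space.span_minimal[of "monomial_at I ` E" "{F. P F}"]
    by (auto simp: poly_span_def)
qed

lemma poly_span_zero: "(\<lambda>x. 0) \<in> poly_span I E"
  using fun_space.span_zero by (auto simp: poly_span_def zero_fun_def)

lemma poly_span_add:
  "F \<in> poly_span I E \<Longrightarrow> G \<in> poly_span I E \<Longrightarrow> (\<lambda>x. F x + G x) \<in> poly_span I E"
  using fun_space.span_add[of F _ G] by (auto simp: poly_span_def plus_fun_def)

lemma poly_span_scale: "F \<in> poly_span I E \<Longrightarrow> (\<lambda>x. c * F x) \<in> poly_span I E"
  using fun_space.span_scale by (auto simp: poly_span_def fun_scale_def)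

lemma poly_span_monomial: "\<alpha> \<in> E \<Longrightarrow> monomial_at I \<alpha> \<in> poly_span I E"
  unfolding poly_span_def by (rule fun_space.span_base) simp

lemma poly_span_sum:
  "(\<And>s. s \<in> S \<Longrightarrow> F s \<in> poly_span I E) \<Longrightarrow> (\<lambda>x. \<Sum>s\<in>S. F s x) \<in> poly_span I E"
  by (induction S rule: infinite_finite_induct) (auto intro: poly_span_zero poly_span_add)

lemma poly_span_const:
  assumes "(\<lambda>i. 0) \<in> E"
  shows "(\<lambda>x. c) \<in> poly_span I E"
  using poly_span_scale[OF poly_span_monomial[OF assms, of I], of c] by (simp add: monomial_at_def)

lemma monomial_at_mult:
  "monomial_at I \<alpha> x * monomial_at I \<beta> x = monomial_at I (\<lambda>i. \<alpha> i + \<beta> i) x"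
  by (simp add: monomial_at_def power_add prod.distrib)

lemma poly_span_mult:
  assumes "F \<in> poly_span I E1" and "G \<in> poly_span I E2"
    and sum: "\<And>\<alpha> \<beta>. \<alpha> \<in> E1 \<Longrightarrow> \<beta> \<in> E2 \<Longrightarrow> (\<lambda>i. \<alpha> i + \<beta> i) \<in> E"
  shows "(\<lambda>x. F x * G x) \<in> poly_span I E"
  using assms(1)
proof (induction rule: poly_span_induct)
  case (monomial \<alpha>)
  show ?case using assms(2)
  proof (induction rule: poly_span_induct)
    case (monomial \<beta>)
    then show ?case using sum[OF \<open>\<alpha> \<in> E1\<close>] by (simp add: monomial_at_mult poly_span_monomial)
  next
    case (scale c F)
    from poly_span_scale[OF this, of c] show ?case by (simp add: algebra_simps)
  qed (auto simp: algebra_simps intro: poly_span_zero poly_span_add)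
qed (auto simp: algebra_simps intro: poly_span_zero poly_span_add poly_span_scale)

lemma poly_span_prod:
  assumes "(\<lambda>i. 0) \<in> E 0"
    and "\<And>d e \<alpha> \<beta>. \<alpha> \<in> E d \<Longrightarrow> \<beta> \<in> E e \<Longrightarrow> (\<lambda>i. \<alpha> i + \<beta> i) \<in> E (d + e)"
    and "finite S" and "\<And>s. s \<in> S \<Longrightarrow> F s \<in> poly_span I (E (d s))"
  shows "(\<lambda>x. \<Prod>s\<in>S. F s x) \<in> poly_span I (E (\<Sum>s\<in>S. d s))"
  using assms(3,4)
proof (induction S rule: finite_induct)
  case empty
  show ?case using poly_span_const[OF assms(1)] by simp
next
  case (insert s S)
  then have "(\<lambda>x. F s x * (\<Prod>s\<in>S. F s x)) \<in> poly_span I (E (d s + (\<Sum>s\<in>S. d s)))"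
    by (intro poly_span_mult[OF _ _ assms(2)]) auto
  then show ?case using insert.hyps by simp
qed

text \<open>Translates the coefficient description into spans. Finiteness of \<open>I\<close> makes
  each exponent set finite, so that a single monomial is a coefficient sum with an indicator as
  coefficient function.\<close>

lemma forms_eq_hforms:
  assumes "finite I"
  shows "forms I = (\<Union>d. hforms I d)"
proof
  show "forms I \<subseteq> (\<Union>d. hforms I d)"
    by (auto simp: forms_def intro!: exI poly_span_sum poly_span_scale poly_span_monomial)
next
  note fin = finite_exponents[OF assms]
  have "F \<in> forms I" if "F \<in> hforms I d" for F d
  proof -
    have "\<exists>c. F = (\<lambda>x. \<Sum>\<alpha>\<in>exponents I d. c \<alpha> * monomial_at I \<alpha> x)"
      using that
    proof (induction rule: poly_span_induct)
      case zero
      show ?case by (rule exI[of _ "\<lambda>_. 0"]) auto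
    next
      case (add F G)
      then obtain c c' where
        "F = (\<lambda>x. \<Sum>\<alpha>\<in>exponents I d. c \<alpha> * monomial_at I \<alpha> x)"
        "G = (\<lambda>x. \<Sum>\<alpha>\<in>exponents I d. c' \<alpha> * monomial_at I \<alpha> x)" by blast
      then show ?case
        by (intro exI[of _ "\<lambda>\<alpha>. c \<alpha> + c' \<alpha>"]) (auto simp: algebra_simps sum.distrib)
    next
      case (scale a F)
      then obtain c where "F = (\<lambda>x. \<Sum>\<alpha>\<in>exponents I d. c \<alpha> * monomial_at I \<alpha> x)" by blast
      then show ?case
        by (intro exI[of _ "\<lambda>\<alpha>. a * c \<alpha>"]) (auto simp: algebra_simps sum_distrib_left)
    next
      case (monomial \<beta>)
      have "(\<Sum>\<alpha>\<in>exponents I d. of_bool (\<alpha> = \<beta>) * monomial_at I \<alpha> x) =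
          (\<Sum>\<alpha>\<in>exponents I d. if \<alpha> = \<beta> then monomial_at I \<alpha> x else 0)" for x
        by (rule sum.cong) auto
      then have "monomial_at I \<beta> x =
          (\<Sum>\<alpha>\<in>exponents I d. of_bool (\<alpha> = \<beta>) * monomial_at I \<alpha> x)" for x
        using monomial fin by simp
      then show ?case by (intro exI[of _ "\<lambda>\<alpha>. of_bool (\<alpha> = \<beta>)"]) auto
    qed
    then show ?thesis by (auto simp: forms_def)
  qed
  then show "(\<Union>d. hforms I d) \<subseteq> forms I" by auto
qed

lemma zero_mem_exponents: "(\<lambda>i. 0) \<in> exponents I 0"
  by (auto simp: exponents_def)

lemma add_mem_exponents:
  "\<alpha> \<in> exponents I d \<Longrightarrow> \<beta> \<in> exponents I e \<Longrightarrow> (\<lambda>i. \<alpha> i + \<beta> i) \<in> exponents I (d + e)"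
  by (auto simp: exponents_def sum.distrib)

lemma hforms_mult:
  "F \<in> hforms I d \<Longrightarrow> G \<in> hforms I e \<Longrightarrow> (\<lambda>x. F x * G x) \<in> hforms I (d + e)"
  by (rule poly_span_mult[OF _ _ add_mem_exponents])

lemma hforms_var:
  assumes "finite I" and "i \<in> I"
  shows "(\<lambda>x. x i) \<in> hforms I 1"
proof -
  let ?\<alpha> = "\<lambda>j. of_bool (j = i)"
  have "?\<alpha> \<in> exponents I 1" using assms by (auto simp: exponents_def of_bool_def)
  moreover have "monomial_at I ?\<alpha> x = x i" for x
  proof -
    have "(\<Prod>j\<in>I. x j ^ of_bool (j = i)) = (\<Prod>j\<in>I. if j = i then x j else 1)"
      by (rule prod.cong) (auto simp: of_bool_def)
    then show ?thesis using assms by (simp add: monomial_at_def)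
  qed
  then have "monomial_at I ?\<alpha> = (\<lambda>x. x i)" by blast
  ultimately show ?thesis using poly_span_monomial[of ?\<alpha> "exponents I 1" I] by simp
qed

lemma hforms_prod:
  "finite S \<Longrightarrow> (\<And>s. s \<in> S \<Longrightarrow> F s \<in> hforms I (d s)) \<Longrightarrow>
    (\<lambda>x. \<Prod>s\<in>S. F s x) \<in> hforms I (\<Sum>s\<in>S. d s)"
  by (rule poly_span_prod[where E = "exponents I", OF zero_mem_exponents add_mem_exponents])

lemma hforms_power: "F \<in> hforms I d \<Longrightarrow> (\<lambda>x. F x ^ k) \<in> hforms I (k * d)"
  using hforms_prod[of "{..<k}" "\<lambda>_. F" I "\<lambda>_. d"] by simp

text \<open>By the Leibniz formula the determinant is a combination of products of \<open>k\<close>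
  linear forms.\<close>

lemma hforms_det:
  assumes "\<And>x. M x \<in> carrier_mat k k"
    and "\<And>i j. i < k \<Longrightarrow> j < k \<Longrightarrow> (\<lambda>x. M x $$ (i, j)) \<in> hforms I 1"
  shows "(\<lambda>x. det (M x)) \<in> hforms I k"
proof -
  have "(\<lambda>x. \<Sum>\<pi>\<in>{\<pi>. \<pi> permutes {0..<k}}. signof \<pi> * (\<Prod>i=0..<k. M x $$ (i, \<pi> i))) \<in> hforms I k"
  proof (intro poly_span_sum poly_span_scale)
    fix \<pi> assume "\<pi> \<in> {\<pi>. \<pi> permutes {0..<k}}"
    then have "\<And>i. i < k \<Longrightarrow> \<pi> i < k" by (auto simp: permutes_def dest: permutes_in_image)
    then show "(\<lambda>x. \<Prod>i=0..<k. M x $$ (i, \<pi> i)) \<in> hforms I k"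
      using hforms_prod[of "{0..<k}" "\<lambda>i x. M x $$ (i, \<pi> i)" I "\<lambda>_. 1"] assms(2) by auto
  qed
  then show ?thesis using assms(1) by (simp add: det_def'[of _ k])
qed

lemma hforms_homogeneous:
  assumes "F \<in> hforms I d"
  shows "F (\<lambda>i. c * x i) = c ^ d * F x"
  using assms
proof (induction rule: poly_span_induct)
  case (monomial \<alpha>)
  then show ?case
    by (auto simp: monomial_at_def exponents_def power_mult_distrib prod.distrib
        power_sum[symmetric])
qed (auto simp: algebra_simps)

text \<open>Along such a curve every form becomes a polynomial in one variable. Its finitely many
  roots are the substitute for limits and for density arguments.\<close>

definition poly_curve :: "(complex \<Rightarrow> 'i \<Rightarrow> complex) \<Rightarrow> bool" where
  "poly_curve \<gamma> \<longleftrightarrow> (\<forall>i. \<exists>q. \<forall>t. \<gamma> t i = poly q t)"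

lemma hforms_poly_curve:
  assumes "F \<in> hforms I d" and "poly_curve \<gamma>"
  obtains q where "\<And>t. F (\<gamma> t) = poly q t"
proof -
  from assms(2) obtain Q where Q: "\<And>i t. \<gamma> t i = poly (Q i) t"
    unfolding poly_curve_def by metis
  have "\<exists>q. \<forall>t. F (\<gamma> t) = poly q t"
    using assms(1)
  proof (induction rule: poly_span_induct)
    case zero
    show ?case by (rule exI[of _ 0]) auto
  next
    case (add F G)
    then obtain p q where "\<forall>t. F (\<gamma> t) = poly p t" "\<forall>t. G (\<gamma> t) = poly q t" by blast
    then show ?case by (intro exI[of _ "p + q"]) auto
  next
    case (scale c F)
    then obtain p where "\<forall>t. F (\<gamma> t) = poly p t" by blast
    then show ?case by (intro exI[of _ "[:c:] * p"]) auto
  next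
    case (monomial \<alpha>)
    then show ?case
      by (intro exI[of _ "\<Prod>i\<in>I. Q i ^ \<alpha> i"]) (auto simp: monomial_at_def Q poly_prod)
  qed
  with that show thesis by blast
qed

section \<open>Directional derivatives of forms\<close>

lemma ex_directional_derivative_monomial:
  assumes "finite I"
  shows "\<exists>D. \<forall>x y. ((\<lambda>t. monomial_at I \<alpha> (\<lambda>i. x i + t * y i)) has_field_derivative
    (\<Sum>i\<in>I. D i x * y i)) (at 0)"
proof -
  have "((\<lambda>t. monomial_at I \<alpha> (\<lambda>i. x i + t * y i)) has_field_derivative
    (\<Sum>i\<in>I. of_nat (\<alpha> i) * x i ^ (\<alpha> i - 1) * (\<Prod>j\<in>I-{i}. x j ^ \<alpha> j) * y i)) (at 0)" for x y
  proof -
    have "((\<lambda>t. (x i + t * y i) ^ \<alpha> i) has_field_derivative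
      of_nat (\<alpha> i) * x i ^ (\<alpha> i - 1) * y i) (at 0)" for i
      by (auto intro!: derivative_eq_intros)
    from has_field_derivative_prod[of I "\<lambda>i t. (x i + t * y i) ^ \<alpha> i", OF this]
    show ?thesis by (simp add: monomial_at_def mult_ac)
  qed
  then show ?thesis
    by (intro exI[of _ "\<lambda>i x. of_nat (\<alpha> i) * x i ^ (\<alpha> i - 1) * (\<Prod>j\<in>I-{i}. x j ^ \<alpha> j)"]) blast
qed

text \<open>The induction only claims that some coefficients \<open>D\<close> exist, valid for all
  directions at once; this is stable under sums and multiples without differentiability side
  conditions on \<open>partial_deriv\<close>.\<close>

lemma hforms_directional_derivative:
  assumes "finite I" and "F \<in> hforms I d"
  shows "((\<lambda>t. F (\<lambda>i. x i + t * y i)) has_field_derivative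
    (\<Sum>i\<in>I. partial_deriv i F x * y i)) (at 0)"
proof -
  have "\<exists>D. \<forall>x y. ((\<lambda>t. F (\<lambda>i. x i + t * y i)) has_field_derivative
    (\<Sum>i\<in>I. D i x * y i)) (at 0)"
    using assms(2)
  proof (induction rule: poly_span_induct)
    case zero
    show ?case by (intro exI[of _ "\<lambda>_ _. 0"]) auto
  next
    case (add F G)
    then obtain D D' where
      "\<And>x y. ((\<lambda>t. F (\<lambda>i. x i + t * y i)) has_field_derivative (\<Sum>i\<in>I. D i x * y i)) (at 0)"
      "\<And>x y. ((\<lambda>t. G (\<lambda>i. x i + t * y i)) has_field_derivative (\<Sum>i\<in>I. D' i x * y i)) (at 0)"
      by blast
    then have "((\<lambda>t. F (\<lambda>i. x i + t * y i) + G (\<lambda>i. x i + t * y i)) has_field_derivative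
      (\<Sum>i\<in>I. D i x * y i) + (\<Sum>i\<in>I. D' i x * y i)) (at 0)" for x y
      by (rule DERIV_add)
    then show ?case
      by (intro exI[of _ "\<lambda>i x. D i x + D' i x"]) (simp add: distrib_right sum.distrib)
  next
    case (scale c F)
    then obtain D where
      "\<And>x y. ((\<lambda>t. F (\<lambda>i. x i + t * y i)) has_field_derivative (\<Sum>i\<in>I. D i x * y i)) (at 0)"
      by blast
    from DERIV_cmult[OF this, of c] show ?case
      by (intro exI[of _ "\<lambda>i x. c * D i x"]) (auto simp: algebra_simps sum_distrib_left)
  next
    case (monomial \<alpha>)
    show ?case by (rule ex_directional_derivative_monomial[OF assms(1)])
  qed
  then obtain D where D:
    "\<And>x y. ((\<lambda>t. F (\<lambda>i. x i + t * y i)) has_field_derivative (\<Sum>i\<in>I. D i x * y i)) (at 0)"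
    by blast
  \<comment> \<open>The unit vector in direction \<open>i\<close> identifies the anonymous
    coefficient; the shift by \<open>x i\<close> moves the base point of the one-variable derivative
    from 0 to \<open>x i\<close>.\<close>
  have "partial_deriv i F x = D i x" if "i \<in> I" for i
  proof -
    have "(\<lambda>j. x j + t * of_bool (j = i)) = x(i := t + x i)" for t by auto
    with D[of x "\<lambda>j. of_bool (j = i)"] that assms(1)
    have "((\<lambda>t. F (x(i := t + x i))) has_field_derivative D i x) (at 0)"
      by (simp add: of_bool_def if_distrib cong: if_cong)
    then have "((\<lambda>t. F (x(i := t))) has_field_derivative D i x) (at (0 + x i))"
      by (subst DERIV_shift)
    then show ?thesis by (simp add: partial_deriv_def DERIV_imp_deriv)
  qed
  with D[of x y] show ?thesis by (simp cong: sum.cong)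
qed

section \<open>Projective closures, irreducibility and chains\<close>

lemma self_mem_proj_point: "x \<in> proj_point x"
  unfolding proj_point_def by (rule CollectI, rule exI[of _ 1]) auto

lemma proj_point_scale_subset:
  assumes "c \<noteq> 0"
  shows "proj_point (\<lambda>i. c * x i) \<subseteq> proj_point x"
proof
  fix z assume "z \<in> proj_point (\<lambda>i. c * x i)"
  then obtain a where "a \<noteq> 0" "z = (\<lambda>i. a * (c * x i))" unfolding proj_point_def by blast
  with assms have "z = (\<lambda>i. (a * c) * x i) \<and> a * c \<noteq> 0" by (simp add: mult.assoc)
  then show "z \<in> proj_point x" unfolding proj_point_def by blast
qed

lemma proj_point_eqI:
  assumes "c \<noteq> 0"
  shows "proj_point (\<lambda>i. c * x i) = proj_point x"
proof
  have "(\<lambda>i. inverse c * (c * x i)) = x" using assms by (simp add: fun_eq_iff)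
  with proj_point_scale_subset[of "inverse c" "\<lambda>i. c * x i"] assms
  show "proj_point x \<subseteq> proj_point (\<lambda>i. c * x i)" by simp
qed (rule proj_point_scale_subset[OF assms])

lemma proj_spaceE:
  assumes "p \<in> proj_space I"
  obtains x where "p = proj_point x" and "x \<in> coord_vectors I" and "x \<noteq> (\<lambda>i. 0)"
  using assms by (auto simp: proj_space_def)

lemma proj_space_mem:
  assumes "p \<in> proj_space I" and "x \<in> p"
  shows "p = proj_point x" and "x \<in> coord_vectors I" and "x \<noteq> (\<lambda>i. 0)"
proof -
  from assms(1) obtain y where y: "p = proj_point y" "y \<in> coord_vectors I" "y \<noteq> (\<lambda>i. 0)"
    by (rule proj_spaceE)
  with assms(2) obtain c where c: "c \<noteq> 0" "x = (\<lambda>i. c * y i)" by (auto simp: proj_point_def)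
  show "p = proj_point x" using proj_point_eqI[of c y] c y by simp
  show "x \<in> coord_vectors I" using c y by (auto simp: coord_vectors_def)
  show "x \<noteq> (\<lambda>i. 0)" using c y by (auto simp: fun_eq_iff)
qed

lemma proj_point_in_proj_space:
  "x \<in> coord_vectors I \<Longrightarrow> x \<noteq> (\<lambda>i. 0) \<Longrightarrow> proj_point x \<in> proj_space I"
  by (auto simp: proj_space_def)

lemma hforms_vanish_proj_point:
  assumes "F \<in> hforms I d"
  shows "(\<forall>x\<in>proj_point y. F x = 0) \<longleftrightarrow> F y = 0"
  using self_mem_proj_point[of y] hforms_homogeneous[OF assms]
  by (auto simp: proj_point_def)

lemma forms_vanish_proj_point:
  assumes "finite I" and "F \<in> forms I"
  shows "(\<forall>x\<in>proj_point y. F x = 0) \<longleftrightarrow> F y = 0"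
  using assms hforms_vanish_proj_point[of F I _ y] unfolding forms_eq_hforms[OF assms(1)] by blast

lemma vanishing_formsI:
  assumes "finite I" and "F \<in> hforms I d" and "\<And>x. x \<in> \<Union>S \<Longrightarrow> F x = 0"
  shows "F \<in> vanishing_forms I S"
  using assms by (auto simp: vanishing_forms_def forms_eq_hforms)

definition zero_locus :: "'i set \<Rightarrow> (('i \<Rightarrow> complex) \<Rightarrow> complex) set \<Rightarrow> ('i \<Rightarrow> complex) set set" where
  "zero_locus I \<F> = {p \<in> proj_space I. \<forall>F\<in>\<F>. \<forall>x\<in>p. F x = 0}"

lemma zariski_closed_iff: "zariski_closed I Z \<longleftrightarrow> (\<exists>\<F>\<subseteq>forms I. Z = zero_locus I \<F>)"
  by (simp add: zariski_closed_def zero_locus_def)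

lemma zariski_closed_zero_locus: "\<F> \<subseteq> forms I \<Longrightarrow> zariski_closed I (zero_locus I \<F>)"
  by (auto simp: zariski_closed_iff)

lemma zariski_closure_eq:
  assumes "S \<subseteq> proj_space I"
  shows "zariski_closure I S = zero_locus I (vanishing_forms I S)"
  unfolding zariski_closure_def
proof (rule hull_unique)
  show "S \<subseteq> zero_locus I (vanishing_forms I S)"
    using assms by (auto simp: zero_locus_def vanishing_forms_def)
  show "zariski_closed I (zero_locus I (vanishing_forms I S))"
    by (rule zariski_closed_zero_locus) (auto simp: vanishing_forms_def)
next
  fix T assume T: "S \<subseteq> T" "zariski_closed I T"
  then obtain \<F> where \<F>: "\<F> \<subseteq> forms I" "T = zero_locus I \<F>" by (auto simp: zariski_closed_iff)
  with T have "\<F> \<subseteq> vanishing_forms I S" by (auto simp: zero_locus_def vanishing_forms_def)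
  with \<F> show "zero_locus I (vanishing_forms I S) \<subseteq> T" by (auto simp: zero_locus_def)
qed

lemma zariski_closed_closure: "S \<subseteq> proj_space I \<Longrightarrow> zariski_closed I (zariski_closure I S)"
  by (auto simp: zariski_closure_eq vanishing_forms_def intro!: zariski_closed_zero_locus)

lemma subset_zariski_closure: "S \<subseteq> zariski_closure I S"
  by (simp add: zariski_closure_def hull_subset)

lemma zariski_closure_minimal:
  "S \<subseteq> T \<Longrightarrow> zariski_closed I T \<Longrightarrow> zariski_closure I S \<subseteq> T"
  by (simp add: zariski_closure_def hull_minimal)

lemma zariski_closed_subset: "zariski_closed I Z \<Longrightarrow> Z \<subseteq> proj_space I"
  by (auto simp: zariski_closed_def)

lemma zariski_closed_Int_zero:
  assumes "zariski_closed I Z" and "F \<in> forms I"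
  shows "zariski_closed I {p \<in> Z. \<forall>x\<in>p. F x = 0}"
proof -
  from assms obtain \<F> where \<F>: "\<F> \<subseteq> forms I" "Z = zero_locus I \<F>"
    by (auto simp: zariski_closed_iff)
  then have "{p \<in> Z. \<forall>x\<in>p. F x = 0} = zero_locus I (insert F \<F>)"
    by (auto simp: zero_locus_def)
  with \<F> assms(2) show ?thesis by (simp add: zariski_closed_zero_locus)
qed

text \<open>If the product vanishes, the zero sets of \<open>F\<close> and \<open>G\<close> cover
  \<open>Z\<close>, and one of them must be all of \<open>Z\<close>. This is the cancellation law of
  the homogeneous coordinate ring.\<close>

lemma zariski_irreducible_no_zero_divisors:
  assumes "finite I" and irr: "zariski_irreducible I Z"
    and "F \<in> forms I" and "G \<in> forms I" and FG: "\<And>x. x \<in> \<Union>Z \<Longrightarrow> F x * G x = 0"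
  shows "(\<forall>x\<in>\<Union>Z. F x = 0) \<or> (\<forall>x\<in>\<Union>Z. G x = 0)"
proof -
  let ?A = "{p \<in> Z. \<forall>x\<in>p. F x = 0}" and ?B = "{p \<in> Z. \<forall>x\<in>p. G x = 0}"
  have closed: "zariski_closed I Z" using irr by (simp add: zariski_irreducible_def)
  have "Z = ?A \<union> ?B"
  proof (intro equalityI subsetI)
    fix p assume p: "p \<in> Z"
    then have "p \<in> proj_space I" using zariski_closed_subset[OF closed] by blast
    then obtain x where x: "p = proj_point x" by (rule proj_spaceE)
    then have "F x * G x = 0" using FG p self_mem_proj_point by fastforce
    then show "p \<in> ?A \<union> ?B"
      using x p forms_vanish_proj_point[OF assms(1)] assms(3,4) by auto
  qed auto
  moreover have "zariski_closed I ?A" "zariski_closed I ?B"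
    using assms closed by (auto intro!: zariski_closed_Int_zero)
  ultimately have "Z = ?A \<or> Z = ?B" using irr unfolding zariski_irreducible_def by blast
  then show ?thesis by auto
qed

lemma poly_nonroot:
  fixes q :: "complex poly"
  assumes "q \<noteq> 0"
  obtains t where "poly q t \<noteq> 0"
  using assms poly_all_0_iff_0[of q] by blast

text \<open>If the closure were a union of two proper closed parts, some form \<open>F\<close> of
  the first and some form \<open>G\<close> of the second would be nonzero at points \<open>x\<close>
  and \<open>y\<close> of \<open>S\<close>. On a curve from \<open>x\<close> to \<open>y\<close>
  both restrict to nonzero polynomials, hence both are nonzero at a common parameter, and that point
  of \<open>S\<close> lies in neither part.\<close>

lemma zariski_irreducible_closure_if_poly_connected:
  assumes "finite I" and "S \<noteq> {}" and S: "S \<subseteq> coord_vectors I - {\<lambda>i. 0}"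
    and conn: "\<And>x y. x \<in> S \<Longrightarrow> y \<in> S \<Longrightarrow>
      \<exists>\<gamma>. poly_curve \<gamma> \<and> \<gamma> 0 = x \<and> \<gamma> 1 = y \<and> range \<gamma> \<subseteq> S"
  shows "zariski_irreducible I (zariski_closure I (proj_point ` S))"
proof -
  let ?Z = "zariski_closure I (proj_point ` S)"
  have sub: "proj_point ` S \<subseteq> proj_space I" using S by (auto simp: proj_space_def)
  have witness: "\<exists>F\<in>\<F>. \<exists>x\<in>S. F x \<noteq> 0"
    if "\<F> \<subseteq> forms I" "?Z \<noteq> zero_locus I \<F>" "zero_locus I \<F> \<subseteq> ?Z" for \<F>
  proof (rule ccontr)
    assume "\<not> (\<exists>F\<in>\<F>. \<exists>x\<in>S. F x \<noteq> 0)"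
    then have "\<forall>y\<in>proj_point x. F y = 0" if "x \<in> S" "F \<in> \<F>" for x F
      using that \<open>\<F> \<subseteq> forms I\<close> forms_vanish_proj_point[OF assms(1), of F x] by auto
    with sub have "proj_point ` S \<subseteq> zero_locus I \<F>" by (auto simp: zero_locus_def)
    then have "?Z \<subseteq> zero_locus I \<F>"
      by (rule zariski_closure_minimal) (rule zariski_closed_zero_locus[OF that(1)])
    with that show False by auto
  qed
  have "?Z = A \<or> ?Z = B" if AB: "zariski_closed I A" "zariski_closed I B" "?Z = A \<union> B" for A B
  proof (rule ccontr)
    assume "\<not> (?Z = A \<or> ?Z = B)"
    with AB obtain \<A> \<B> where \<A>: "\<A> \<subseteq> forms I" "A = zero_locus I \<A>"
      and \<B>: "\<B> \<subseteq> forms I" "B = zero_locus I \<B>" and ne: "?Z \<noteq> A" "?Z \<noteq> B"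
      unfolding zariski_closed_iff by blast
    obtain F x where F: "F \<in> \<A>" "x \<in> S" "F x \<noteq> 0"
      using witness[OF \<A>(1)] ne \<A>(2) AB(3) by auto
    obtain G y where G: "G \<in> \<B>" "y \<in> S" "G y \<noteq> 0"
      using witness[OF \<B>(1)] ne \<B>(2) AB(3) by auto
    obtain \<gamma> where \<gamma>: "poly_curve \<gamma>" "\<gamma> 0 = x" "\<gamma> 1 = y" "range \<gamma> \<subseteq> S"
      using conn[OF F(2) G(2)] by blast
    obtain d e where "F \<in> hforms I d" "G \<in> hforms I e"
      using F(1) G(1) \<A>(1) \<B>(1) unfolding forms_eq_hforms[OF assms(1)] by blast
    then obtain p q where p: "\<And>t. F (\<gamma> t) = poly p t" and q: "\<And>t. G (\<gamma> t) = poly q t"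
      using hforms_poly_curve[OF _ \<gamma>(1)] by metis
    have "p \<noteq> 0" "q \<noteq> 0" using p[of 0] q[of 1] F G \<gamma> by auto
    then obtain t where "poly (p * q) t \<noteq> 0" using poly_nonroot[of "p * q"] by auto
    then have "F (\<gamma> t) \<noteq> 0" "G (\<gamma> t) \<noteq> 0" by (auto simp: p q)
    moreover have "proj_point (\<gamma> t) \<in> A \<union> B"
      using \<gamma>(4) AB(3) subset_zariski_closure[of "proj_point ` S" I] by auto
    ultimately show False
      using F(1) G(1) \<A>(2) \<B>(2) self_mem_proj_point[of "\<gamma> t"] by (auto simp: zero_locus_def)
  qed
  moreover have "?Z \<noteq> {}" using subset_zariski_closure[of "proj_point ` S" I] assms(2) by auto
  ultimately show ?thesis
    using zariski_closed_closure[OF sub] by (simp add: zariski_irreducible_def)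
qed

text \<open>Says that the Hilbert function of \<open>S\<close> in degree \<open>d\<close> is at
  least \<open>m\<close>: the forms are independent as functions on \<open>S\<close>, not merely as
  polynomials.\<close>

definition indep_forms :: "'i set \<Rightarrow> ('i \<Rightarrow> complex) set \<Rightarrow> nat \<Rightarrow> nat \<Rightarrow> bool" where
  "indep_forms I S d m \<longleftrightarrow> (\<exists>f. (\<forall>i<m. f i \<in> hforms I d) \<and>
     (\<forall>c. (\<forall>x\<in>S. (\<Sum>i<m. c i * f i x) = 0) \<longrightarrow> (\<forall>i<m. c i = 0)))"

lemma indep_forms_subset: "indep_forms I S d m \<Longrightarrow> S \<subseteq> T \<Longrightarrow> indep_forms I T d m"
  unfolding indep_forms_def by (elim ex_forward conj_forward all_forward imp_forward) auto

text \<open>The new family consists of the old forms times \<open>G\<close> and of the forms that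
  are independent on \<open>Z0\<close>. Restricting a vanishing combination to \<open>Z0\<close>,
  where \<open>G\<close> is zero, kills the second half of the coefficients. What remains is
  \<open>G\<close> times a form, and irreducibility of \<open>Z\<close> cancels
  \<open>G\<close>.\<close>

lemma indep_forms_mult_add:
  assumes fin: "finite I" and irr: "zariski_irreducible I Z" and sub: "Z0 \<subseteq> Z"
    and G: "G \<in> hforms I e" and G0: "\<And>x. x \<in> \<Union>Z0 \<Longrightarrow> G x = 0"
    and Gn: "x0 \<in> \<Union>Z" "G x0 \<noteq> 0"
    and ind: "indep_forms I (\<Union>Z) d m" and ind0: "indep_forms I (\<Union>Z0) (d + e) m0"
  shows "indep_forms I (\<Union>Z) (d + e) (m + m0)"
proof -
  from ind obtain f where f: "\<And>i. i < m \<Longrightarrow> f i \<in> hforms I d"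
    "\<And>c. (\<And>x. x \<in> \<Union>Z \<Longrightarrow> (\<Sum>i<m. c i * f i x) = 0) \<Longrightarrow> (\<forall>i<m. c i = 0)"
    unfolding indep_forms_def by metis
  from ind0 obtain g where g: "\<And>i. i < m0 \<Longrightarrow> g i \<in> hforms I (d + e)"
    "\<And>c. (\<And>x. x \<in> \<Union>Z0 \<Longrightarrow> (\<Sum>i<m0. c i * g i x) = 0) \<Longrightarrow> (\<forall>i<m0. c i = 0)"
    unfolding indep_forms_def by metis
  define h where "h i = (if i < m then (\<lambda>x. f i x * G x) else g (i - m))" for i
  have split: "(\<Sum>i<m + m0. c i * h i x) =
    G x * (\<Sum>i<m. c i * f i x) + (\<Sum>i<m0. c (m + i) * g i x)" for c x
  proof -
    have "(\<Sum>i<m + m0. c i * h i x) = (\<Sum>i<m. c i * h i x) + (\<Sum>i<m0. c (m + i) * h (m + i) x)"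
      by (induction m0) (auto simp: algebra_simps)
    then show ?thesis by (simp add: h_def sum_distrib_left mult_ac)
  qed
  have "\<forall>i<m + m0. c i = 0" if c: "\<And>x. x \<in> \<Union>Z \<Longrightarrow> (\<Sum>i<m + m0. c i * h i x) = 0" for c
  proof -
    have "(\<Sum>i<m0. c (m + i) * g i x) = 0" if "x \<in> \<Union>Z0" for x
      using c[of x] split[of c x] G0[OF that] that sub by auto
    from g(2)[OF this] have c0: "\<forall>i<m0. c (m + i) = 0" by blast
    then have "G x * (\<Sum>i<m. c i * f i x) = 0" if "x \<in> \<Union>Z" for x
      using c[OF that] split[of c x] by auto
    moreover have "(\<lambda>x. \<Sum>i<m. c i * f i x) \<in> hforms I d"
      using f(1) by (intro poly_span_sum poly_span_scale) auto
    ultimately have "\<forall>x\<in>\<Union>Z. (\<Sum>i<m. c i * f i x) = 0"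
      using zariski_irreducible_no_zero_divisors[OF fin irr, of G "\<lambda>x. \<Sum>i<m. c i * f i x"]
        G Gn fin by (auto simp: forms_eq_hforms)
    then have "\<forall>i<m. c i = 0" using f(2) by blast
    show ?thesis
    proof (intro allI impI)
      fix i assume "i < m + m0"
      then show "c i = 0"
        using c0[rule_format, of "i - m"] \<open>\<forall>i<m. c i = 0\<close> by (cases "i < m") auto
    qed
  qed
  moreover have "\<forall>i<m + m0. h i \<in> hforms I (d + e)"
    using f(1) g(1) hforms_mult[OF _ G] by (auto simp: h_def)
  ultimately show ?thesis unfolding indep_forms_def by blast
qed

lemma indep_forms_one:
  assumes "finite I" and "Z \<subseteq> proj_space I" and "Z \<noteq> {}"
  shows "indep_forms I (\<Union>Z) d 1"
proof -
  obtain p where p: "p \<in> Z" using assms(3) by blast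
  with assms(2) obtain x where x: "p = proj_point x" "x \<in> coord_vectors I" "x \<noteq> (\<lambda>i. 0)"
    using proj_spaceE by blast
  then obtain i where i: "x i \<noteq> 0" by auto
  with x have "i \<in> I" by (auto simp: coord_vectors_def)
  then have "(\<lambda>x. x i ^ d) \<in> hforms I d"
    using hforms_power[OF hforms_var[OF assms(1)], of i d] by simp
  moreover have "x \<in> \<Union>Z" using p x self_mem_proj_point by auto
  ultimately show ?thesis using i unfolding indep_forms_def
    by (intro exI[of _ "\<lambda>_ x. x i ^ d"]) auto
qed

text \<open>The Hilbert function of the top of a chain of irreducible sets grows at least as fast as that
  of projective space of the same dimension; the recursion is Pascal's rule.\<close>

lemma chain_indep_forms:
  assumes fin: "finite I"
    and irr: "\<And>j. j \<le> k \<Longrightarrow> zariski_irreducible I (C j)"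
    and strict: "\<And>j. j < k \<Longrightarrow> C j \<subset> C (Suc j)"
  obtains E where "\<And>d. indep_forms I (\<Union>(C k)) (E * d) ((d + k) choose k)"
proof -
  have closed: "zariski_closed I (C j)" and ne: "C j \<noteq> {}" if "j \<le> k" for j
    using irr[OF that] by (auto simp: zariski_irreducible_def)
  have ps: "C j \<subseteq> proj_space I" if "j \<le> k" for j
    using closed[OF that] by (rule zariski_closed_subset)
  have "\<exists>e G. G \<in> hforms I e \<and> (\<forall>x\<in>\<Union>(C j). G x = 0) \<and> (\<exists>x\<in>\<Union>(C (Suc j)). G x \<noteq> 0)"
    if "j < k" for j
  proof -
    obtain \<F> where \<F>: "\<F> \<subseteq> forms I" "C j = zero_locus I \<F>"
      using closed[of j] \<open>j < k\<close> by (auto simp: zariski_closed_iff)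
    obtain p where "p \<in> C (Suc j)" "p \<notin> C j" using strict[OF \<open>j < k\<close>] by blast
    moreover from this have "p \<in> proj_space I" using ps[of "Suc j"] \<open>j < k\<close> by auto
    ultimately obtain F x where "F \<in> \<F>" "x \<in> p" "F x \<noteq> 0"
      using \<F>(2) by (auto simp: zero_locus_def)
    with \<open>p \<in> C (Suc j)\<close> \<F> fin show ?thesis
      by (auto simp: zero_locus_def forms_eq_hforms) blast
  qed
  then obtain e G where G: "\<And>j. j < k \<Longrightarrow> G j \<in> hforms I (e j)"
    "\<And>j x. j < k \<Longrightarrow> x \<in> \<Union>(C j) \<Longrightarrow> G j x = 0"
    "\<And>j. j < k \<Longrightarrow> \<exists>x\<in>\<Union>(C (Suc j)). G j x \<noteq> 0"
    by metis
  \<comment> \<open>A form of degree 0 is constant, so it cannot vanish on the nonempty set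
    \<open>C j\<close> and be nonzero on the next one.\<close>
  have e: "e j > 0" if "j < k" for j
  proof (rule ccontr)
    assume "\<not> e j > 0"
    then have const: "G j (\<lambda>i. 0 * x i) = G j x" for x
      using hforms_homogeneous[OF G(1)[OF that], of 0 x] by simp
    have "C j \<noteq> {}" "C j \<subseteq> proj_space I" using ne[of j] ps[of j] \<open>j < k\<close> by auto
    then obtain p where "p \<in> C j" "p \<in> proj_space I" by blast
    then obtain x where "x \<in> \<Union>(C j)" using self_mem_proj_point by (blast elim: proj_spaceE)
    with const[of x] G(2)[OF that] have "G j (\<lambda>i. 0) = 0" by auto
    with const G(3)[OF that] show False by auto
  qed
  \<comment> \<open>Suitable powers bring all separating forms to one common degree
    \<open>E\<close>, so that each step of the recursion shifts the degree by the same
    amount.\<close>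
  define E where "E = (\<Prod>j<k. e j)"
  define H where "H j = (\<lambda>x. G j x ^ (E div e j))" for j
  have "E > 0" using e by (simp add: E_def prod_pos)
  have H: "H j \<in> hforms I E" "\<And>x. x \<in> \<Union>(C j) \<Longrightarrow> H j x = 0"
    "\<exists>x\<in>\<Union>(C (Suc j)). H j x \<noteq> 0" if "j < k" for j
  proof -
    have dvd: "e j dvd E" using that by (auto simp: E_def intro!: dvd_prodI)
    then show "H j \<in> hforms I E"
      using hforms_power[OF G(1)[OF that], of "E div e j"] by (simp add: H_def)
    have "E div e j \<noteq> 0" using dvd \<open>E > 0\<close> by (auto elim: dvdE)
    then show "\<And>x. x \<in> \<Union>(C j) \<Longrightarrow> H j x = 0" using G(2)[OF that] by (simp add: H_def)
    show "\<exists>x\<in>\<Union>(C (Suc j)). H j x \<noteq> 0"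
      using G(3)[OF that] unfolding H_def by (metis power_not_zero)
  qed
  have "indep_forms I (\<Union>(C j)) (E * d) ((d + j) choose j)" if "j \<le> k" for j d
    using that
  proof (induction j arbitrary: d)
    case 0
    then show ?case using indep_forms_one[OF fin ps ne] by simp
  next
    case (Suc j)
    note IH = Suc.IH
    show ?case
    proof (induction d)
      case 0
      then show ?case using indep_forms_one[OF fin ps ne] Suc.prems by simp
    next
      case (Suc d)
      from \<open>Suc j \<le> k\<close> have j: "j < k" by simp
      obtain x0 where x0: "x0 \<in> \<Union>(C (Suc j))" "H j x0 \<noteq> 0" using H(3)[OF j] by blast
      have "indep_forms I (\<Union>(C j)) (E * d + E) ((Suc d + j) choose j)"
        using IH[of "Suc d"] j by (simp add: algebra_simps)
      from indep_forms_mult_add[OF fin irr[OF \<open>Suc j \<le> k\<close>] psubset_imp_subset[OF strict[OF j]]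
          H(1,2)[OF j] x0 Suc this]
      show ?case by (simp add: algebra_simps)
    qed
  qed
  from that[OF this[OF order_refl]] show thesis .
qed

section \<open>Rank normal form\<close>

lemma index_mult_mat_sum:
  "A \<in> carrier_mat nr m \<Longrightarrow> B \<in> carrier_mat m nc \<Longrightarrow> i < nr \<Longrightarrow> j < nc \<Longrightarrow>
    (A * B) $$ (i, j) = (\<Sum>k<m. A $$ (i, k) * B $$ (k, j))"
  by (simp add: scalar_prod_def atLeast0LessThan)

lemma det_zero_row:
  fixes A :: "'a::comm_ring_1 mat"
  assumes "A \<in> carrier_mat n n" and "i < n" and "\<And>j. j < n \<Longrightarrow> A $$ (i, j) = 0"
  shows "det A = 0"
  using laplace_expansion_row[OF assms(1,2)] assms(3) by simp

text \<open>Padding both factors by zeros to square matrices leaves the product unchanged, and the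
  padded right factor has a zero row.\<close>

lemma det_mult_lt:
  fixes X :: "'a::comm_ring_1 mat"
  assumes X: "X \<in> carrier_mat k m" and Y: "Y \<in> carrier_mat m k" and "m < k"
  shows "det (X * Y) = 0"
proof -
  define X' where "X' = mat k k (\<lambda>(i, j). if j < m then X $$ (i, j) else 0)"
  define Y' where "Y' = mat k k (\<lambda>(i, j). if i < m then Y $$ (i, j) else 0)"
  have c: "X' \<in> carrier_mat k k" "Y' \<in> carrier_mat k k" by (auto simp: X'_def Y'_def)
  have "X * Y = X' * Y'"
  proof (rule eq_matI)
    fix i j assume "i < dim_row (X' * Y')" "j < dim_col (X' * Y')"
    then have ij: "i < k" "j < k" using c by auto
    have "(\<Sum>l<k. X' $$ (i, l) * Y' $$ (l, j)) = (\<Sum>l<m. X $$ (i, l) * Y $$ (l, j))"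
      by (rule sum.mono_neutral_cong_right) (use ij \<open>m < k\<close> in \<open>auto simp: X'_def Y'_def\<close>)
    then show "(X * Y) $$ (i, j) = (X' * Y') $$ (i, j)"
      using index_mult_mat_sum[OF X Y ij] index_mult_mat_sum[OF c ij] by simp
  qed (use X Y c in auto)
  moreover have "det Y' = 0"
    by (rule det_zero_row[of _ k m]) (use \<open>m < k\<close> in \<open>auto simp: Y'_def\<close>)
  ultimately show ?thesis using det_mult[OF c] by simp
qed

text \<open>The inverse is carried along explicitly, so products, transposes and cancellations need
  no inverse to be chosen.\<close>

definition inverse_pair :: "nat \<Rightarrow> 'a::field mat \<Rightarrow> 'a mat \<Rightarrow> bool" where
  "inverse_pair n P P' \<longleftrightarrow> P \<in> carrier_mat n n \<and> P' \<in> carrier_mat n n \<and> P * P' = 1\<^sub>m n \<and> P' * P = 1\<^sub>m n"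

lemma inverse_pairD:
  assumes "inverse_pair n P P'"
  shows "P \<in> carrier_mat n n" "P' \<in> carrier_mat n n" "P * P' = 1\<^sub>m n" "P' * P = 1\<^sub>m n"
  using assms by (auto simp: inverse_pair_def)

lemma inverse_pair_sym: "inverse_pair n P P' \<Longrightarrow> inverse_pair n P' P"
  by (auto simp: inverse_pair_def)

lemma inverse_pair_transpose:
  assumes "inverse_pair n P P'"
  shows "inverse_pair n (P\<^sup>T) (P'\<^sup>T)"
proof -
  note P = inverse_pairD[OF assms]
  have "P\<^sup>T * P'\<^sup>T = (P' * P)\<^sup>T" "P'\<^sup>T * P\<^sup>T = (P * P')\<^sup>T"
    using transpose_mult[OF P(2,1)] transpose_mult[OF P(1,2)] by simp_all
  with P show ?thesis by (simp add: inverse_pair_def)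
qed

lemma inverse_pair_cancel:
  assumes "inverse_pair n P P'" and "X \<in> carrier_mat n m"
  shows "P * (P' * X) = X"
  using inverse_pairD[OF assms(1)] assms(2) assoc_mult_mat[of P n n P' n X m] by simp

lemma inverse_pair_cancel_right:
  assumes "inverse_pair n P P'" and "X \<in> carrier_mat m n"
  shows "X * P * P' = X"
  using inverse_pairD[OF assms(1)] assms(2) assoc_mult_mat[of X m n P n P' n] by simp

lemma Units_inverse_pair:
  assumes "P \<in> Units (ring_mat TYPE('a::field) n b)"
  obtains P' where "inverse_pair n P P'"
proof -
  from assms have "\<exists>P'. inverse_pair n P P'"
    unfolding Units_def ring_mat_def inverse_pair_def by auto
  with that show thesis by blast
qed

lemma inverse_pair_exists:
  assumes "P \<in> carrier_mat n n" and "det P \<noteq> (0::'a::field)"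
  obtains P' where "inverse_pair n P P'"
  by (rule Units_inverse_pair[OF det_non_zero_imp_unit[OF assms, of "()"]]) (rule that)

text \<open>Rectangular shapes are allowed because the same matrix also serves as inclusion
  \<open>rank_form n p p\<close> and as projection \<open>rank_form p n p\<close> onto the first
  \<open>p\<close> coordinates.\<close>

definition rank_form :: "nat \<Rightarrow> nat \<Rightarrow> nat \<Rightarrow> 'a::field mat" where
  "rank_form nr nc q = mat nr nc (\<lambda>(i, j). if i = j \<and> i < q then 1 else 0)"

lemma rank_form_carrier [simp]:
  "rank_form nr nc q \<in> carrier_mat nr nc"
  "dim_row (rank_form nr nc q) = nr" "dim_col (rank_form nr nc q) = nc"
  by (auto simp: rank_form_def)

lemma index_rank_form [simp]:
  "i < nr \<Longrightarrow> j < nc \<Longrightarrow> rank_form nr nc q $$ (i, j) = (if i = j \<and> i < q then 1 else 0)"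
  by (simp add: rank_form_def)

lemma transpose_rank_form: "(rank_form nr nc q)\<^sup>T = rank_form nc nr q"
  by (rule eq_matI) auto

lemma index_rank_form_mult:
  assumes "X \<in> carrier_mat m nc" and "i < nr" and "j < nc" and "q \<le> m"
  shows "(rank_form nr m q * X) $$ (i, j) = (if i < q then X $$ (i, j) else 0)"
proof -
  have "(\<Sum>k<m. rank_form nr m q $$ (i, k) * X $$ (k, j)) =
      (\<Sum>k<m. if k = i then (if i < q then X $$ (i, j) else 0) else 0)"
    by (rule sum.cong) (use assms in auto)
  with assms show ?thesis by (simp add: index_mult_mat_sum[of _ nr m X nc] del: index_mult_mat)
qed

lemma rank_form_mult:
  assumes "q \<le> m"
  shows "rank_form nr m q * rank_form m nc q = rank_form nr nc q"
proof (rule eq_matI)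
  fix i j
  assume "i < dim_row (rank_form nr nc q)" "j < dim_col (rank_form nr nc q)"
  then have "i < nr" "j < nc" by auto
  with assms show "(rank_form nr m q * rank_form m nc q) $$ (i, j) = rank_form nr nc q $$ (i, j)"
    using index_rank_form_mult[of "rank_form m nc q" m nc i nr j q] by (auto simp del: index_mult_mat(1))
qed auto

lemma index_mult_rank_form:
  assumes "X \<in> carrier_mat nr m" and "i < nr" and "j < nc" and "q \<le> m"
  shows "(X * rank_form m nc q) $$ (i, j) = (if j < q then X $$ (i, j) else 0)"
proof -
  have "(\<Sum>k<m. X $$ (i, k) * rank_form m nc q $$ (k, j)) =
      (\<Sum>k<m. if k = j then (if j < q then X $$ (i, j) else 0) else 0)"
    by (rule sum.cong) (use assms in auto)
  with assms show ?thesis by (simp add: index_mult_mat_sum[of X nr m _ nc] del: index_mult_mat)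
qed

text \<open>Row reduction leaves two cases. Either every column has a pivot and the reduced matrix
  is an identity block above zeros, or all rows from index \<open>q - 1\<close> on vanish, which
  will let \<open>U\<close> factor through a smaller inner dimension. If \<open>nr < q\<close>, the
  second case holds vacuously.\<close>

lemma rank_form_left_or_drop:
  fixes U :: "'a::field mat"
  assumes U: "U \<in> carrier_mat nr q"
  obtains H H' where "inverse_pair nr H H'" and
    "q \<le> nr \<and> H * U = rank_form nr q q \<or>
     0 < q \<and> (\<forall>i<nr. q \<le> Suc i \<longrightarrow> (\<forall>j<q. (H * U) $$ (i, j) = 0))"
proof (cases "q = 0")
  case True
  have "inverse_pair nr (1\<^sub>m nr) (1\<^sub>m nr :: 'a mat)" by (auto simp: inverse_pair_def)
  moreover have "1\<^sub>m nr * U = rank_form nr q q" using U True by (intro eq_matI) auto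
  ultimately show thesis using that True by blast
next
  case False
  obtain R R' where R: "gauss_jordan U (0\<^sub>m nr 0) = (R, R')" by (cases "gauss_jordan U (0\<^sub>m nr 0)")
  obtain H where unit: "H \<in> Units (ring_mat TYPE('a) nr ())" and HU: "R = H * U"
    using gauss_jordan_transform[OF U zero_carrier_mat R, of "()"] by blast
  obtain H' where H: "inverse_pair nr H H'" by (rule Units_inverse_pair[OF unit])
  have Rc: "R \<in> carrier_mat nr q" using gauss_jordan_carrier[OF U zero_carrier_mat R] by simp
  obtain f where f: "pivot_fun R f q"
    using gauss_jordan_row_echelon[OF U R] Rc by (auto simp: row_echelon_form_def)
  have dr: "dim_row R = nr" using Rc by simp
  note piv = pivot_funD[OF dr f]
  note bound = pivot_bound[OF dr f]
  show thesis
  proof (cases "q \<le> nr \<and> f (q - 1) = q - 1")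
    case True
    \<comment> \<open>Pivot positions increase strictly, so \<open>f j\<close> is at least
      \<open>j\<close>; since row \<open>q - 1\<close> has its pivot at \<open>q - 1\<close>, it is
      also at most \<open>j\<close>.\<close>
    have fj: "f j = j" if "j < q" for j
    proof -
      have 1: "f j = q \<or> f j \<ge> j" using bound[of 0 j] that True by auto
      have "f (q - 1) = q \<or> f (q - 1) \<ge> (q - 1 - j) + f j"
        using bound[of j "q - 1 - j"] that True by auto
      with True that have "f j \<le> j" by auto
      with 1 that show ?thesis by auto
    qed
    have "R = rank_form nr q q"
    proof (rule eq_matI)
      fix i j assume "i < dim_row (rank_form nr q q :: 'a mat)" "j < dim_col (rank_form nr q q :: 'a mat)"
      then have ij: "i < nr" "j < q" by auto
      then have "j < nr" using True by simp
      with piv(4)[of j] piv(5)[of j i] fj[OF ij(2)] ij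
      show "R $$ (i, j) = rank_form nr q q $$ (i, j)" by auto
    qed (use Rc in auto)
    with that[OF H] HU True show thesis by simp
  next
    case no: False
    \<comment> \<open>For a pivot function the value \<open>q\<close> marks a zero row. Row
      \<open>q - 1\<close> is forced to be zero, and with it every later row.\<close>
    have "R $$ (i, j) = 0" if i: "i < nr" "q \<le> Suc i" and j: "j < q" for i j
    proof -
      have "q - 1 < nr" using i False by auto
      then have q: "q \<le> nr" "f (q - 1) \<noteq> q - 1" "f (q - 1) \<le> q" using no piv(1)[of "q - 1"] by auto
      moreover have "f (q - 1) = q \<or> f (q - 1) \<ge> q - 1" using bound[of 0 "q - 1"] \<open>q - 1 < nr\<close> by auto
      ultimately have "f (q - 1) = q" by auto
      then have "f i = q \<or> f i \<ge> (i - (q - 1)) + q" using bound[of "q - 1" "i - (q - 1)"] i by auto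
      with piv(1)[OF i(1)] have "f i = q" by auto
      with piv(2)[OF i(1), of j] j show ?thesis by simp
    qed
    with that[OF H] HU False show thesis by simp
  qed
qed

text \<open>In \<open>U = H' * (H * U)\<close> only the first \<open>q - 1\<close> rows of the right
  factor are nonzero, so only the first \<open>q - 1\<close> columns of \<open>H'\<close>
  contribute. The guards \<open>k < nr\<close> pad by zeros when \<open>q - 1\<close> exceeds
  \<open>nr\<close>.\<close>

lemma factor_drop:
  fixes U :: "'a::field mat"
  assumes U: "U \<in> carrier_mat nr q" and H: "inverse_pair nr H H'" and "0 < q"
    and zero: "\<And>i j. i < nr \<Longrightarrow> q \<le> Suc i \<Longrightarrow> j < q \<Longrightarrow> (H * U) $$ (i, j) = 0"
  obtains U1 V1 where "U1 \<in> carrier_mat nr (q - 1)" "V1 \<in> carrier_mat (q - 1) q" "U = U1 * V1"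
proof -
  note Hc = inverse_pairD[OF H]
  define U1 where "U1 = mat nr (q - 1) (\<lambda>(i, k). if k < nr then H' $$ (i, k) else 0)"
  define V1 where "V1 = mat (q - 1) q (\<lambda>(k, j). if k < nr then (H * U) $$ (k, j) else 0)"
  have c: "U1 \<in> carrier_mat nr (q - 1)" "V1 \<in> carrier_mat (q - 1) q" by (auto simp: U1_def V1_def)
  have HU: "H * U \<in> carrier_mat nr q" using Hc(1) U by simp
  have "U = U1 * V1"
  proof (rule eq_matI)
    fix i j assume "i < dim_row (U1 * V1)" "j < dim_col (U1 * V1)"
    then have ij: "i < nr" "j < q" using c by auto
    let ?s = "\<lambda>k. H' $$ (i, k) * (H * U) $$ (k, j)"
    have "(\<Sum>k<q - 1. U1 $$ (i, k) * V1 $$ (k, j)) = (\<Sum>k\<in>{..<q - 1} \<inter> {..<nr}. ?s k)"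
      by (rule sum.mono_neutral_cong_right)
        (use ij in \<open>auto simp: U1_def V1_def simp del: index_mult_mat\<close>)
    also have "\<dots> = (\<Sum>k<nr. ?s k)"
    proof (rule sum.mono_neutral_left)
      have "(H * U) $$ (k, j) = 0" if "k < nr" "\<not> k < q - 1" for k
        using that by (intro zero) (use ij in auto)
      then show "\<forall>k\<in>{..<nr} - {..<q - 1} \<inter> {..<nr}. ?s k = 0" by auto
    qed auto
    also have "\<dots> = (H' * (H * U)) $$ (i, j)" using index_mult_mat_sum[OF Hc(2) HU ij] by simp
    also have "H' * (H * U) = U" by (rule inverse_pair_cancel[OF inverse_pair_sym[OF H] U])
    finally show "U $$ (i, j) = (U1 * V1) $$ (i, j)" using index_mult_mat_sum[OF c ij] by simp
  qed (use U c in auto)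
  with c that show thesis by blast
qed

text \<open>A factorization \<open>A = U * W\<close> of least inner dimension \<open>q\<close> rules
  out the degenerate alternative of \<open>rank_form_left_or_drop\<close> for \<open>U\<close> and
  for the transpose of \<open>W\<close>. Both factors therefore reduce to identity blocks.\<close>

lemma rank_normal_form:
  fixes A :: "'a::field mat"
  assumes A: "A \<in> carrier_mat nr nc"
  obtains q P P' Q Q' where "q \<le> nr" "q \<le> nc" "inverse_pair nr P P'" "inverse_pair nc Q Q'"
    "A = P * rank_form nr nc q * Q"
proof -
  let ?fac = "\<lambda>q. \<exists>U W. U \<in> carrier_mat nr q \<and> W \<in> carrier_mat q nc \<and> A = U * W"
  have ex: "?fac nc" by (rule exI[of _ A], rule exI[of _ "1\<^sub>m nc"]) (use A in auto)
  define q where "q = (LEAST q. ?fac q)"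
  have "?fac q" unfolding q_def by (rule LeastI[of ?fac, OF ex])
  then obtain U W where UW: "U \<in> carrier_mat nr q" "W \<in> carrier_mat q nc" "A = U * W" by blast
  have min: "\<not> ?fac (q - 1)" if "0 < q"
    unfolding q_def by (rule not_less_Least) (use that in \<open>simp add: q_def\<close>)
  obtain H H' where H: "inverse_pair nr H H'" and
    H2: "q \<le> nr \<and> H * U = rank_form nr q q \<or>
     0 < q \<and> (\<forall>i<nr. q \<le> Suc i \<longrightarrow> (\<forall>j<q. (H * U) $$ (i, j) = 0))"
    by (rule rank_form_left_or_drop[OF UW(1)])
  have HU: "q \<le> nr" "H * U = rank_form nr q q"
  proof -
    have False if z: "0 < q" "\<forall>i<nr. q \<le> Suc i \<longrightarrow> (\<forall>j<q. (H * U) $$ (i, j) = 0)"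
    proof -
      obtain U1 V1 where 1: "U1 \<in> carrier_mat nr (q - 1)" "V1 \<in> carrier_mat (q - 1) q" "U = U1 * V1"
        by (rule factor_drop[OF UW(1) H z(1)]) (use z in auto)
      then have "A = U1 * (V1 * W)" using UW assoc_mult_mat[OF 1(1,2) UW(2)] by simp
      with 1 UW min[OF z(1)] show False by (metis mult_carrier_mat)
    qed
    with H2 show "q \<le> nr" "H * U = rank_form nr q q" by blast+
  qed
  have WT: "W\<^sup>T \<in> carrier_mat nc q" using UW(2) by simp
  obtain K K' where K: "inverse_pair nc K K'" and
    K2: "q \<le> nc \<and> K * W\<^sup>T = rank_form nc q q \<or>
     0 < q \<and> (\<forall>i<nc. q \<le> Suc i \<longrightarrow> (\<forall>j<q. (K * W\<^sup>T) $$ (i, j) = 0))"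
    by (rule rank_form_left_or_drop[OF WT])
  have KW: "q \<le> nc" "K * W\<^sup>T = rank_form nc q q"
  proof -
    have False if z: "0 < q" "\<forall>i<nc. q \<le> Suc i \<longrightarrow> (\<forall>j<q. (K * W\<^sup>T) $$ (i, j) = 0)"
    proof -
      obtain U1 V1 where 1: "U1 \<in> carrier_mat nc (q - 1)" "V1 \<in> carrier_mat (q - 1) q" "W\<^sup>T = U1 * V1"
        by (rule factor_drop[OF WT K z(1)]) (use z in auto)
      then have "W = V1\<^sup>T * U1\<^sup>T" using transpose_mult[OF 1(1,2)] by (metis transpose_transpose)
      then have "A = (U * V1\<^sup>T) * U1\<^sup>T"
        using UW 1 assoc_mult_mat[of U nr q "V1\<^sup>T" "q - 1" "U1\<^sup>T" nc] by simp
      moreover have "U * V1\<^sup>T \<in> carrier_mat nr (q - 1)" "U1\<^sup>T \<in> carrier_mat (q - 1) nc"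
        using 1 UW by auto
      ultimately show False using min[OF z(1)] by blast
    qed
    with K2 show "q \<le> nc" "K * W\<^sup>T = rank_form nc q q" by blast+
  qed
  note Hc = inverse_pairD[OF H] and Kc = inverse_pairD[OF K]
  have U: "U = H' * rank_form nr q q"
    using inverse_pair_cancel[OF inverse_pair_sym[OF H] UW(1)] HU by simp
  have "W\<^sup>T = K' * rank_form nc q q"
    using inverse_pair_cancel[OF inverse_pair_sym[OF K] WT] KW by simp
  then have W: "W = rank_form q nc q * K'\<^sup>T"
    using transpose_mult[OF Kc(2), of "rank_form nc q q" q] transpose_rank_form
    by (metis rank_form_carrier(1) transpose_transpose)
  have "A = H' * rank_form nr q q * (rank_form q nc q * K'\<^sup>T)" using UW U W by simp
  also have "\<dots> = H' * (rank_form nr q q * rank_form q nc q) * K'\<^sup>T"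
    using Hc Kc assoc_mult_mat[of "H' * rank_form nr q q" nr q "rank_form q nc q" nc "K'\<^sup>T" nc]
      assoc_mult_mat[of H' nr nr "rank_form nr q q" q "rank_form q nc q" nc] by simp
  finally have "A = H' * rank_form nr nc q * K'\<^sup>T" by (simp add: rank_form_mult)
  with that[OF HU(1) KW(1) inverse_pair_sym[OF H] inverse_pair_sym[OF inverse_pair_transpose[OF K]]]
  show thesis .
qed

text \<open>Undoing \<open>P\<close> and \<open>Q\<close> and cutting out the leading block writes
  the identity of size \<open>q\<close> as a product through dimension \<open>m\<close>. For
  \<open>m < q\<close> its determinant would be 0 by \<open>det_mult_lt\<close>.\<close>

lemma rank_form_inner_dim:
  fixes U :: "'a::field mat"
  assumes P: "inverse_pair nr P P'" and Q: "inverse_pair nc Q Q'" and q: "q \<le> nr" "q \<le> nc"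
    and eq: "P * rank_form nr nc q * Q = U * W"
    and U: "U \<in> carrier_mat nr m" and W: "W \<in> carrier_mat m nc"
  shows "q \<le> m"
proof (rule ccontr)
  assume "\<not> q \<le> m"
  note Pc = inverse_pairD[OF P] and Qc = inverse_pairD[OF Q]
  define X where "X = rank_form q nr q * P' * U"
  define Y where "Y = W * (Q' * rank_form nc q q)"
  have c: "X \<in> carrier_mat q m" "Y \<in> carrier_mat m q" using Pc Qc U W by (auto simp: X_def Y_def)
  have "X * Y = rank_form q nr q * (P' * (U * W) * Q') * rank_form nc q q"
    unfolding X_def Y_def using Pc Qc U W
    by (simp add: assoc_mult_mat[of _ q nr _ nr _ m] assoc_mult_mat[of _ q nr _ m _ nc]
        assoc_mult_mat[of _ q nr _ nc _ nc] assoc_mult_mat[of _ q nr _ nc _ q]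
        assoc_mult_mat[of _ nr nr _ m _ nc] assoc_mult_mat[of _ q nr _ m _ q]
        assoc_mult_mat[of _ nr nr _ m _ q] assoc_mult_mat[of _ nr m _ nc _ q]
        assoc_mult_mat[of _ m nc _ nc _ q] assoc_mult_mat[of _ nr nr _ nc _ q]
        assoc_mult_mat[of _ nr nr _ nc _ nc] assoc_mult_mat[of _ nr nc _ nc _ q]
        assoc_mult_mat[of _ nr m _ nc _ nc] assoc_mult_mat[of _ nr nr _ nr _ q])
  also have "P' * (U * W) * Q' = rank_form nr nc q"
  proof -
    have "P' * (P * rank_form nr nc q * Q) = rank_form nr nc q * Q"
      using inverse_pair_cancel[OF inverse_pair_sym[OF P] mult_carrier_mat[OF rank_form_carrier(1) Qc(1)]] Pc Qc
      by (simp add: assoc_mult_mat[of _ nr nr _ nc _ nc])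
    then show ?thesis
      using inverse_pair_cancel_right[OF Q, of "rank_form nr nc q" nr] by (simp add: eq)
  qed
  also have "rank_form q nr q * rank_form nr nc q * rank_form nc q q = (1\<^sub>m q :: 'a mat)"
    using q by (simp add: rank_form_mult) (auto intro: eq_matI)
  finally have "det (X * Y) = 1" by simp
  with det_mult_lt[OF c] \<open>\<not> q \<le> m\<close> show False by simp
qed

lemma rank_sum_products_le:
  fixes f g :: "nat \<Rightarrow> nat \<Rightarrow> complex"
  shows "vec_space.rank n (mat n nc (\<lambda>(i, j). \<Sum>k<q. f i k * g k j)) \<le> q"
proof (induction q)
  case 0
  have eq: "mat n nc (\<lambda>(i, j). \<Sum>k<0. f i k * g k j) = 0\<^sub>m n nc" by (intro eq_matI) auto
  show ?case unfolding eq using vec_space.rank_0I[of n nc] by simp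
next
  case (Suc q)
  let ?A = "mat n nc (\<lambda>(i, j). \<Sum>k<q. f i k * g k j)" and ?B = "mat n nc (\<lambda>(i, j). f i q * g q j)"
  have "mat n nc (\<lambda>(i, j). \<Sum>k<Suc q. f i k * g k j) = ?A + ?B" by (intro eq_matI) auto
  moreover have "vec_space.rank n (?A + ?B) \<le> vec_space.rank n ?A + vec_space.rank n ?B"
    by (rule vec_space.rank_subadditive) auto
  moreover have "vec_space.rank n ?B \<le> 1"
    by (rule vec_space.rank_le_1_product_entries[of _ _ nc "\<lambda>i. f i q" "g q"]) auto
  ultimately show ?case using Suc by simp
qed

lemma rank_mult_le:
  fixes U W :: "complex mat"
  assumes "U \<in> carrier_mat n m" and "W \<in> carrier_mat m nc"
  shows "vec_space.rank n (U * W) \<le> m"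
proof -
  have "U * W = mat n nc (\<lambda>(i, j). \<Sum>k<m. U $$ (i, k) * W $$ (k, j))"
    by (rule eq_matI) (use assms in \<open>auto simp: index_mult_mat_sum simp del: index_mult_mat(1)\<close>)
  then show ?thesis
    using rank_sum_products_le[where q = m and f = "\<lambda>i k. U $$ (i, k)" and g = "\<lambda>k j. W $$ (k, j)"] by simp
qed

text \<open>The left factor lists a maximal independent set of columns of \<open>A\<close>; the
  right factor holds the coordinates of all columns with respect to it.\<close>

lemma (in vec_space) rank_factorization:
  assumes A: "A \<in> carrier_mat n nc"
  obtains U W where "U \<in> carrier_mat n (rank A)" "W \<in> carrier_mat (rank A) nc" "A = U * W"
proof -
  let ?P = "\<lambda>T. T \<subseteq> set (cols A) \<and> lin_indpt T"
  have colsA: "set (cols A) \<subseteq> carrier_vec n" using cols_dim[of A] A by auto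
  have "?P {}" by (metis basis_def empty_subsetI fin_dim finite_basis_exists subset_li_is_li)
  then obtain S where S: "finite S" "maximal S ?P"
    using maximal_exists_superset[of "set (cols A)" ?P "{}"] by blast
  have rk: "rank A = card S" by (rule rank_card_indpt[OF A S(2)])
  have Ssub: "S \<subseteq> set (cols A)" "lin_indpt S" using S(2) by (auto simp: maximal_def)
  with colsA have Sc: "S \<subseteq> carrier_vec n" by blast
  obtain vs where vs: "set vs = S" "distinct vs" using finite_distinct_list[OF S(1)] by blast
  define M where "M = mat_of_cols n vs"
  have M: "M \<in> carrier_mat n (rank A)" "cols M = vs"
    using vs Sc by (auto simp: M_def rk distinct_card[symmetric])
  have "\<exists>w. w \<in> carrier_vec (rank A) \<and> col A j = M *\<^sub>v w" if "j < nc" for j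
  proof -
    have j: "col A j \<in> set (cols A)" using that A by (auto simp: cols_def)
    then have jc: "col A j \<in> carrier_vec n" using colsA by blast
    have "col A j \<in> span S"
    proof (cases "col A j \<in> S")
      case True
      then show ?thesis using span_mem[OF Sc] by blast
    next
      case False
      have "\<not> lin_indpt (S \<union> {col A j})"
        using S(2) False j Ssub unfolding maximal_def by blast
      then show ?thesis using lin_dep_iff_in_span[OF Sc Ssub(2) jc False] by simp
    qed
    then obtain a where a: "col A j = lincomb a S" using finite_span[OF S(1) Sc] by auto
    have "M *\<^sub>v vec (rank A) (\<lambda>i. a (col M i)) = lincomb a S"
      using mat_mult_eq_lincomb[OF M(1), of a] M vs by simp
    with a show ?thesis by (metis vec_carrier)
  qed
  then obtain w where w: "\<And>j. j < nc \<Longrightarrow> w j \<in> carrier_vec (rank A)"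
    "\<And>j. j < nc \<Longrightarrow> col A j = M *\<^sub>v w j" by metis
  define W where "W = mat (rank A) nc (\<lambda>(i, j). w j $ i)"
  have Wc: "W \<in> carrier_mat (rank A) nc" by (simp add: W_def)
  have "A = M * W"
  proof (rule eq_matI)
    fix i j assume "i < dim_row (M * W)" "j < dim_col (M * W)"
    then have ij: "i < n" "j < nc" using M Wc by auto
    have "col W j = w j" using w(1)[OF ij(2)] ij by (intro eq_vecI) (auto simp: W_def)
    moreover have "A $$ (i, j) = (M *\<^sub>v w j) $ i" using w(2)[OF ij(2)] A ij by (metis carrier_matD index_col)
    ultimately show "A $$ (i, j) = (M * W) $$ (i, j)" using M Wc ij by simp
  qed (use A M Wc in auto)
  with M(1) Wc that show thesis by blast
qed

text \<open>Bridges the column rank of the definitions to factorizations, the form in which rank is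
  handled afterwards. A factorization through the exact rank is padded to inner dimension
  \<open>q\<close> by rectangular \<open>rank_form\<close> matrices.\<close>

lemma mat_rank_le_iff:
  assumes A: "A \<in> carrier_mat n n"
  shows "mat_rank A \<le> q \<longleftrightarrow> (\<exists>U W. U \<in> carrier_mat n q \<and> W \<in> carrier_mat q n \<and> A = U * W)"
proof
  assume "\<exists>U W. U \<in> carrier_mat n q \<and> W \<in> carrier_mat q n \<and> A = U * W"
  then show "mat_rank A \<le> q" using A rank_mult_le[of _ n q _ n] by (auto simp: mat_rank_def)
next
  assume le: "mat_rank A \<le> q"
  define m where "m = vec_space.rank n A"
  have m: "m \<le> q" using le A by (simp add: mat_rank_def m_def)
  obtain U W where UW: "U \<in> carrier_mat n m" "W \<in> carrier_mat m n" "A = U * W"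
    unfolding m_def by (rule vec_space.rank_factorization[OF A])
  define U' where "U' = U * rank_form m q m"
  define W' where "W' = rank_form q m m * W"
  have c: "U' \<in> carrier_mat n q" "W' \<in> carrier_mat q n" using UW by (auto simp: U'_def W'_def)
  have "U' * W' = U' * rank_form q m m * W"
    using assoc_mult_mat[OF c(1) rank_form_carrier(1) UW(2)] by (simp add: W'_def)
  also have "U' * rank_form q m m = U * (rank_form m q m * rank_form q m m)"
    unfolding U'_def by (rule assoc_mult_mat[OF UW(1) rank_form_carrier(1) rank_form_carrier(1)])
  also have "rank_form m q m * rank_form q m m = (1\<^sub>m m :: complex mat)"
    using m by (simp add: rank_form_mult) (auto intro: eq_matI)
  finally have "A = U' * W'" using UW by simp
  with c show "\<exists>U W. U \<in> carrier_mat n q \<and> W \<in> carrier_mat q n \<and> A = U * W" by blast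
qed

lemma mat_rank_normal_form:
  assumes P: "inverse_pair n P P'" and Q: "inverse_pair n Q Q'" and q: "q \<le> n"
  shows "mat_rank (P * rank_form n n q * Q) = q"
proof (rule antisym)
  note Pc = inverse_pairD[OF P] and Qc = inverse_pairD[OF Q]
  let ?A = "P * rank_form n n q * Q"
  have A: "?A \<in> carrier_mat n n"
    by (rule mult_carrier_mat[OF mult_carrier_mat[OF Pc(1) rank_form_carrier(1)] Qc(1)])
  have "(P * rank_form n q q) * (rank_form q n q * Q) = P * rank_form n q q * rank_form q n q * Q"
    using assoc_mult_mat[of "P * rank_form n q q" n q "rank_form q n q" n Q n] Pc Qc by simp
  also have "P * rank_form n q q * rank_form q n q = P * (rank_form n q q * rank_form q n q)"
    by (rule assoc_mult_mat[OF Pc(1) rank_form_carrier(1) rank_form_carrier(1)])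
  finally have "?A = (P * rank_form n q q) * (rank_form q n q * Q)" by (simp add: rank_form_mult)
  moreover have "P * rank_form n q q \<in> carrier_mat n q" "rank_form q n q * Q \<in> carrier_mat q n"
    using Pc Qc by auto
  ultimately show "mat_rank ?A \<le> q" using mat_rank_le_iff[OF A] by blast
  obtain U W where "U \<in> carrier_mat n (mat_rank ?A)" "W \<in> carrier_mat (mat_rank ?A) n" "?A = U * W"
    using mat_rank_le_iff[OF A, of "mat_rank ?A"] by auto
  then show "q \<le> mat_rank ?A" using rank_form_inner_dim[OF P Q q q] by blast
qed

lemma mat_rank_normal_formE:
  assumes "A \<in> carrier_mat n n"
  obtains P P' Q Q' where "inverse_pair n P P'" "inverse_pair n Q Q'" "mat_rank A \<le> n"
    "A = P * rank_form n n (mat_rank A) * Q"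
  using rank_normal_form[OF assms] mat_rank_normal_form by metis

lemma det_skew_odd:
  fixes S :: "complex mat"
  assumes S: "S \<in> carrier_mat r r" and "transpose_mat S = - S" and "odd r"
  shows "det S = 0"
proof -
  have "- S = (-1) \<cdot>\<^sub>m S" using S by (intro eq_matI) auto
  then have "det S = (-1) ^ r * det S" using det_transpose[OF S] assms S by simp
  with \<open>odd r\<close> show ?thesis by simp
qed

section \<open>Tangent spaces of determinantal varieties\<close>

lemma index_triple_mult:
  assumes "S \<in> carrier_mat m nr" "A \<in> carrier_mat nr nc" "T \<in> carrier_mat nc m'" "i < m" "j < m'"
  shows "(S * A * T) $$ (i, j) = (\<Sum>k<nr. \<Sum>l<nc. S $$ (i, k) * A $$ (k, l) * T $$ (l, j))"
proof -
  have SA: "S * A \<in> carrier_mat m nc" using assms by simp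
  have "(S * A * T) $$ (i, j) = (\<Sum>l<nc. (\<Sum>k<nr. S $$ (i, k) * A $$ (k, l)) * T $$ (l, j))"
    unfolding index_mult_mat_sum[OF SA assms(3-5)]
    by (intro sum.cong refl) (use index_mult_mat_sum[OF assms(1,2,4)] in simp)
  also have "\<dots> = (\<Sum>k<nr. \<Sum>l<nc. S $$ (i, k) * A $$ (k, l) * T $$ (l, j))"
    by (subst sum.swap) (simp add: sum_distrib_right)
  finally show ?thesis .
qed

lemma mat_rank_mult_le:
  "U \<in> carrier_mat n q \<Longrightarrow> W \<in> carrier_mat q n \<Longrightarrow> mat_rank (U * W) \<le> q"
  using rank_mult_le[of U n q W n] by (simp add: mat_rank_def)

lemma mat_rank_leE:
  assumes "A \<in> carrier_mat n n" "mat_rank A \<le> q"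
  obtains U W where "U \<in> carrier_mat n q" "W \<in> carrier_mat q n" "A = U * W"
proof -
  have "\<exists>U W. U \<in> carrier_mat n q \<and> W \<in> carrier_mat q n \<and> A = U * W"
    using mat_rank_le_iff[OF assms(1)] assms(2) by simp
  then show thesis by (elim exE conjE) (rule that)
qed

lemma rank_form_mult_min:
  assumes "q \<le> m"
  shows "rank_form nr m q * rank_form m nc q' = rank_form nr nc (min q q')"
proof (rule eq_matI)
  fix i j
  assume "i < dim_row (rank_form nr nc (min q q'))" "j < dim_col (rank_form nr nc (min q q'))"
  then have "i < nr" "j < nc" by auto
  with assms show "(rank_form nr m q * rank_form m nc q') $$ (i, j) = rank_form nr nc (min q q') $$ (i, j)"
    using index_rank_form_mult[of "rank_form m nc q'" m nc i nr j q] by (auto simp del: index_mult_mat(1))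
qed auto

lemma rank_form_one: "rank_form n n n = 1\<^sub>m n"
  by (rule eq_matI) auto

text \<open>The determinants of \<open>S * A * T\<close> for arbitrary \<open>S\<close> and
  \<open>T\<close> replace the minors of size \<open>q + 1\<close> and avoid index sets. If the
  normal form has size larger than \<open>q\<close>, the matrices \<open>S\<close> and
  \<open>T\<close> that undo \<open>P\<close> and \<open>Q\<close> and cut out a leading block
  produce an identity matrix, of determinant 1.\<close>

lemma factorization_iff_dets_zero:
  fixes A :: "complex mat"
  assumes A: "A \<in> carrier_mat nr nc"
  shows "(\<exists>U W. U \<in> carrier_mat nr q \<and> W \<in> carrier_mat q nc \<and> A = U * W) \<longleftrightarrow>
    (\<forall>S\<in>carrier_mat (Suc q) nr. \<forall>T\<in>carrier_mat nc (Suc q). det (S * A * T) = 0)"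
proof (intro iffI ballI)
  fix S T :: "complex mat"
  assume S: "S \<in> carrier_mat (Suc q) nr" and T: "T \<in> carrier_mat nc (Suc q)"
    and "\<exists>U W. U \<in> carrier_mat nr q \<and> W \<in> carrier_mat q nc \<and> A = U * W"
  then obtain U W where UW: "U \<in> carrier_mat nr q" "W \<in> carrier_mat q nc" "A = U * W" by blast
  have "S * A * T = S * U * W * T" using assoc_mult_mat[OF S UW(1,2)] UW(3) by simp
  also have "\<dots> = (S * U) * (W * T)"
    using assoc_mult_mat[OF mult_carrier_mat[OF S UW(1)] UW(2) T] by simp
  finally show "det (S * A * T) = 0"
    using det_mult_lt[OF mult_carrier_mat[OF S UW(1)] mult_carrier_mat[OF UW(2) T]] by simp
next
  assume dets: "\<forall>S\<in>carrier_mat (Suc q) nr. \<forall>T\<in>carrier_mat nc (Suc q). det (S * A * T) = 0"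
  obtain m P P' Q Q' where m: "m \<le> nr" "m \<le> nc" and P: "inverse_pair nr P P'"
    and Q: "inverse_pair nc Q Q'" and eq: "A = P * rank_form nr nc m * Q"
    by (rule rank_normal_form[OF A])
  note Pc = inverse_pairD[OF P] and Qc = inverse_pairD[OF Q]
  have "m \<le> q"
  proof (rule ccontr)
    assume "\<not> m \<le> q"
    define S where "S = rank_form (Suc q) nr (Suc q) * P'"
    define T where "T = Q' * rank_form nc (Suc q) (Suc q)"
    have c: "S \<in> carrier_mat (Suc q) nr" "T \<in> carrier_mat nc (Suc q)"
      unfolding S_def T_def
      by (rule mult_carrier_mat[OF rank_form_carrier(1) Pc(2)])
        (rule mult_carrier_mat[OF Qc(2) rank_form_carrier(1)])
    have AQ: "A * Q' = P * rank_form nr nc m"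
      unfolding eq by (rule inverse_pair_cancel_right[OF Q mult_carrier_mat[OF Pc(1) rank_form_carrier(1)]])
    have PA: "P' * (A * Q') = rank_form nr nc m"
      unfolding AQ by (rule inverse_pair_cancel[OF inverse_pair_sym[OF P] rank_form_carrier(1)])
    have "S * A * T = S * (A * T)" by (rule assoc_mult_mat[OF c(1) A c(2)])
    also have "A * T = A * Q' * rank_form nc (Suc q) (Suc q)"
      unfolding T_def by (rule assoc_mult_mat[OF A Qc(2) rank_form_carrier(1), symmetric])
    also have "S * (A * Q' * rank_form nc (Suc q) (Suc q)) = S * (A * Q') * rank_form nc (Suc q) (Suc q)"
      by (rule assoc_mult_mat[OF c(1) mult_carrier_mat[OF A Qc(2)] rank_form_carrier(1), symmetric])
    also have "S * (A * Q') = rank_form (Suc q) nr (Suc q) * (P' * (A * Q'))"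
      unfolding S_def by (rule assoc_mult_mat[OF rank_form_carrier(1) Pc(2) mult_carrier_mat[OF A Qc(2)]])
    also have "\<dots> * rank_form nc (Suc q) (Suc q) = 1\<^sub>m (Suc q)"
      unfolding PA using m \<open>\<not> m \<le> q\<close>
      by (simp add: rank_form_mult_min min_absorb1 rank_form_one)
    finally show False using dets c by force
  qed
  define U where "U = P * rank_form nr q m"
  define W where "W = rank_form q nc m * Q"
  have c: "U \<in> carrier_mat nr q" "W \<in> carrier_mat q nc"
    unfolding U_def W_def
    by (rule mult_carrier_mat[OF Pc(1) rank_form_carrier(1)])
      (rule mult_carrier_mat[OF rank_form_carrier(1) Qc(1)])
  have "U * W = U * rank_form q nc m * Q"
    unfolding W_def by (rule assoc_mult_mat[OF c(1) rank_form_carrier(1) Qc(1), symmetric])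
  also have "U * rank_form q nc m = P * (rank_form nr q m * rank_form q nc m)"
    unfolding U_def by (rule assoc_mult_mat[OF Pc(1) rank_form_carrier(1) rank_form_carrier(1)])
  finally have "A = U * W" using eq \<open>m \<le> q\<close> by (simp add: rank_form_mult)
  with c show "\<exists>U W. U \<in> carrier_mat nr q \<and> W \<in> carrier_mat q nc \<and> A = U * W" by blast
qed

section \<open>Matrices as points of projective space, and the equations of rank conditions\<close>

definition coords :: "nat \<Rightarrow> complex mat \<Rightarrow> nat \<times> nat \<Rightarrow> complex" where
  "coords n X = (\<lambda>(i, j). if i < n \<and> j < n then X $$ (i, j) else 0)"

lemma finite_entries: "finite (entries n)"
  by (simp add: entries_def)

lemma mem_entries: "(i, j) \<in> entries n \<longleftrightarrow> i < n \<and> j < n"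
  by (auto simp: entries_def)

lemma coords_mem: "coords n X \<in> coord_vectors (entries n)"
  by (auto simp: coords_def coord_vectors_def entries_def)

lemma mat_coords: "X \<in> carrier_mat n n \<Longrightarrow> mat n n (coords n X) = X"
  by (intro eq_matI) (auto simp: coords_def)

lemma coords_mat: "a \<in> coord_vectors (entries n) \<Longrightarrow> coords n (mat n n a) = a"
  by (auto simp: coords_def coord_vectors_def entries_def fun_eq_iff)

lemma coords_eq_zero_iff:
  assumes "X \<in> carrier_mat n n"
  shows "coords n X = (\<lambda>i. 0) \<longleftrightarrow> X = 0\<^sub>m n n"
proof
  assume "coords n X = (\<lambda>i. 0)"
  then have "mat n n (coords n X) = 0\<^sub>m n n" by (intro eq_matI) auto
  with assms show "X = 0\<^sub>m n n" by (simp add: mat_coords)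
qed (auto simp: coords_def fun_eq_iff)

lemma coords_add_smult:
  "A \<in> carrier_mat n n \<Longrightarrow> Y \<in> carrier_mat n n \<Longrightarrow>
    coords n (A + t \<cdot>\<^sub>m Y) = (\<lambda>i. coords n A i + t * coords n Y i)"
  by (auto simp: coords_def fun_eq_iff)

lemma coords_smult:
  "A \<in> carrier_mat n n \<Longrightarrow> coords n (t \<cdot>\<^sub>m A) = (\<lambda>i. t * coords n A i)"
  by (auto simp: coords_def fun_eq_iff)

lemma proj_point_coords_mem:
  "X \<in> carrier_mat n n \<Longrightarrow> X \<noteq> 0\<^sub>m n n \<Longrightarrow> proj_point (coords n X) \<in> proj_space (entries n)"
  by (intro proj_point_in_proj_space coords_mem) (simp add: coords_eq_zero_iff)

lemma proj_space_entriesE: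
  assumes "p \<in> proj_space (entries n)"
  obtains X where "X \<in> carrier_mat n n" "X \<noteq> 0\<^sub>m n n" "p = proj_point (coords n X)"
proof -
  obtain a where a: "p = proj_point a" "a \<in> coord_vectors (entries n)" "a \<noteq> (\<lambda>i. 0)"
    by (rule proj_spaceE[OF assms])
  have c: "coords n (mat n n a) = a" by (rule coords_mat[OF a(2)])
  show thesis
  proof (rule that)
    show "mat n n a \<in> carrier_mat n n" by simp
    then show "mat n n a \<noteq> 0\<^sub>m n n"
      using coords_eq_zero_iff[of "mat n n a" n] a(3) unfolding c by blast
    show "p = proj_point (coords n (mat n n a))" unfolding c by (rule a(1))
  qed
qed

lemma mat_rank_smult_le:
  assumes A: "A \<in> carrier_mat n n" and "mat_rank A \<le> q"
  shows "mat_rank (c \<cdot>\<^sub>m A) \<le> q"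
proof -
  obtain U W where UW: "U \<in> carrier_mat n q" "W \<in> carrier_mat q n" "A = U * W"
    by (rule mat_rank_leE[OF assms])
  have "c \<cdot>\<^sub>m A = (c \<cdot>\<^sub>m U) * W" using mult_smult_assoc_mat[OF UW(1,2), of c] UW(3) by simp
  moreover have "mat_rank ((c \<cdot>\<^sub>m U) * W) \<le> q" by (rule mat_rank_mult_le) (use UW in auto)
  ultimately show ?thesis by simp
qed

lemma mat_rank_smult:
  assumes A: "A \<in> carrier_mat n n" and "c \<noteq> 0"
  shows "mat_rank (c \<cdot>\<^sub>m A) = mat_rank A"
proof (rule antisym)
  show "mat_rank (c \<cdot>\<^sub>m A) \<le> mat_rank A" using mat_rank_smult_le[OF A] by simp
  have "inverse c \<cdot>\<^sub>m (c \<cdot>\<^sub>m A) = A" using assms by (intro eq_matI) auto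
  then show "mat_rank A \<le> mat_rank (c \<cdot>\<^sub>m A)"
    using mat_rank_smult_le[of "c \<cdot>\<^sub>m A" n "mat_rank (c \<cdot>\<^sub>m A)" "inverse c"] A by simp
qed

lemma mat_scale: "mat n n (\<lambda>i. c * a i) = c \<cdot>\<^sub>m mat n n a"
  by (intro eq_matI) auto

lemma det_variety_iff:
  assumes "X \<in> carrier_mat n n" "X \<noteq> 0\<^sub>m n n"
  shows "proj_point (coords n X) \<in> det_variety n r \<longleftrightarrow> mat_rank X \<le> r"
proof -
  have "mat_rank (mat n n (\<lambda>i. c * coords n X i)) = mat_rank X" if "c \<noteq> 0" for c
    unfolding mat_scale mat_coords[OF assms(1)] by (rule mat_rank_smult[OF assms(1) that])
  with assms proj_point_coords_mem[OF assms] self_mem_proj_point[of "coords n X"]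
  show ?thesis by (auto simp: det_variety_def proj_point_def mat_coords)
qed

lemma hforms_entry:
  "i < n \<Longrightarrow> j < n \<Longrightarrow> (\<lambda>a. a (i, j)) \<in> hforms (entries n) 1"
  by (rule hforms_var[OF finite_entries]) (simp add: mem_entries)

lemma hforms_linear_matrix:
  assumes "S \<in> carrier_mat m nr" "T \<in> carrier_mat nc m'" "\<And>a. M a \<in> carrier_mat nr nc"
    and "\<And>k l. k < nr \<Longrightarrow> l < nc \<Longrightarrow> (\<lambda>a. M a $$ (k, l)) \<in> hforms I 1" and "i < m" "j < m'"
  shows "(\<lambda>a. (S * M a * T) $$ (i, j)) \<in> hforms I 1"
proof -
  have "(\<lambda>a. S $$ (i, k) * M a $$ (k, l) * T $$ (l, j)) \<in> hforms I 1" if "k < nr" "l < nc" for k l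
    using poly_span_scale[OF assms(4)[OF that], of "S $$ (i, k) * T $$ (l, j)"] by (simp add: mult_ac)
  then show ?thesis unfolding index_triple_mult[OF assms(1,3,2,5,6)]
    by (intro poly_span_sum) auto
qed

text \<open>The equations are the determinants of \<open>S * M a * T\<close>, forms of degree
  \<open>q + 1\<close>. The rectangular shape is for the matrix with blocks B and its transpose, the
  square one for the determinantal variety.\<close>

lemma zariski_closed_factorization:
  assumes "\<And>a. M a \<in> carrier_mat nr nc" and "finite I"
    and "\<And>k l. k < nr \<Longrightarrow> l < nc \<Longrightarrow> (\<lambda>a. M a $$ (k, l)) \<in> hforms I 1"
  shows "zariski_closed I {p \<in> proj_space I. \<forall>a\<in>p.
    \<exists>U W. U \<in> carrier_mat nr q \<and> W \<in> carrier_mat q nc \<and> M a = U * W}"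
proof -
  let ?\<F> = "(\<lambda>(S, T) a. det (S * M a * T)) ` (carrier_mat (Suc q) nr \<times> carrier_mat nc (Suc q))"
  have "(\<lambda>a. det (S * M a * T)) \<in> hforms I (Suc q)"
    if "S \<in> carrier_mat (Suc q) nr" "T \<in> carrier_mat nc (Suc q)" for S T
  proof (rule hforms_det)
    show "S * M a * T \<in> carrier_mat (Suc q) (Suc q)" for a
      by (rule mult_carrier_mat[OF mult_carrier_mat[OF that(1) assms(1)] that(2)])
    show "(\<lambda>a. (S * M a * T) $$ (i, j)) \<in> hforms I 1" if "i < Suc q" "j < Suc q" for i j
      by (rule hforms_linear_matrix[OF \<open>S \<in> _\<close> \<open>T \<in> _\<close> assms(1,3) that])
  qed
  then have "?\<F> \<subseteq> forms I" unfolding forms_eq_hforms[OF assms(2)]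
    by (intro image_subsetI UN_I[of "Suc q"]) (auto simp del: index_mult_mat)
  then have "zariski_closed I (zero_locus I ?\<F>)" by (rule zariski_closed_zero_locus)
  also have "zero_locus I ?\<F> = {p \<in> proj_space I. \<forall>a\<in>p.
    \<exists>U W. U \<in> carrier_mat nr q \<and> W \<in> carrier_mat q nc \<and> M a = U * W}"
    unfolding factorization_iff_dets_zero[OF assms(1)] zero_locus_def by fastforce
  finally show ?thesis .
qed

lemma zariski_closed_det_variety: "zariski_closed (entries n) (det_variety n r)"
proof -
  have "(\<lambda>a. mat n n a $$ (k, l)) \<in> hforms (entries n) 1" if "k < n" "l < n" for k l
    using hforms_entry[OF that] that by simp
  from zariski_closed_factorization[OF _ finite_entries this, where q = r]
  show ?thesis by (simp add: det_variety_def mat_rank_le_iff[of _ n])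
qed

lemma poly_eq_zero_if_cofinite:
  fixes q :: "complex poly"
  assumes "finite S" and "\<And>t. t \<notin> S \<Longrightarrow> poly q t = 0"
  shows "q = 0"
proof (rule ccontr)
  assume "q \<noteq> 0"
  then have "finite {t. poly q t = 0}" by (rule poly_roots_finite)
  with assms(1) have "finite ({t. poly q t = 0} \<union> S)" by simp
  moreover have "{t. poly q t = 0} \<union> S = UNIV" using assms(2) by auto
  ultimately show False using infinite_UNIV_char_0 by metis
qed

text \<open>Passes from generic parameters to a special one: a polynomial that is zero off a finite
  set is zero.\<close>

lemma hforms_zero_on_curve:
  assumes "F \<in> hforms I d" "poly_curve \<gamma>" "finite S" "\<And>t. t \<notin> S \<Longrightarrow> F (\<gamma> t) = 0"
  shows "F (\<gamma> t) = 0"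
proof -
  obtain q where q: "\<And>t. F (\<gamma> t) = poly q t" using hforms_poly_curve[OF assms(1,2)] by metis
  then have "q = 0" using assms(3,4) by (intro poly_eq_zero_if_cofinite[of S]) auto
  with q show ?thesis by simp
qed

lemma poly_curve_line: "poly_curve (\<lambda>t i. x i + t * y i)"
  unfolding poly_curve_def
proof
  fix i show "\<exists>q. \<forall>t. x i + t * y i = poly q t" by (rule exI[of _ "[:x i, y i:]"]) auto
qed

text \<open>Extends the vanishing to the origin of the affine cone.\<close>

lemma vanishing_forms_det_variety:
  assumes F: "F \<in> vanishing_forms (entries n) (det_variety n r)" and "1 \<le> r" "1 \<le> n"
    and A: "A \<in> carrier_mat n n" "mat_rank A \<le> r"
  shows "F (coords n A) = 0"
proof -
  have nonzero: "F (coords n X) = 0" if "X \<in> carrier_mat n n" "mat_rank X \<le> r" "X \<noteq> 0\<^sub>m n n" for X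
    using F that det_variety_iff[OF that(1,3)] self_mem_proj_point by (auto simp: vanishing_forms_def)
  show ?thesis
  proof (cases "A = 0\<^sub>m n n")
    case True
    obtain d where d: "F \<in> hforms (entries n) d"
      using F forms_eq_hforms[OF finite_entries] by (auto simp: vanishing_forms_def)
    \<comment> \<open>A rank one matrix, so that its nonzero multiples represent a point of the
      variety because \<open>1 \<le> r\<close>; the line through 0 in this direction reaches the
      origin.\<close>
    let ?E = "rank_form n n 1 :: complex mat"
    have E: "?E \<in> carrier_mat n n" "?E $$ (0, 0) = 1" using \<open>1 \<le> n\<close> by auto
    have one: "inverse_pair n (1\<^sub>m n) (1\<^sub>m n :: complex mat)" by (auto simp: inverse_pair_def)
    have rkE: "mat_rank ?E = 1" using mat_rank_normal_form[OF one one \<open>1 \<le> n\<close>] by simp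
    have zero: "F (\<lambda>i. coords n A i + t * coords n ?E i) = 0" if "t \<notin> {0}" for t
    proof -
      have "(t \<cdot>\<^sub>m ?E) $$ (0, 0) = t" using E \<open>1 \<le> n\<close> by simp
      moreover have "(0\<^sub>m n n :: complex mat) $$ (0, 0) = 0" using \<open>1 \<le> n\<close> by simp
      ultimately have "t \<cdot>\<^sub>m ?E \<noteq> 0\<^sub>m n n" using that by (metis singletonI)
      moreover have "mat_rank (t \<cdot>\<^sub>m ?E) \<le> r" using mat_rank_smult_le[OF E(1)] rkE \<open>1 \<le> r\<close> by simp
      ultimately have "F (coords n (t \<cdot>\<^sub>m ?E)) = 0" using nonzero by simp
      moreover have "coords n (t \<cdot>\<^sub>m ?E) = (\<lambda>i. coords n A i + t * coords n ?E i)"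
        using True by (auto simp: coords_def fun_eq_iff)
      ultimately show ?thesis by simp
    qed
    let ?\<gamma> = "\<lambda>t i. coords n A i + t * coords n ?E i"
    have "F (?\<gamma> 0) = 0"
      by (rule hforms_zero_on_curve[where \<gamma> = ?\<gamma> and S = "{0}", OF d poly_curve_line])
        (use zero in auto)
    then show ?thesis by simp
  qed (use nonzero A in auto)
qed

lemma det_variety_mem:
  assumes "p \<in> det_variety n r" "x \<in> p"
  shows "mat_rank (mat n n x) \<le> r" "coords n (mat n n x) = x" "mat n n x \<noteq> 0\<^sub>m n n"
proof -
  have p: "p \<in> proj_space (entries n)" using assms by (simp add: det_variety_def)
  show "mat_rank (mat n n x) \<le> r" using assms by (simp add: det_variety_def)
  show c: "coords n (mat n n x) = x" using proj_space_mem(2)[OF p assms(2)] by (rule coords_mat)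
  show "mat n n x \<noteq> 0\<^sub>m n n"
    using proj_space_mem(3)[OF p assms(2)] coords_eq_zero_iff[of "mat n n x" n] c by auto
qed

text \<open>A vanishing form is zero along the whole line, even where the line passes through the
  zero matrix, so its derivative in the direction \<open>Y\<close> is zero.\<close>

lemma directional_derivative_det_variety:
  assumes F: "F \<in> vanishing_forms (entries n) (det_variety n r)" and "1 \<le> r" "1 \<le> n"
    and A: "A \<in> carrier_mat n n" and Y: "Y \<in> carrier_mat n n"
    and line: "\<And>t. mat_rank (A + t \<cdot>\<^sub>m Y) \<le> r"
  shows "(\<Sum>i\<in>entries n. partial_deriv i F (coords n A) * coords n Y i) = 0"
proof -
  obtain d where d: "F \<in> hforms (entries n) d"
    using F forms_eq_hforms[OF finite_entries] by (auto simp: vanishing_forms_def)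
  have "F (\<lambda>i. coords n A i + t * coords n Y i) = 0" for t
    using vanishing_forms_det_variety[OF F assms(2,3) _ line[of t]] A Y
    by (simp add: coords_add_smult[symmetric])
  with hforms_directional_derivative[OF finite_entries d, of "coords n A" "coords n Y"]
  have "((\<lambda>t. 0) has_field_derivative
    (\<Sum>i\<in>entries n. partial_deriv i F (coords n A) * coords n Y i)) (at 0)" by simp
  then show ?thesis using DERIV_const DERIV_unique by blast
qed

lemma sum_entries: "(\<Sum>i\<in>entries n. f i) = (\<Sum>i<n. \<Sum>j<n. f (i, j))"
  by (simp add: entries_def sum.cartesian_product)

lemma tangent_space_det_varietyI:
  assumes p: "p \<in> det_variety n r" and "1 \<le> r" "1 \<le> n"
    and Y: "Y \<in> carrier_mat n n" "Y \<noteq> 0\<^sub>m n n"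
    and tang: "\<And>F x. F \<in> vanishing_forms (entries n) (det_variety n r) \<Longrightarrow> x \<in> p \<Longrightarrow>
      (\<Sum>i\<in>entries n. partial_deriv i F x * coords n Y i) = 0"
  shows "proj_point (coords n Y) \<in> tangent_space (entries n) (det_variety n r) p"
proof -
  have "(\<Sum>i\<in>entries n. partial_deriv i F x * (c * coords n Y i)) = 0"
    if "F \<in> vanishing_forms (entries n) (det_variety n r)" "x \<in> p" for F x c
  proof -
    have "(\<Sum>i\<in>entries n. partial_deriv i F x * (c * coords n Y i)) =
        c * (\<Sum>i\<in>entries n. partial_deriv i F x * coords n Y i)"
      by (simp add: sum_distrib_left mult_ac)
    with tang[OF that] show ?thesis by simp
  qed
  with proj_point_coords_mem[OF Y] show ?thesis
    by (auto simp: tangent_space_def proj_point_def)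
qed

text \<open>Directions of lines inside the affine cone are tangent, hence orthogonal to the
  hyperplane. The line is required at every representative \<open>x\<close>, because the definition
  of \<open>tangent_space\<close> quantifies over all of them; \<open>Y = 0\<close> is separate, as
  it gives no projective point.\<close>

lemma tangent_hyperplane_orthogonal:
  assumes p: "p \<in> det_variety n r" and r: "1 \<le> r" "1 \<le> n"
    and sub: "tangent_space (entries n) (det_variety n r) p \<subseteq> hyperplane (entries n) h"
    and b: "b \<in> h" and Y: "Y \<in> carrier_mat n n"
    and line: "\<And>x t. x \<in> p \<Longrightarrow> mat_rank (mat n n x + t \<cdot>\<^sub>m Y) \<le> r"
  shows "(\<Sum>i<n. \<Sum>j<n. Y $$ (i, j) * b (i, j)) = 0"
proof (cases "Y = 0\<^sub>m n n")
  case False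
  have "(\<Sum>i\<in>entries n. partial_deriv i F x * coords n Y i) = 0"
    if "F \<in> vanishing_forms (entries n) (det_variety n r)" "x \<in> p" for F x
    using directional_derivative_det_variety[OF that(1) r _ Y line[OF that(2)]]
      det_variety_mem[OF p that(2)] by simp
  then have "proj_point (coords n Y) \<in> tangent_space (entries n) (det_variety n r) p"
    by (rule tangent_space_det_varietyI[OF p r Y False])
  with sub have "proj_point (coords n Y) \<in> hyperplane (entries n) h" by blast
  then have "(\<Sum>i\<in>entries n. coords n Y i * b i) = 0"
    using b self_mem_proj_point[of "coords n Y"] by (auto simp: hyperplane_def)
  then show ?thesis by (simp add: sum_entries coords_def)
qed simp

lemma mat_rank_mult_left_le:
  assumes A: "A \<in> carrier_mat n n" and X: "X \<in> carrier_mat n n" and "mat_rank A \<le> r"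
  shows "mat_rank (X * A) \<le> r"
proof -
  obtain U W where UW: "U \<in> carrier_mat n r" "W \<in> carrier_mat r n" "A = U * W"
    by (rule mat_rank_leE[OF A assms(3)])
  have "X * A = (X * U) * W" using assoc_mult_mat[OF X UW(1,2)] UW(3) by simp
  with mat_rank_mult_le[OF mult_carrier_mat[OF X UW(1)] UW(2)] show ?thesis by simp
qed

lemma mat_rank_mult_right_le:
  assumes A: "A \<in> carrier_mat n n" and X: "X \<in> carrier_mat n n" and "mat_rank A \<le> r"
  shows "mat_rank (A * X) \<le> r"
proof -
  obtain U W where UW: "U \<in> carrier_mat n r" "W \<in> carrier_mat r n" "A = U * W"
    by (rule mat_rank_leE[OF A assms(3)])
  have "A * X = U * (W * X)" using assoc_mult_mat[OF UW(1,2) X] UW(3) by simp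
  with mat_rank_mult_le[OF UW(1) mult_carrier_mat[OF UW(2) X]] show ?thesis by simp
qed

lemma line_left:
  fixes A :: "complex mat"
  assumes "A \<in> carrier_mat n n" "X \<in> carrier_mat n n"
  shows "A + t \<cdot>\<^sub>m (X * A) = (1\<^sub>m n + t \<cdot>\<^sub>m X) * A"
  using assms by (simp add: add_mult_distrib_mat[of _ n n] mult_smult_assoc_mat[of _ n n])

lemma line_right:
  fixes A :: "complex mat"
  assumes "A \<in> carrier_mat n n" "X \<in> carrier_mat n n"
  shows "A + t \<cdot>\<^sub>m (A * X) = A * (1\<^sub>m n + t \<cdot>\<^sub>m X)"
  using assms mult_add_distrib_mat[of A n n "1\<^sub>m n" n "t \<cdot>\<^sub>m X"]
  by (simp add: mult_smult_distrib[of A n n X n])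

lemma smult_div_smult: "c \<noteq> 0 \<Longrightarrow> (t / c) \<cdot>\<^sub>m (c \<cdot>\<^sub>m M) = t \<cdot>\<^sub>m (M :: complex mat)"
  by (intro eq_matI) auto

lemma unit_matrix_left_index:
  fixes A :: "complex mat"
  assumes "A \<in> carrier_mat n n" "k < n" "l < n" "i < n" "j < n"
  shows "(mat n n (\<lambda>(i, j). if i = l \<and> j = k then 1 else 0) * A) $$ (i, j) =
    (if i = l then A $$ (k, j) else 0)"
proof -
  have "(\<Sum>m<n. mat n n (\<lambda>(i, j). if i = l \<and> j = k then 1 else 0) $$ (i, m) * A $$ (m, j)) =
      (\<Sum>m<n. if m = k then (if i = l then A $$ (k, j) else 0) else 0)"
    by (rule sum.cong) (use assms in auto)
  then show ?thesis using assms by (simp add: index_mult_mat_sum[of _ n n A n] del: index_mult_mat(1))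
qed

lemma unit_matrix_right_index:
  fixes A :: "complex mat"
  assumes "A \<in> carrier_mat n n" "k < n" "l < n" "i < n" "j < n"
  shows "(A * mat n n (\<lambda>(i, j). if i = k \<and> j = l then 1 else 0)) $$ (i, j) =
    (if j = l then A $$ (i, k) else 0)"
proof -
  have "(\<Sum>m<n. A $$ (i, m) * mat n n (\<lambda>(i, j). if i = k \<and> j = l then 1 else 0) $$ (m, j)) =
      (\<Sum>m<n. if m = k then (if j = l then A $$ (i, k) else 0) else 0)"
    by (rule sum.cong) (use assms in auto)
  then show ?thesis using assms by (simp add: index_mult_mat_sum[of A n n _ n] del: index_mult_mat(1))
qed

text \<open>The lines A + t X A and A + t A X consist of products with A as a factor, so they keep
  the rank at most \<open>r\<close>. Orthogonality to X A for matrix units X reads off the entries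
  of A times the transpose of B, and orthogonality to A X those of the transpose of A times
  B.\<close>

lemma tangent_hyperplane_imp:
  assumes p: "p \<in> det_variety n r" and r: "1 \<le> r" "1 \<le> n"
    and sub: "tangent_space (entries n) (det_variety n r) p \<subseteq> hyperplane (entries n) h"
    and h: "h \<in> proj_space (entries n)" and b: "b \<in> h" and x: "x \<in> p"
  shows "mat_rank (mat n n x) = r"
    and "(mat n n x)\<^sup>T * mat n n b = 0\<^sub>m n n"
    and "mat n n x * (mat n n b)\<^sup>T = 0\<^sub>m n n"
proof -
  let ?A = "mat n n x" and ?B = "mat n n b"
  have A: "?A \<in> carrier_mat n n" by simp
  note orth = tangent_hyperplane_orthogonal[OF p r sub b]
  have multiple: "\<exists>c. mat n n y = c \<cdot>\<^sub>m ?A" if "y \<in> p" for y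
  proof -
    have "p = proj_point x" using proj_space_mem(1)[of p "entries n", OF _ x] p by (simp add: det_variety_def)
    with that obtain c where "y = (\<lambda>i. c * x i)" by (auto simp: proj_point_def)
    then show ?thesis by (auto simp: mat_scale)
  qed
  have smult0: "0 \<cdot>\<^sub>m ?A = 0\<^sub>m n n" by (rule eq_matI) auto
  note rk = det_variety_mem(1)[OF p]
  have left: "(\<Sum>i<n. \<Sum>j<n. (X * ?A) $$ (i, j) * b (i, j)) = 0" if X: "X \<in> carrier_mat n n" for X
  proof (rule orth)
    fix y t assume "y \<in> p"
    obtain c where c: "mat n n y = c \<cdot>\<^sub>m ?A" "c \<noteq> 0"
      using multiple[OF \<open>y \<in> p\<close>] det_variety_mem(3)[OF p \<open>y \<in> p\<close>]
      by (metis smult0)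
    \<comment> \<open>At the representative \<open>y = c x\<close> the same direction is
      \<open>1 / c\<close> times the direction formed from \<open>y\<close>, so the line parameter
      is rescaled.\<close>
    have "mat n n y + t \<cdot>\<^sub>m (X * ?A) = mat n n y + (t / c) \<cdot>\<^sub>m (X * mat n n y)"
      using c X by (simp add: mult_smult_distrib[of X n n ?A n] smult_div_smult)
    then show "mat_rank (mat n n y + t \<cdot>\<^sub>m (X * ?A)) \<le> r"
      using line_left[of "mat n n y" n X "t / c"] X
      by (auto intro!: mat_rank_mult_left_le rk \<open>y \<in> p\<close>)
  qed (use X in simp)
  have right: "(\<Sum>i<n. \<Sum>j<n. (?A * X) $$ (i, j) * b (i, j)) = 0" if X: "X \<in> carrier_mat n n" for X
  proof (rule orth)
    fix y t assume "y \<in> p"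
    obtain c where c: "mat n n y = c \<cdot>\<^sub>m ?A" "c \<noteq> 0"
      using multiple[OF \<open>y \<in> p\<close>] det_variety_mem(3)[OF p \<open>y \<in> p\<close>]
      by (metis smult0)
    have "mat n n y + t \<cdot>\<^sub>m (?A * X) = mat n n y + (t / c) \<cdot>\<^sub>m (mat n n y * X)"
      using c X by (simp add: mult_smult_assoc_mat[of ?A n n X n] smult_div_smult)
    then show "mat_rank (mat n n y + t \<cdot>\<^sub>m (?A * X)) \<le> r"
      using line_right[of "mat n n y" n X "t / c"] X
      by (auto intro!: mat_rank_mult_right_le rk \<open>y \<in> p\<close>)
  qed (use mult_carrier_mat[OF A X] in simp)
  show "?A\<^sup>T * ?B = 0\<^sub>m n n"
  proof (rule eq_matI)
    fix k l assume "k < dim_row (0\<^sub>m n n :: complex mat)" "l < dim_col (0\<^sub>m n n :: complex mat)"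
    then have kl: "k < n" "l < n" by auto
    have "(\<Sum>i<n. \<Sum>j<n. (?A * mat n n (\<lambda>(i, j). if i = k \<and> j = l then 1 else 0)) $$ (i, j) * b (i, j)) =
        (\<Sum>i<n. \<Sum>j<n. if j = l then ?A $$ (i, k) * b (i, l) else 0)"
      by (intro sum.cong refl) (use unit_matrix_right_index[OF A kl] in \<open>auto simp del: index_mult_mat(1)\<close>)
    with right[of "mat n n (\<lambda>(i, j). if i = k \<and> j = l then 1 else 0)"] kl
    have "(\<Sum>i<n. ?A $$ (i, k) * b (i, l)) = 0" by (simp del: index_mult_mat(1))
    moreover have "(?A\<^sup>T * ?B) $$ (k, l) = (\<Sum>i<n. ?A\<^sup>T $$ (k, i) * ?B $$ (i, l))"
      by (rule index_mult_mat_sum) (use kl in auto)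
    ultimately show "(?A\<^sup>T * ?B) $$ (k, l) = 0\<^sub>m n n $$ (k, l)" using kl by (simp del: index_mult_mat(1))
  qed auto
  show "?A * ?B\<^sup>T = 0\<^sub>m n n"
  proof (rule eq_matI)
    fix k l assume "k < dim_row (0\<^sub>m n n :: complex mat)" "l < dim_col (0\<^sub>m n n :: complex mat)"
    then have kl: "k < n" "l < n" by auto
    have "(\<Sum>i<n. \<Sum>j<n. (mat n n (\<lambda>(i, j). if i = l \<and> j = k then 1 else 0) * ?A) $$ (i, j) * b (i, j)) =
        (\<Sum>i<n. \<Sum>j<n. if i = l then ?A $$ (k, j) * b (l, j) else 0)"
      by (intro sum.cong refl) (use unit_matrix_left_index[OF A kl] in \<open>auto simp del: index_mult_mat(1)\<close>)
    also have "\<dots> = (\<Sum>j<n. \<Sum>i<n. if i = l then ?A $$ (k, j) * b (l, j) else 0)" by (rule sum.swap)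
    finally have "(\<Sum>j<n. ?A $$ (k, j) * b (l, j)) = 0"
      using left[of "mat n n (\<lambda>(i, j). if i = l \<and> j = k then 1 else 0)"] kl by (simp del: index_mult_mat(1))
    moreover have "(?A * ?B\<^sup>T) $$ (k, l) = (\<Sum>j<n. ?A $$ (k, j) * ?B\<^sup>T $$ (j, l))"
      by (rule index_mult_mat_sum) (use kl in auto)
    ultimately show "(?A * ?B\<^sup>T) $$ (k, l) = 0\<^sub>m n n $$ (k, l)" using kl by (simp del: index_mult_mat(1))
  qed auto
  show "mat_rank ?A = r"
  proof (rule ccontr)
    assume "mat_rank ?A \<noteq> r"
    with rk[OF x] have less: "mat_rank ?A < r" by simp
    have "b (k, l) = 0" if kl: "k < n" "l < n" for k l
    proof -
      let ?Y = "mat n n (\<lambda>(i, j). if i = k \<and> j = l then 1 else 0) :: complex mat"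
      have zero: "(\<Sum>i<n. \<Sum>j<n. ?Y $$ (i, j) * b (i, j)) = 0"
      proof (rule orth)
        fix y t assume "y \<in> p"
        then obtain c where c: "mat n n y = c \<cdot>\<^sub>m ?A" using multiple by blast
        \<comment> \<open>A multiple of a matrix unit raises the rank by at most one, and
          \<open>less\<close> leaves room for that. Hence every entry of \<open>b\<close> would be
          0, which is no point.\<close>
        have "vec_space.rank n (c \<cdot>\<^sub>m ?A + t \<cdot>\<^sub>m ?Y) \<le> vec_space.rank n (c \<cdot>\<^sub>m ?A) + vec_space.rank n (t \<cdot>\<^sub>m ?Y)"
          by (rule vec_space.rank_subadditive) auto
        moreover have "vec_space.rank n (c \<cdot>\<^sub>m ?A) \<le> mat_rank ?A"
          using mat_rank_smult_le[OF A order_refl, of c] by (simp add: mat_rank_def)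
        moreover have "vec_space.rank n (t \<cdot>\<^sub>m ?Y) \<le> 1"
          by (rule vec_space.rank_le_1_product_entries[of _ _ n "\<lambda>i. if i = k then t else 0"
                "\<lambda>j. if j = l then 1 else 0"]) auto
        ultimately show "mat_rank (mat n n y + t \<cdot>\<^sub>m ?Y) \<le> r"
          using less c by (simp add: mat_rank_def)
      qed simp
      have "(\<Sum>i<n. \<Sum>j<n. ?Y $$ (i, j) * b (i, j)) =
          (\<Sum>i<n. \<Sum>j<n. if i = k then (if j = l then b (k, l) else 0) else 0)"
        by (intro sum.cong refl) auto
      also have "\<dots> = (\<Sum>i<n. if i = k then b (k, l) else 0)"
        by (rule sum.cong) (use kl in auto)
      also have "\<dots> = b (k, l)" using kl by simp
      finally show ?thesis unfolding zero by simp
    qed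
    then have "b = (\<lambda>i. 0)"
      using proj_space_mem(2)[OF h b] by (auto simp: coord_vectors_def entries_def fun_eq_iff)
    with proj_space_mem(3)[OF h b] show False by blast
  qed
qed

section \<open>The local dimension: upper bound\<close>

lemma sum_fun_eval:
  fixes f :: "'s \<Rightarrow> 'a \<Rightarrow> complex"
  shows "(\<Sum>s\<in>S. f s) x = (\<Sum>s\<in>S. f s x)"
  by (induction S rule: infinite_finite_induct) auto

lemma independent_family:
  assumes "finite S" and ind: "\<And>c. (\<And>x. (\<Sum>s\<in>S. c s * g s x) = 0) \<Longrightarrow> (\<And>s. s \<in> S \<Longrightarrow> c s = 0)"
  shows "inj_on g S" and "fun_space.independent (g ` S)"
proof -
  show inj: "inj_on g S"
  proof (rule inj_onI, rule ccontr)
    fix s t assume st: "s \<in> S" "t \<in> S" "g s = g t" "s \<noteq> t"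
    let ?c = "\<lambda>r. if r = s then 1 else if r = t then -1 else 0"
    have "(\<Sum>r\<in>S. ?c r * g r x) = 0" for x
    proof -
      have "(\<Sum>r\<in>S. ?c r * g r x) = (\<Sum>r\<in>S. (if r = s then g r x else 0) - (if r = t then g r x else 0))"
        by (rule sum.cong) (use st in auto)
      with st assms(1) show ?thesis by (simp add: sum_subtractf)
    qed
    from ind[of ?c, OF this st(1)] show False by simp
  qed
  show "fun_space.independent (g ` S)"
  proof
    assume "fun_space.dependent (g ` S)"
    then obtain u v where v: "v \<in> g ` S" "u v \<noteq> 0"
      and zero: "(\<Sum>v\<in>g ` S. fun_scale (u v) v) = 0"
      using fun_space.dependent_finite[of "g ` S"] assms(1) by auto
    have "(\<Sum>s\<in>S. u (g s) * g s x) = 0" for x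
    proof -
      have "(\<Sum>v\<in>g ` S. fun_scale (u v) v) x = (\<Sum>v\<in>g ` S. fun_scale (u v) v x)"
        by (rule sum_fun_eval)
      then show ?thesis using zero inj by (simp add: sum.reindex fun_scale_def)
    qed
    from ind[of "\<lambda>s. u (g s)", OF this] v show False by auto
  qed
qed

lemma card_le_if_independent_in_span:
  assumes "finite B" and "\<And>i. i < m \<Longrightarrow> g i \<in> fun_space.span B"
    and "\<And>c. (\<And>x. (\<Sum>i<m. c i * g i x) = 0) \<Longrightarrow> (\<And>i. i < m \<Longrightarrow> c i = 0)"
  shows "m \<le> card B"
proof -
  have ind: "inj_on g {..<m}" "fun_space.independent (g ` {..<m})"
    using independent_family[of "{..<m}" g] assms(3) by auto
  have "g ` {..<m} \<subseteq> fun_space.span B" using assms(2) by auto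
  from fun_space.independent_span_bound[OF assms(1) ind(2) this] show ?thesis
    using card_image[OF ind(1)] by simp
qed

text \<open>Degree at most \<open>d\<close> in each variable separately. With this grading the chart
  entries have degree 1 although they contain products of two parameters, and the number of
  monomials is bounded by a power of \<open>d + 1\<close>.\<close>

definition box_exponents :: "'i set \<Rightarrow> nat \<Rightarrow> ('i \<Rightarrow> nat) set" where
  "box_exponents I d = {\<beta>. \<forall>i. (i \<in> I \<longrightarrow> \<beta> i \<in> {..d}) \<and> (i \<notin> I \<longrightarrow> \<beta> i = 0)}"

lemma finite_box_exponents: "finite I \<Longrightarrow> finite (box_exponents I d)"
  unfolding box_exponents_def by (rule finite_set_of_finite_funs) auto

lemma card_box_exponents_le:
  assumes "finite I"
  shows "card (box_exponents I d) \<le> Suc d ^ card I"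
proof -
  have "inj_on (\<lambda>\<beta>. restrict \<beta> I) (box_exponents I d)"
  proof (rule inj_onI)
    fix \<beta> \<beta>' assume b: "\<beta> \<in> box_exponents I d" "\<beta>' \<in> box_exponents I d" "restrict \<beta> I = restrict \<beta>' I"
    show "\<beta> = \<beta>'"
    proof
      fix i show "\<beta> i = \<beta>' i"
        using b(1,2) fun_cong[OF b(3), of i] by (cases "i \<in> I") (simp_all add: box_exponents_def)
    qed
  qed
  moreover have "(\<lambda>\<beta>. restrict \<beta> I) ` box_exponents I d \<subseteq> I \<rightarrow>\<^sub>E {..d}"
    by (auto simp: box_exponents_def)
  moreover have "finite (I \<rightarrow>\<^sub>E {..d})" using assms by (simp add: finite_PiE)
  ultimately have "card (box_exponents I d) \<le> card (I \<rightarrow>\<^sub>E {..d})" by (rule card_inj_on_le)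
  then show ?thesis using assms by (simp add: card_funcsetE)
qed

abbreviation box_polys :: "'i set \<Rightarrow> nat \<Rightarrow> (('i \<Rightarrow> complex) \<Rightarrow> complex) set" where
  "box_polys I d \<equiv> poly_span I (box_exponents I d)"

lemma zero_mem_box_exponents: "(\<lambda>i. 0) \<in> box_exponents I d"
  by (auto simp: box_exponents_def)

lemma add_mem_box_exponents:
  "\<alpha> \<in> box_exponents I d \<Longrightarrow> \<beta> \<in> box_exponents I e \<Longrightarrow> (\<lambda>i. \<alpha> i + \<beta> i) \<in> box_exponents I (d + e)"
  by (auto simp: box_exponents_def add_mono)

lemmas box_polys_const = poly_span_const[OF zero_mem_box_exponents]

lemma monomial_at_indicator:
  assumes "finite I" "S \<subseteq> I"
  shows "monomial_at I (\<lambda>j. of_bool (j \<in> S)) x = (\<Prod>j\<in>S. x j)"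
proof -
  have "(\<Prod>j\<in>I. x j ^ of_bool (j \<in> S)) = (\<Prod>j\<in>S. x j)"
    by (rule prod.mono_neutral_cong_right) (use assms in auto)
  then show ?thesis by (simp add: monomial_at_def)
qed

lemma box_polys_squarefree:
  assumes "finite I" "S \<subseteq> I"
  shows "(\<lambda>x. \<Prod>j\<in>S. x j) \<in> box_polys I 1"
proof -
  have "(\<lambda>j. of_bool (j \<in> S)) \<in> box_exponents I 1" using assms(2) by (auto simp: box_exponents_def)
  from poly_span_monomial[OF this] show ?thesis
    using monomial_at_indicator[OF assms] by (metis (no_types, lifting) ext)
qed

lemma box_polys_var: "finite I \<Longrightarrow> i \<in> I \<Longrightarrow> (\<lambda>x. x i) \<in> box_polys I 1"
  using box_polys_squarefree[of I "{i}"] by simp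

lemma box_polys_var2:
  "finite I \<Longrightarrow> i \<in> I \<Longrightarrow> j \<in> I \<Longrightarrow> i \<noteq> j \<Longrightarrow> (\<lambda>x. x i * x j) \<in> box_polys I 1"
  using box_polys_squarefree[of I "{i, j}"] by simp

lemma box_polys_prod:
  "finite S \<Longrightarrow> (\<And>s. s \<in> S \<Longrightarrow> F s \<in> box_polys I (d s)) \<Longrightarrow>
    (\<lambda>x. \<Prod>s\<in>S. F s x) \<in> box_polys I (\<Sum>s\<in>S. d s)"
  by (rule poly_span_prod[where E = "box_exponents I", OF zero_mem_box_exponents add_mem_box_exponents])

lemma box_polys_power: "F \<in> box_polys I d \<Longrightarrow> (\<lambda>x. F x ^ k) \<in> box_polys I (k * d)"
  using box_polys_prod[of "{..<k}" "\<lambda>_. F" I "\<lambda>_. d"] by simp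

lemma hforms_substitute_box:
  assumes "F \<in> hforms I d" and "finite I" and "\<And>i. i \<in> I \<Longrightarrow> (\<lambda>u. \<phi> u i) \<in> box_polys J 1"
  shows "(\<lambda>u. F (\<phi> u)) \<in> box_polys J d"
  using assms(1)
proof (induction rule: poly_span_induct)
  case (monomial \<alpha>)
  have "(\<lambda>u. \<phi> u i ^ \<alpha> i) \<in> box_polys J (\<alpha> i)" if "i \<in> I" for i
    using box_polys_power[OF assms(3)[OF that], of "\<alpha> i"] by simp
  from box_polys_prod[OF assms(2), of "\<lambda>i u. \<phi> u i ^ \<alpha> i", OF this] monomial
  show ?case by (simp add: monomial_at_def exponents_def)
qed (auto intro: poly_span_zero poly_span_add poly_span_scale)

text \<open>A generic matrix of rank \<open>r\<close> is \<open>[I; c] [a b]\<close>. The parameters \<open>c\<close> and \<open>a - I\<close>, \<open>b\<close>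
  are indexed by the positions they occupy in the product; \<open>(0, 0)\<close> is normalized to \<open>1\<close>.\<close>

definition border :: "nat \<Rightarrow> nat \<Rightarrow> (nat \<times> nat) set" where
  "border n r = {(i, j) \<in> entries n. i < r \<or> j < r}"

definition chart_params :: "nat \<Rightarrow> nat \<Rightarrow> (nat \<times> nat) set" where
  "chart_params n r = border n r - {(0, 0)}"

definition chart :: "nat \<Rightarrow> nat \<Rightarrow> (nat \<times> nat \<Rightarrow> complex) \<Rightarrow> complex mat" where
  "chart n r u =
     mat n r (\<lambda>(i, k). if i < r then of_bool (i = k) else u (i, k)) *
     mat r n (\<lambda>(k, j). of_bool (k = j) + u (k, j))"

lemma finite_chart_params: "finite (chart_params n r)"
  by (rule finite_subset[OF _ finite_entries[of n]]) (auto simp: chart_params_def border_def)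

lemma finite_border: "finite (border n r)"
  by (rule finite_subset[OF _ finite_entries[of n]]) (auto simp: border_def)

lemma card_border: "1 \<le> r \<Longrightarrow> 1 \<le> n \<Longrightarrow> card (border n r) = Suc (card (chart_params n r))"
  unfolding chart_params_def
  by (rule card.remove[OF finite_border]) (auto simp: border_def mem_entries)

lemma chart_carrier [simp]: "chart n r u \<in> carrier_mat n n"
  unfolding chart_def by (rule mult_carrier_mat[of _ n r]) auto

lemma dim_chart [simp]: "dim_row (chart n r u) = n" "dim_col (chart n r u) = n"
  using carrier_matD[OF chart_carrier] by blast+

lemma mat_rank_chart: "mat_rank (chart n r u) \<le> r"
  unfolding chart_def by (rule mat_rank_mult_le) auto

lemma index_chart:
  assumes "i < n" "j < n"
  shows "chart n r u $$ (i, j) =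
    (if i < r then of_bool (i = j) + u (i, j)
     else (\<Sum>k<r. u (i, k) * (of_bool (k = j) + u (k, j))))"
proof -
  have "chart n r u $$ (i, j) =
    (\<Sum>k<r. (if i < r then of_bool (i = k) else u (i, k)) * (of_bool (k = j) + u (k, j)))"
    unfolding chart_def by (subst index_mult_mat_sum[of _ n r _ n]) (use assms in auto)
  moreover have "(\<Sum>k<r. of_bool (i = k) * (of_bool (k = j) + u (k, j))) =
    (\<Sum>k<r. if k = i then of_bool (i = j) + u (i, j) else 0)"
    by (rule sum.cong) auto
  ultimately show ?thesis by simp
qed

text \<open>Reads off the parameters of a product whose left factor starts with an identity block.
  Dividing the right factor by its corner entry \<open>c\<close> achieves the normalization at
  \<open>(0, 0)\<close>.\<close>

lemma chart_eq_product:
  assumes L: "L \<in> carrier_mat n r" "\<And>i k. i < r \<Longrightarrow> k < r \<Longrightarrow> L $$ (i, k) = of_bool (i = k)"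
    and R: "R \<in> carrier_mat r n" and "R $$ (0, 0) = c" "c \<noteq> 0" "1 \<le> r" "r \<le> n"
  obtains u where "u (0, 0) = 0" "L * R = c \<cdot>\<^sub>m chart n r u"
proof -
  define u where "u = (\<lambda>(i, j). if i < r then R $$ (i, j) / c - of_bool (i = j) else L $$ (i, j))"
  have "u (0, 0) = 0" using assms by (simp add: u_def)
  moreover have "L * R = c \<cdot>\<^sub>m chart n r u"
  proof (rule eq_matI)
    fix i j assume "i < dim_row (c \<cdot>\<^sub>m chart n r u)" "j < dim_col (c \<cdot>\<^sub>m chart n r u)"
    then have ij: "i < n" "j < n" using chart_carrier[of n r u] by auto
    have "(L * R) $$ (i, j) = (\<Sum>k<r. L $$ (i, k) * R $$ (k, j))"
      by (rule index_mult_mat_sum[OF L(1) R ij])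
    also have "\<dots> = c * (\<Sum>k<r. (if i < r then of_bool (i = k) else u (i, k)) * (of_bool (k = j) + u (k, j)))"
      unfolding sum_distrib_left
      by (rule sum.cong) (use L(2) \<open>c \<noteq> 0\<close> in \<open>auto simp: u_def\<close>)
    also have "\<dots> = c * chart n r u $$ (i, j)"
      unfolding chart_def by (subst index_mult_mat_sum[of _ n r _ n]) (use ij in auto)
    finally show "(L * R) $$ (i, j) = (c \<cdot>\<^sub>m chart n r u) $$ (i, j)"
      using ij chart_carrier[of n r u] by simp
  qed (use L R in auto)
  ultimately show thesis by (rule that)
qed

section \<open>Polynomial dependence on one parameter, and density of the chart\<close>

definition poly_fun :: "(complex \<Rightarrow> complex) \<Rightarrow> bool" where
  "poly_fun f \<longleftrightarrow> (\<exists>q. \<forall>t. f t = poly q t)"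

lemma poly_curve_iff: "poly_curve \<gamma> \<longleftrightarrow> (\<forall>i. poly_fun (\<lambda>t. \<gamma> t i))"
  by (simp add: poly_curve_def poly_fun_def)

lemma poly_fun_const [intro]: "poly_fun (\<lambda>t. c)"
  unfolding poly_fun_def by (rule exI[of _ "[:c:]"]) auto

lemma poly_fun_id [intro]: "poly_fun (\<lambda>t. t)"
  unfolding poly_fun_def by (rule exI[of _ "[:0, 1:]"]) auto

lemma poly_fun_add [intro]:
  assumes "poly_fun f" "poly_fun g"
  shows "poly_fun (\<lambda>t. f t + g t)"
proof -
  from assms obtain p q where "\<forall>t. f t = poly p t" "\<forall>t. g t = poly q t" by (auto simp: poly_fun_def)
  then show ?thesis unfolding poly_fun_def by (intro exI[of _ "p + q"]) simp
qed

lemma poly_fun_mult [intro]: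
  assumes "poly_fun f" "poly_fun g"
  shows "poly_fun (\<lambda>t. f t * g t)"
proof -
  from assms obtain p q where "\<forall>t. f t = poly p t" "\<forall>t. g t = poly q t" by (auto simp: poly_fun_def)
  then show ?thesis unfolding poly_fun_def by (intro exI[of _ "p * q"]) simp
qed

lemma poly_fun_sum [intro]: "(\<And>s. s \<in> S \<Longrightarrow> poly_fun (f s)) \<Longrightarrow> poly_fun (\<lambda>t. \<Sum>s\<in>S. f s t)"
  by (induction S rule: infinite_finite_induct) auto

lemma poly_fun_prod [intro]: "(\<And>s. s \<in> S \<Longrightarrow> poly_fun (f s)) \<Longrightarrow> poly_fun (\<lambda>t. \<Prod>s\<in>S. f s t)"
  by (induction S rule: infinite_finite_induct) auto

lemma poly_fun_mult_mat:
  assumes "\<And>t. A t \<in> carrier_mat nr m" "\<And>t. B t \<in> carrier_mat m nc"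
    and "\<And>i k. i < nr \<Longrightarrow> k < m \<Longrightarrow> poly_fun (\<lambda>t. A t $$ (i, k))"
    and "\<And>k j. k < m \<Longrightarrow> j < nc \<Longrightarrow> poly_fun (\<lambda>t. B t $$ (k, j))"
    and "i < nr" "j < nc"
  shows "poly_fun (\<lambda>t. (A t * B t) $$ (i, j))"
  unfolding index_mult_mat_sum[OF assms(1,2,5,6)]
  by (intro poly_fun_sum poly_fun_mult assms(3,4)) (use assms(5,6) in auto)

lemma poly_fun_det:
  assumes "\<And>t. A t \<in> carrier_mat k k" "\<And>i j. i < k \<Longrightarrow> j < k \<Longrightarrow> poly_fun (\<lambda>t. A t $$ (i, j))"
  shows "poly_fun (\<lambda>t. det (A t))"
proof -
  have "poly_fun (\<lambda>t. \<Sum>\<pi>\<in>{\<pi>. \<pi> permutes {0..<k}}. signof \<pi> * (\<Prod>i=0..<k. A t $$ (i, \<pi> i)))"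
  proof (intro poly_fun_sum poly_fun_mult poly_fun_const poly_fun_prod)
    fix \<pi> i assume "\<pi> \<in> {\<pi>. \<pi> permutes {0..<k}}" "i \<in> {0..<k}"
    then have "\<pi> i < k" "i < k" using permutes_in_image[of \<pi> "{0..<k}" i] by auto
    then show "poly_fun (\<lambda>t. A t $$ (i, \<pi> i))" by (intro assms(2))
  qed
  then show ?thesis by (simp add: det_def'[OF assms(1)])
qed

text \<open>The determinant is the value at \<open>t\<close> of the characteristic polynomial of
  \<open>- A\<close>, which is monic. Thus adding \<open>t\<close> times the identity makes any
  square matrix invertible for all but finitely many \<open>t\<close>.\<close>

lemma finite_det_add_scalar_zero:
  fixes A :: "complex mat"
  assumes A: "A \<in> carrier_mat k k"
  shows "finite {t. det (A + t \<cdot>\<^sub>m 1\<^sub>m k) = 0}"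
proof -
  have ne: "char_poly (- A) \<noteq> 0" using degree_monic_char_poly[of "- A" k] A by auto
  have "poly (char_poly (- A)) t = det (A + t \<cdot>\<^sub>m 1\<^sub>m k)" for t
  proof -
    have "- char_matrix (- A) t = A + t \<cdot>\<^sub>m 1\<^sub>m k"
      using A by (intro eq_matI) (auto simp: char_matrix_def)
    then show ?thesis using char_poly_matrix[of "- A" k t] A by simp
  qed
  with poly_roots_finite[OF ne] show ?thesis by simp
qed

text \<open>The chart meets the matrices of rank at most \<open>r\<close> densely. Write
  \<open>A = U * W\<close> and perturb both factors; for all but finitely many \<open>t\<close> the
  product is a nonzero multiple of a chart matrix, so the form vanishes there, and then also at
  \<open>t = 0\<close>.\<close>

lemma hforms_zero_on_rank_le:
  assumes F: "F \<in> hforms (entries n) d"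
    and zero: "\<And>u. u (0, 0) = 0 \<Longrightarrow> F (coords n (chart n r u)) = 0"
    and r: "1 \<le> r" "r \<le> n" and A: "A \<in> carrier_mat n n" "mat_rank A \<le> r"
  shows "F (coords n A) = 0"
proof -
  obtain U W where UW: "U \<in> carrier_mat n r" "W \<in> carrier_mat r n" "A = U * W"
    by (rule mat_rank_leE[OF A])
  define V where "V = mat r r (\<lambda>(i, k). U $$ (i, k))"
  have V: "V \<in> carrier_mat r r" by (simp add: V_def)
  define Ut where "Ut t = U + t \<cdot>\<^sub>m rank_form n r r" for t
  define Wt where "Wt t = W + t \<cdot>\<^sub>m rank_form r n r" for t
  have Utc: "Ut t \<in> carrier_mat n r" and Wtc: "Wt t \<in> carrier_mat r n" for t
    using UW by (auto simp: Ut_def Wt_def)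
  define \<gamma> where "\<gamma> t = coords n (Ut t * Wt t)" for t
  have curve: "poly_curve \<gamma>"
    unfolding poly_curve_iff
  proof
    fix i show "poly_fun (\<lambda>t. \<gamma> t i)"
    proof (cases "i \<in> entries n")
      case True
      then obtain a b where ab: "i = (a, b)" "a < n" "b < n" by (auto simp: entries_def)
      have "poly_fun (\<lambda>t. (Ut t * Wt t) $$ (a, b))"
        by (rule poly_fun_mult_mat[OF Utc Wtc]) (use UW ab in \<open>auto simp: Ut_def Wt_def\<close>)
      with ab show ?thesis by (simp add: \<gamma>_def coords_def del: index_mult_mat(1))
    next
      case False
      then have "(\<lambda>t. \<gamma> t i) = (\<lambda>t. 0)" by (auto simp: \<gamma>_def coords_def entries_def split: prod.splits)
      then show ?thesis by auto
    qed
  qed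
  \<comment> \<open>The corner entry of the perturbed product is monic of degree 2 in
    \<open>t\<close>, because both factors are shifted in their leading diagonal entry. So it
    vanishes for at most finitely many \<open>t\<close>.\<close>
  let ?q = "[:\<Sum>k<r. U $$ (0, k) * W $$ (k, 0), U $$ (0, 0) + W $$ (0, 0), 1:]"
  have corner: "(Ut t * Wt t) $$ (0, 0) = poly ?q t" for t
  proof -
    have "(Ut t * Wt t) $$ (0, 0) = (\<Sum>k<r. Ut t $$ (0, k) * Wt t $$ (k, 0))"
      by (rule index_mult_mat_sum[OF Utc Wtc]) (use r in auto)
    also have "\<dots> = (\<Sum>k<r. U $$ (0, k) * W $$ (k, 0) +
        (if k = 0 then t * U $$ (0, 0) + t * W $$ (0, 0) + t * t else 0))"
      by (rule sum.cong) (use UW r in \<open>auto simp: Ut_def Wt_def algebra_simps\<close>)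
    also have "\<dots> = poly ?q t" using r by (simp add: sum.distrib algebra_simps)
    finally show ?thesis .
  qed
  have qfin: "finite {t. poly ?q t = 0}" by (rule poly_roots_finite) simp
  have zero': "F (\<gamma> t) = 0"
    if t: "t \<notin> {t. det (V + t \<cdot>\<^sub>m 1\<^sub>m r) = 0} \<union> {t. poly ?q t = 0}" for t
  proof -
    let ?X = "V + t \<cdot>\<^sub>m 1\<^sub>m r"
    have "?X \<in> carrier_mat r r" "det ?X \<noteq> 0" using V t by auto
    then obtain X' where X': "inverse_pair r ?X X'" by (rule inverse_pair_exists)
    note Xc = inverse_pairD[OF X']
    \<comment> \<open>The invertible top block moves from the left factor to the right one. The left
      factor then starts with the identity and the product is unchanged.\<close>
    have L: "Ut t * X' \<in> carrier_mat n r" and R: "?X * Wt t \<in> carrier_mat r n"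
      by (rule mult_carrier_mat[OF Utc Xc(2)]) (rule mult_carrier_mat[OF Xc(1) Wtc])
    have "X' * (?X * Wt t) = Wt t" by (rule inverse_pair_cancel[OF inverse_pair_sym[OF X'] Wtc])
    then have LR: "Ut t * X' * (?X * Wt t) = Ut t * Wt t"
      using assoc_mult_mat[OF Utc Xc(2) R] by simp
    have top: "(Ut t * X') $$ (i, k) = of_bool (i = k)" if "i < r" "k < r" for i k
    proof -
      have "(Ut t * X') $$ (i, k) = (\<Sum>l<r. Ut t $$ (i, l) * X' $$ (l, k))"
        by (rule index_mult_mat_sum[OF Utc Xc(2)]) (use that r in auto)
      also have "\<dots> = (\<Sum>l<r. ?X $$ (i, l) * X' $$ (l, k))"
        by (rule sum.cong) (use that r UW V in \<open>auto simp: Ut_def V_def\<close>)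
      also have "\<dots> = (?X * X') $$ (i, k)"
        by (rule index_mult_mat_sum[OF Xc(1,2) that, symmetric])
      finally show ?thesis using Xc(3) that by simp
    qed
    have RL: "(?X * Wt t) $$ (0, 0) = (Ut t * Wt t) $$ (0, 0)"
    proof -
      have "(?X * Wt t) $$ (0, 0) = (\<Sum>l<r. ?X $$ (0, l) * Wt t $$ (l, 0))"
        by (rule index_mult_mat_sum[OF Xc(1) Wtc]) (use r in auto)
      also have "\<dots> = (\<Sum>l<r. Ut t $$ (0, l) * Wt t $$ (l, 0))"
        by (rule sum.cong) (use r UW V in \<open>auto simp: Ut_def V_def\<close>)
      also have "\<dots> = (Ut t * Wt t) $$ (0, 0)"
        by (rule index_mult_mat_sum[OF Utc Wtc, symmetric]) (use r in auto)
      finally show ?thesis .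
    qed
    let ?c = "(?X * Wt t) $$ (0, 0)"
    have "?c \<noteq> 0" unfolding RL corner using t by blast
    then obtain u where u: "u (0, 0) = 0" "Ut t * X' * (?X * Wt t) = ?c \<cdot>\<^sub>m chart n r u"
      using chart_eq_product[OF L top R refl _ r] by blast
    have "\<gamma> t = (\<lambda>i. ?c * coords n (chart n r u) i)"
      unfolding \<gamma>_def LR[symmetric] u(2) by (rule coords_smult[OF chart_carrier])
    then show ?thesis using hforms_homogeneous[OF F, of ?c "coords n (chart n r u)"] zero[of u, OF u(1)]
      by (simp del: index_mult_mat(1))
  qed
  have "F (\<gamma> 0) = 0"
    by (rule hforms_zero_on_curve[OF F curve finite_UnI[OF finite_det_add_scalar_zero[OF V] qfin] zero'])
  moreover have "\<gamma> 0 = coords n A"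
  proof -
    have "Ut 0 = U" "Wt 0 = W" using UW by (auto simp: Ut_def Wt_def intro!: eq_matI)
    with UW(3) show ?thesis by (simp add: \<gamma>_def)
  qed
  ultimately show ?thesis by simp
qed

text \<open>Lower entries are sums of products of a parameter in row \<open>i \<ge> r\<close> with
  one in a row \<open>k < r\<close>. These are different variables, so every monomial is squarefree.
  Position \<open>(0, 0)\<close> is reset to 0 because it is no parameter.\<close>

lemma chart_box_poly:
  assumes "(i, j) \<in> entries n"
  shows "(\<lambda>u. coords n (chart n r (u((0, 0) := 0))) (i, j)) \<in> box_polys (chart_params n r) 1"
proof -
  let ?B = "box_polys (chart_params n r) 1"
  have ij: "i < n" "j < n" using assms by (auto simp: mem_entries)
  have top: "(\<lambda>u. of_bool b + (u((0, 0) := 0)) (k, j)) \<in> ?B" if "k < r" "k < n" for k b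
  proof (cases "(k, j) = (0, 0)")
    case True
    then show ?thesis by (simp add: box_polys_const)
  next
    case False
    then have "(k, j) \<in> chart_params n r"
      using that ij by (auto simp: chart_params_def border_def mem_entries)
    from poly_span_add[OF box_polys_const box_polys_var[OF finite_chart_params this]]
    have "(\<lambda>u. of_bool b + u (k, j)) \<in> ?B" .
    moreover have "(\<lambda>u :: _ \<Rightarrow> complex. of_bool b + (u((0, 0) := 0)) (k, j)) = (\<lambda>u. of_bool b + u (k, j))"
      using False by auto
    ultimately show ?thesis by (simp only:)
  qed
  show ?thesis
  proof (cases "i < r")
    case True
    then show ?thesis using top[OF True ij(1), of "i = j"] ij by (simp add: coords_def index_chart)
  next
    case False
    have "(\<lambda>u. (u((0, 0) := 0)) (i, k) * (of_bool (k = j) + (u((0, 0) := 0)) (k, j))) \<in> ?B"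
      if k: "k < r" for k
    proof -
      have ik: "(i, k) \<in> chart_params n r" "(i, k) \<noteq> (0, 0)" "(i, k) \<noteq> (k, j)"
        using False k ij by (auto simp: chart_params_def border_def mem_entries)
      have one: "(\<lambda>u. of_bool (k = j) * u (i, k)) \<in> ?B"
        by (rule poly_span_scale[OF box_polys_var[OF finite_chart_params ik(1)]])
      show ?thesis
      proof (cases "(k, j) = (0, 0)")
        case True
        with one ik show ?thesis by (auto simp: mult.commute)
      next
        case False
        then have "(k, j) \<in> chart_params n r"
          using k ij \<open>\<not> i < r\<close> by (auto simp: chart_params_def border_def mem_entries)
        from poly_span_add[OF one box_polys_var2[OF finite_chart_params ik(1) this ik(3)]] False ik(2)
        show ?thesis by (auto simp: algebra_simps)
      qed
    qed
    then have "(\<lambda>u. \<Sum>k<r. (u((0, 0) := 0)) (i, k) * (of_bool (k = j) + (u((0, 0) := 0)) (k, j))) \<in> ?B"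
      by (intro poly_span_sum) auto
    with False ij show ?thesis by (simp add: coords_def index_chart del: fun_upd_apply)
  qed
qed

text \<open>Pulling back to the chart preserves independence, since a form that vanishes on the
  chart vanishes on the whole variety. The pullbacks lie in the span of at most
  \<open>Suc d ^ card (chart_params n r)\<close> monomials.\<close>

lemma indep_forms_det_variety_le:
  assumes r: "1 \<le> r" "r \<le> n" and "indep_forms (entries n) (\<Union>(det_variety n r)) d m"
  shows "m \<le> Suc d ^ card (chart_params n r)"
proof -
  let ?J = "chart_params n r" and ?\<phi> = "\<lambda>u. coords n (chart n r (u((0, 0) := 0)))"
  from assms(3) obtain f where f: "\<And>i. i < m \<Longrightarrow> f i \<in> hforms (entries n) d"
    "\<And>c. (\<And>x. x \<in> \<Union>(det_variety n r) \<Longrightarrow> (\<Sum>i<m. c i * f i x) = 0) \<Longrightarrow> (\<forall>i<m. c i = 0)"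
    unfolding indep_forms_def by metis
  let ?B = "monomial_at ?J ` box_exponents ?J d"
  have fin: "finite (box_exponents ?J d)" by (rule finite_box_exponents[OF finite_chart_params])
  have "m \<le> card ?B"
  proof (rule card_le_if_independent_in_span[where g = "\<lambda>i u. f i (?\<phi> u)"])
    show "finite ?B" using fin by simp
    show "(\<lambda>u. f i (?\<phi> u)) \<in> fun_space.span ?B" if "i < m" for i
      using hforms_substitute_box[OF f(1)[OF that] finite_entries, of ?\<phi> ?J] chart_box_poly
      unfolding poly_span_def by auto
    fix c i assume c: "\<And>u. (\<Sum>i<m. c i * f i (?\<phi> u)) = 0" and "i < m"
    have F: "(\<lambda>x. \<Sum>i<m. c i * f i x) \<in> hforms (entries n) d"
      using f(1) by (intro poly_span_sum poly_span_scale) auto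
    have "(\<Sum>i<m. c i * f i x) = 0" if x: "x \<in> \<Union>(det_variety n r)" for x
    proof -
      obtain p where p: "p \<in> det_variety n r" "x \<in> p" using x by blast
      have "(\<Sum>i<m. c i * f i (coords n (mat n n x))) = 0"
      proof (rule hforms_zero_on_rank_le[OF F _ r _ det_variety_mem(1)[OF p]])
        fix u :: "nat \<times> nat \<Rightarrow> complex" assume "u (0, 0) = 0"
        then have "u((0, 0) := 0) = u" by auto
        with c[of u] show "(\<Sum>i<m. c i * f i (coords n (chart n r u))) = 0" by simp
      qed simp
      then show ?thesis by (simp add: det_variety_mem(2)[OF p])
    qed
    from f(2)[OF this] \<open>i < m\<close> show "c i = 0" by blast
  qed
  also have "\<dots> \<le> card (box_exponents ?J d)" by (rule card_image_le[OF fin])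
  also have "\<dots> \<le> Suc d ^ card ?J" by (rule card_box_exponents_le[OF finite_chart_params])
  finally show ?thesis .
qed

text \<open>A chain of length \<open>k\<close> yields binomial growth of order \<open>k\<close> in
  the degree, the chart allows only order \<open>card (chart_params n r)\<close>. The scaling
  constant \<open>E\<close> does not change the order of growth.\<close>

lemma chain_length_det_variety_le:
  assumes r: "1 \<le> r" "r \<le> n"
    and irr: "\<And>j. j \<le> k \<Longrightarrow> zariski_irreducible (entries n) (C j)"
    and strict: "\<And>j. j < k \<Longrightarrow> C j \<subset> C (Suc j)" and sub: "C k \<subseteq> det_variety n r"
  shows "k \<le> card (chart_params n r)"
proof (rule ccontr)
  let ?M = "card (chart_params n r)"
  assume "\<not> k \<le> ?M"
  then have k: "?M < k" by simp
  have "\<exists>E. \<forall>d. indep_forms (entries n) (\<Union>(C k)) (E * d) ((d + k) choose k)"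
    by (rule chain_indep_forms[where C = C and k = k, OF finite_entries irr strict]) blast+
  then obtain E where E: "\<And>d. indep_forms (entries n) (\<Union>(C k)) (E * d) ((d + k) choose k)"
    by blast
  have bound: "((d + k) choose k) \<le> Suc (E * d) ^ ?M" for d
    by (rule indep_forms_det_variety_le[OF r indep_forms_subset[OF E]]) (use sub in blast)
  \<comment> \<open>With \<open>d = k * x\<close> the estimate
    \<open>(n / k) ^ k \<le> n choose k\<close> gives exactly \<open>Suc x ^ k\<close>. Cancelling a
    power of \<open>Suc x\<close> leaves a bound for \<open>Suc x\<close> that is independent of
    \<open>x\<close>.\<close>
  have growth: "Suc x \<le> Suc (E * k) ^ ?M" for x
  proof -
    have "real (k * x + k) / real k = real (Suc x)" using k by (simp add: field_simps)
    then have "real (Suc x) ^ k = (real (k * x + k) / real k) ^ k" by (simp only:)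
    also have "\<dots> \<le> real ((k * x + k) choose k)" by (rule binomial_ge_n_over_k_pow_k) simp
    finally have "Suc x ^ k \<le> (k * x + k) choose k" by (metis of_nat_le_iff of_nat_power)
    also have "\<dots> \<le> Suc (E * (k * x)) ^ ?M" by (rule bound)
    also have "\<dots> \<le> (Suc (E * k) * Suc x) ^ ?M" by (rule power_mono) (auto simp: algebra_simps)
    also have "\<dots> = Suc (E * k) ^ ?M * Suc x ^ ?M" by (rule power_mult_distrib)
    finally have "Suc x ^ (k - ?M) * Suc x ^ ?M \<le> Suc (E * k) ^ ?M * Suc x ^ ?M"
      using k by (simp add: power_add[symmetric] del: power_Suc)
    then have "Suc x ^ (k - ?M) \<le> Suc (E * k) ^ ?M" by (simp del: power_Suc)
    moreover have "Suc x ^ 1 \<le> Suc x ^ (k - ?M)" by (rule power_increasing) (use k in auto)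
    ultimately show ?thesis by simp
  qed
  from growth[of "Suc (E * k) ^ ?M"] show False by simp
qed

section \<open>The local dimension: lower bound\<close>

lemma triple_carrier:
  "P \<in> carrier_mat n n \<Longrightarrow> X \<in> carrier_mat n n \<Longrightarrow> Q \<in> carrier_mat n n \<Longrightarrow> P * X * Q \<in> carrier_mat n n"
  by (intro mult_carrier_mat[of _ n n]) auto

lemma inverse_pair_conjugate:
  assumes P: "inverse_pair n P P'" and Q: "inverse_pair n Q Q'" and X: "X \<in> carrier_mat n n"
  shows "P' * (P * X * Q) * Q' = X"
proof -
  note Pc = inverse_pairD[OF P] and Qc = inverse_pairD[OF Q]
  have PX: "P * X \<in> carrier_mat n n" by (rule mult_carrier_mat[OF Pc(1) X])
  have "P' * (P * X * Q) * Q' = P' * (P * X * Q * Q')"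
    by (rule assoc_mult_mat[OF Pc(2) mult_carrier_mat[OF PX Qc(1)] Qc(2)])
  also have "P * X * Q * Q' = P * X" by (rule inverse_pair_cancel_right[OF Q PX])
  also have "P' * (P * X) = X" by (rule inverse_pair_cancel[OF inverse_pair_sym[OF P] X])
  finally show ?thesis .
qed

text \<open>Expands P z Q in the matrices P E_t Q with E_t the matrix unit at position
  \<open>t\<close>. Those with \<open>t\<close> in \<open>border n r\<close> will be the basis of
  the tangent space.\<close>

lemma coords_triple_eq_sum:
  assumes P: "P \<in> carrier_mat n n" and Q: "Q \<in> carrier_mat n n"
    and "S \<subseteq> entries n" and z: "\<And>t. t \<in> entries n - S \<Longrightarrow> z t = 0"
  shows "coords n (P * mat n n z * Q) x =
    (\<Sum>t\<in>S. z t * (if x \<in> entries n then P $$ (fst x, fst t) * Q $$ (snd t, snd x) else 0))"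
proof (cases "x \<in> entries n")
  case True
  then obtain i j where x: "x = (i, j)" "i < n" "j < n" by (auto simp: entries_def)
  have "(P * mat n n z * Q) $$ (i, j) = (\<Sum>k<n. \<Sum>l<n. P $$ (i, k) * mat n n z $$ (k, l) * Q $$ (l, j))"
    by (rule index_triple_mult[OF P _ Q x(2,3)]) simp
  also have "\<dots> = (\<Sum>k<n. \<Sum>l<n. z (k, l) * (P $$ (i, k) * Q $$ (l, j)))"
    by (intro sum.cong refl) auto
  also have "\<dots> = (\<Sum>t\<in>entries n. z t * (P $$ (i, fst t) * Q $$ (snd t, j)))"
    by (simp add: sum_entries)
  also have "\<dots> = (\<Sum>t\<in>S. z t * (P $$ (i, fst t) * Q $$ (snd t, j)))"
    by (rule sum.mono_neutral_right) (use assms finite_entries in auto)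
  finally show ?thesis using x True by (simp add: coords_def del: index_mult_mat(1))
qed (auto simp: coords_def entries_def split: prod.splits)

lemma hforms_conjugate_entry:
  assumes "P \<in> carrier_mat n n" "Q \<in> carrier_mat n n" "i < n" "j < n"
  shows "(\<lambda>a. (P * mat n n a * Q) $$ (i, j)) \<in> hforms (entries n) 1"
proof (rule hforms_linear_matrix[OF assms(1,2) _ _ assms(3,4)])
  show "(\<lambda>a. mat n n a $$ (k, l)) \<in> hforms (entries n) 1" if "k < n" "l < n" for k l
    using hforms_entry[OF that] that by simp
qed simp

lemma poly_fun_chart_line:
  assumes "i < n" "j < n"
  shows "poly_fun (\<lambda>t. chart n r (\<lambda>s. u s + t * v s) $$ (i, j))"
  unfolding index_chart[OF assms]
  by (cases "i < r") (auto intro!: poly_fun_add poly_fun_mult poly_fun_sum poly_fun_const poly_fun_id)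

lemma chart_zero: "chart n r (\<lambda>s. 0) = rank_form n n r"
  by (rule eq_matI) (auto simp: index_chart)

text \<open>Recovers a parameter by a linear form in the matrix entries. The constant 1 on the
  diagonal is homogenized by the corner entry, which equals 1; in the lower rows the quadratic terms
  drop out when all upper parameters are 0.\<close>

lemma chart_linear_coordinate:
  assumes s: "s \<in> border n r" and u0: "u (0, 0) = 0" and r: "1 \<le> r"
    and top: "\<And>k l. r \<le> fst s \<Longrightarrow> k < r \<Longrightarrow> u (k, l) = 0"
  shows "chart n r u $$ s - of_bool (fst s = snd s \<and> fst s < r) * chart n r u $$ (0, 0) = u s"
proof -
  obtain i j where ij: "s = (i, j)" "i < n" "j < n" "i < r \<or> j < r"
    using s by (auto simp: border_def entries_def)
  then have "0 < n" by auto
  then have c0: "chart n r u $$ (0, 0) = 1" using r u0 by (simp add: index_chart)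
  show ?thesis
  proof (cases "i < r")
    case True
    then show ?thesis using ij c0 by (simp add: index_chart)
  next
    case False
    then have "j < r" using ij by simp
    have "(\<Sum>k<r. u (i, k) * (of_bool (k = j) + u (k, j))) = (\<Sum>k<r. if k = j then u (i, j) else 0)"
      by (rule sum.cong) (use top False ij in auto)
    then show ?thesis using ij c0 False \<open>j < r\<close> by (simp add: index_chart)
  qed
qed

text \<open>Every cell contains the point with parameters 0, which is
  \<open>P * rank_form n n r * Q\<close>. The factors \<open>P\<close> and \<open>Q\<close> move the
  chart so that chains of cells pass through a prescribed point of rank \<open>r\<close>.\<close>

definition chart_cell :: "nat \<Rightarrow> nat \<Rightarrow> complex mat \<Rightarrow> complex mat \<Rightarrow> (nat \<times> nat) set \<Rightarrow>
    (nat \<times> nat \<Rightarrow> complex) set" where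
  "chart_cell n r P Q S = {coords n (P * chart n r u * Q) | u. \<forall>s. s \<notin> S \<longrightarrow> u s = 0}"

lemma chart_cell_mono: "S \<subseteq> S' \<Longrightarrow> chart_cell n r P Q S \<subseteq> chart_cell n r P Q S'"
  unfolding chart_cell_def by blast

lemma chart_cell_facts:
  assumes P: "inverse_pair n P P'" and Q: "inverse_pair n Q Q'" and r: "1 \<le> r" "r \<le> n"
    and S: "S \<subseteq> chart_params n r" and x: "x \<in> chart_cell n r P Q S"
  shows "x \<in> coord_vectors (entries n)" "x \<noteq> (\<lambda>i. 0)" "proj_point x \<in> det_variety n r"
proof -
  note Pc = inverse_pairD[OF P] and Qc = inverse_pairD[OF Q]
  obtain u where u: "x = coords n (P * chart n r u * Q)" "\<And>s. s \<notin> S \<Longrightarrow> u s = 0"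
    using x by (auto simp: chart_cell_def)
  have c: "P * chart n r u * Q \<in> carrier_mat n n" by (rule triple_carrier[OF Pc(1) _ Qc(1)]) simp
  show "x \<in> coord_vectors (entries n)" unfolding u(1) by (rule coords_mem)
  have nz: "P * chart n r u * Q \<noteq> 0\<^sub>m n n"
  proof
    assume z: "P * chart n r u * Q = 0\<^sub>m n n"
    have "chart n r u = P' * 0\<^sub>m n n * Q'"
      using inverse_pair_conjugate[OF P Q chart_carrier, of r u] unfolding z by simp
    then have "chart n r u = 0\<^sub>m n n" using Pc Qc by simp
    moreover have "u (0, 0) = 0" using S by (intro u(2)) (auto simp: chart_params_def)
    then have "chart n r u $$ (0, 0) = 1" using r by (simp add: index_chart)
    ultimately show False using r by simp
  qed
  then show "x \<noteq> (\<lambda>i. 0)" unfolding u(1) using coords_eq_zero_iff[OF c] by blast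
  show "proj_point x \<in> det_variety n r"
    unfolding u(1) det_variety_iff[OF c nz]
    by (rule mat_rank_mult_right_le[OF mult_carrier_mat[OF Pc(1) chart_carrier] Qc(1)
          mat_rank_mult_left_le[OF chart_carrier Pc(1) mat_rank_chart]])
qed

text \<open>A segment between two parameter vectors supported in \<open>S\<close> maps to a
  polynomial curve inside the cell.\<close>

lemma chart_cell_irreducible:
  assumes P: "inverse_pair n P P'" and Q: "inverse_pair n Q Q'" and r: "1 \<le> r" "r \<le> n"
    and S: "S \<subseteq> chart_params n r"
  shows "zariski_irreducible (entries n) (zariski_closure (entries n) (proj_point ` chart_cell n r P Q S))"
proof (rule zariski_irreducible_closure_if_poly_connected[OF finite_entries])
  note Pc = inverse_pairD[OF P] and Qc = inverse_pairD[OF Q]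
  have "coords n (P * chart n r (\<lambda>_. 0) * Q) \<in> chart_cell n r P Q S"
    unfolding chart_cell_def by (intro CollectI exI[of _ "\<lambda>_. 0"] conjI refl) simp
  then show "chart_cell n r P Q S \<noteq> {}" by blast
  show "chart_cell n r P Q S \<subseteq> coord_vectors (entries n) - {\<lambda>i. 0}"
    using chart_cell_facts[OF P Q r S] by blast
  fix x y assume "x \<in> chart_cell n r P Q S" "y \<in> chart_cell n r P Q S"
  then obtain u v where u: "x = coords n (P * chart n r u * Q)" "\<And>s. s \<notin> S \<Longrightarrow> u s = 0"
    and v: "y = coords n (P * chart n r v * Q)" "\<And>s. s \<notin> S \<Longrightarrow> v s = 0"
    by (auto simp: chart_cell_def)
  define w where "w t = (\<lambda>s. u s + t * (v s - u s))" for t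
  let ?\<gamma> = "\<lambda>t. coords n (P * chart n r (w t) * Q)"
  have "poly_fun (\<lambda>t. ?\<gamma> t s)" for s
  proof (cases "s \<in> entries n")
    case True
    then obtain i j where ij: "s = (i, j)" "i < n" "j < n" by (auto simp: entries_def)
    have "poly_fun (\<lambda>t. (P * chart n r (w t) * Q) $$ (i, j))"
      by (intro poly_fun_mult_mat[of _ n n _ n] poly_fun_const mult_carrier_mat[OF Pc(1)] chart_carrier
          poly_fun_chart_line Pc(1) Qc(1))
        (use ij in \<open>auto simp: w_def intro: poly_fun_chart_line\<close>)
    with ij show ?thesis by (simp add: coords_def del: index_mult_mat(1))
  next
    case False
    then have "(\<lambda>t. ?\<gamma> t s) = (\<lambda>t. 0)" by (auto simp: coords_def entries_def split: prod.splits)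
    then show ?thesis by auto
  qed
  then have "poly_curve ?\<gamma>" by (simp add: poly_curve_iff)
  moreover have "?\<gamma> 0 = x" "?\<gamma> 1 = y" by (simp_all add: u v w_def)
  moreover have "?\<gamma> t \<in> chart_cell n r P Q S" for t
  proof -
    have "\<forall>s. s \<notin> S \<longrightarrow> w t s = 0" using u(2) v(2) by (simp add: w_def)
    then show ?thesis unfolding chart_cell_def by (intro CollectI exI[of _ "w t"] conjI refl)
  qed
  ultimately show "\<exists>\<gamma>. poly_curve \<gamma> \<and> \<gamma> 0 = x \<and> \<gamma> 1 = y \<and> range \<gamma> \<subseteq> chart_cell n r P Q S"
    by (intro exI[of _ ?\<gamma>]) blast
qed

text \<open>The linear form \<open>lf\<close> has the value \<open>u s\<close> on the larger cell.
  It vanishes on the smaller one and is 1 at the parameter vector \<open>e\<close>. The hypothesis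
  \<open>order\<close> keeps upper parameters away while a lower one is added, which is what makes
  that value linear.\<close>

lemma chart_cell_closure_strict:
  assumes P: "inverse_pair n P P'" and Q: "inverse_pair n Q Q'" and r: "1 \<le> r" "r \<le> n"
    and S: "insert s S \<subseteq> chart_params n r" and s: "s \<notin> S"
    and order: "\<And>k l. r \<le> fst s \<Longrightarrow> k < r \<Longrightarrow> (k, l) \<notin> S"
  shows "zariski_closure (entries n) (proj_point ` chart_cell n r P Q S) \<subset>
    zariski_closure (entries n) (proj_point ` chart_cell n r P Q (insert s S))"
proof -
  note Pc = inverse_pairD[OF P] and Qc = inverse_pairD[OF Q]
  let ?Z = "\<lambda>S. zariski_closure (entries n) (proj_point ` chart_cell n r P Q S)"
  let ?\<delta> = "of_bool (fst s = snd s \<and> fst s < r) :: complex"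
  define lf where "lf a = (P' * mat n n a * Q') $$ s + (- ?\<delta>) * (P' * mat n n a * Q') $$ (0, 0)" for a
  have sb: "s \<in> border n r" and sE: "fst s < n" "snd s < n"
    using S by (auto simp: chart_params_def border_def entries_def)
  have n: "0 < n" using r by simp
  have lf: "lf \<in> hforms (entries n) 1"
    unfolding lf_def using hforms_conjugate_entry[OF Pc(2) Qc(2) sE] hforms_conjugate_entry[OF Pc(2) Qc(2) n n]
    by (intro poly_span_add poly_span_scale) auto
  have value_: "lf (coords n (P * chart n r u * Q)) = u s"
    if u: "\<And>t. t \<notin> insert s S \<Longrightarrow> u t = 0" for u
  proof -
    have "P' * mat n n (coords n (P * chart n r u * Q)) * Q' = chart n r u"
      unfolding mat_coords[OF triple_carrier[OF Pc(1) chart_carrier Qc(1)]]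
      by (rule inverse_pair_conjugate[OF P Q chart_carrier])
    moreover have "u (0, 0) = 0" using S by (intro u) (auto simp: chart_params_def)
    moreover have "u (k, l) = 0" if "r \<le> fst s" "k < r" for k l
      using order[OF that] that by (intro u) auto
    ultimately show ?thesis
      using chart_linear_coordinate[OF sb, of u] r(1) by (simp add: lf_def)
  qed
  have sub: "proj_point ` chart_cell n r P Q S' \<subseteq> proj_space (entries n)"
    if "S' \<subseteq> chart_params n r" for S'
    using chart_cell_facts(3)[OF P Q r that] by (auto simp: det_variety_def)
  have "lf x = 0" if "x \<in> chart_cell n r P Q S" for x
  proof -
    obtain u where u: "x = coords n (P * chart n r u * Q)" "\<And>t. t \<notin> S \<Longrightarrow> u t = 0"
      using \<open>x \<in> chart_cell n r P Q S\<close> by (auto simp: chart_cell_def)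
    then show ?thesis using value_[of u] s by simp
  qed
  then have van: "lf \<in> vanishing_forms (entries n) (proj_point ` chart_cell n r P Q S)"
    by (intro vanishing_formsI[OF finite_entries lf]) (use hforms_vanish_proj_point[OF lf] in blast)
  define e where "e = (\<lambda>t. of_bool (t = s) :: complex)"
  let ?x = "coords n (P * chart n r e * Q)"
  have xin: "?x \<in> chart_cell n r P Q (insert s S)"
    unfolding chart_cell_def by (intro CollectI exI[of _ e] conjI refl) (simp add: e_def)
  have "lf ?x \<noteq> 0" using value_[of e] by (simp add: e_def)
  then have "proj_point ?x \<notin> ?Z S"
    using van self_mem_proj_point[of ?x] sub[of S] S
    by (auto simp: zariski_closure_eq zero_locus_def)
  moreover have "proj_point ?x \<in> ?Z (insert s S)"
    using xin subset_zariski_closure[of "proj_point ` chart_cell n r P Q (insert s S)" "entries n"] by blast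
  moreover have "?Z S \<subseteq> ?Z (insert s S)"
  proof (rule zariski_closure_minimal)
    have "proj_point ` chart_cell n r P Q S \<subseteq> proj_point ` chart_cell n r P Q (insert s S)"
      by (intro image_mono chart_cell_mono) auto
    then show "proj_point ` chart_cell n r P Q S \<subseteq> ?Z (insert s S)"
      using subset_zariski_closure[of _ "entries n"] by (rule subset_trans)
    show "zariski_closed (entries n) (?Z (insert s S))" by (rule zariski_closed_closure[OF sub[OF S]])
  qed
  ultimately show ?thesis by blast
qed

text \<open>The chain of maximal length starts with the closure of the point itself, the cell
  without parameters, and frees one parameter at a time until all are free.\<close>

lemma local_dim_det_variety:
  assumes P: "inverse_pair n P P'" and Q: "inverse_pair n Q Q'" and r: "1 \<le> r" "r \<le> n"
  shows "local_dim (entries n) (det_variety n r) (proj_point (coords n (P * rank_form n n r * Q))) =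
    enat (card (chart_params n r))"
proof -
  let ?p = "proj_point (coords n (P * rank_form n n r * Q))"
  let ?M = "card (chart_params n r)"
  define bot where "bot = {s \<in> chart_params n r. r \<le> fst s}"
  define top where "top = {s \<in> chart_params n r. fst s < r}"
  have fin: "finite bot" "finite top" unfolding bot_def top_def using finite_chart_params by auto
  obtain bs where bs: "set bs = bot" "distinct bs" using finite_distinct_list[OF fin(1)] by blast
  obtain ts where ts: "set ts = top" "distinct ts" using finite_distinct_list[OF fin(2)] by blast
  \<comment> \<open>Parameters in rows from \<open>r\<close> on come first, so that all upper
    parameters are still 0 while these are added; afterwards the upper entries are linear in their
    own parameters in any case.\<close>
  define xs where "xs = bs @ ts"
  have xs: "set xs = chart_params n r" "distinct xs"
    using bs ts by (auto simp: xs_def bot_def top_def)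
  have len: "length xs = ?M" using distinct_card[OF xs(2)] xs(1) by simp
  define C where "C j = zariski_closure (entries n) (proj_point ` chart_cell n r P Q (set (take j xs)))" for j
  have sub: "set (take j xs) \<subseteq> chart_params n r" for j using xs(1) set_take_subset[of j xs] by auto
  have irr: "zariski_irreducible (entries n) (C j)" for j
    unfolding C_def by (rule chart_cell_irreducible[OF P Q r sub])
  have base: "?p \<in> C j" for j
  proof -
    have "coords n (P * rank_form n n r * Q) \<in> chart_cell n r P Q (set (take j xs))"
      unfolding chart_cell_def chart_zero[symmetric] by (intro CollectI exI[of _ "\<lambda>s. 0"] conjI refl) simp
    then show ?thesis unfolding C_def using subset_zariski_closure by blast
  qed
  have inX: "C j \<subseteq> det_variety n r" for j
    unfolding C_def by (rule zariski_closure_minimal[OF _ zariski_closed_det_variety])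
      (use chart_cell_facts(3)[OF P Q r sub] in blast)
  have strict: "C j \<subset> C (Suc j)" if j: "j < ?M" for j
  proof -
    have take: "set (take (Suc j) xs) = insert (xs ! j) (set (take j xs))"
      using j len by (simp add: take_Suc_conv_app_nth)
    have new: "xs ! j \<notin> set (take j xs)"
      using xs(2) j len by (metis distinct_take take_Suc_conv_app_nth distinct_append
          list.set_intros(1) disjoint_iff)
    have order: "(k, l) \<notin> set (take j xs)" if "r \<le> fst (xs ! j)" "k < r" for k l
    proof -
      have "j < length bs"
      proof (rule ccontr)
        assume "\<not> j < length bs"
        then have "xs ! j \<in> set ts" using j len by (simp add: xs_def nth_append)
        with that ts show False by (auto simp: top_def)
      qed
      then have "set (take j xs) \<subseteq> bot" using set_take_subset[of j bs] bs by (auto simp: xs_def)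
      with that show ?thesis by (auto simp: bot_def)
    qed
    show ?thesis unfolding C_def take
      by (rule chart_cell_closure_strict[OF P Q r _ new order]) (use sub[of "Suc j"] take in auto)
  qed
  let ?K = "{enat k | k. \<exists>C.
     (\<forall>j\<le>k. zariski_irreducible (entries n) (C j) \<and> ?p \<in> C j \<and> C j \<subseteq> det_variety n r) \<and>
     (\<forall>j<k. C j \<subset> C (Suc j))}"
  have "enat ?M \<in> ?K" using irr base inX strict by (intro CollectI exI[of _ ?M] conjI exI[of _ C]) auto
  moreover have "e \<le> enat ?M" if e: "e \<in> ?K" for e
  proof -
    obtain k D where k: "e = enat k"
      "\<And>j. j \<le> k \<Longrightarrow> zariski_irreducible (entries n) (D j)" "\<And>j. j \<le> k \<Longrightarrow> D j \<subseteq> det_variety n r"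
      "\<And>j. j < k \<Longrightarrow> D j \<subset> D (Suc j)" using e by auto
    have "k \<le> ?M" by (rule chain_length_det_variety_le[where C = D, OF r k(2,4) k(3)]) auto
    then show ?thesis using k(1) by simp
  qed
  ultimately have "Sup ?K = enat ?M" by (intro antisym Sup_least Sup_upper) auto
  then show ?thesis by (simp add: local_dim_def)
qed

section \<open>Smooth points\<close>

text \<open>The last row of the diagonal matrix is zero, so the last row of the sum is
  \<open>t\<close> times the last row of \<open>Z\<close>. Factoring out \<open>t\<close> leaves
  \<open>det (K t)\<close>, and the derivative at 0 is \<open>det (K 0)\<close>. The matrix
  \<open>K 0\<close> is the identity except for its last row, hence lower triangular.\<close>

lemma diagonal_det_line_derivative:
  fixes Z :: "complex mat"
  assumes Z: "Z \<in> carrier_mat (Suc r) (Suc r)"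
  shows "((\<lambda>t. det (rank_form (Suc r) (Suc r) r + t \<cdot>\<^sub>m Z)) has_field_derivative Z $$ (r, r)) (at 0)"
proof -
  define K where "K t = mat (Suc r) (Suc r) (\<lambda>(i, j). if i = r then Z $$ (i, j)
    else rank_form (Suc r) (Suc r) r $$ (i, j) + t * Z $$ (i, j))" for t
  have Kc: "K t \<in> carrier_mat (Suc r) (Suc r)" for t by (simp add: K_def)
  have row: "rank_form (Suc r) (Suc r) r + t \<cdot>\<^sub>m Z = multrow r t (K t)" for t
    using Z by (intro eq_matI) (auto simp: K_def)
  have "poly_fun (\<lambda>t. det (K t))"
  proof (rule poly_fun_det[OF Kc])
    show "poly_fun (\<lambda>t. K t $$ (i, j))" if "i < Suc r" "j < Suc r" for i j
      using that by (cases "i = r")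
        (auto simp: K_def intro!: poly_fun_add poly_fun_mult poly_fun_const poly_fun_id)
  qed
  then obtain q where q: "\<And>t. det (K t) = poly q t" by (auto simp: poly_fun_def)
  have "det (K 0) = prod_list (diag_mat (K 0))"
    by (rule det_lower_triangular[OF _ Kc]) (auto simp: K_def)
  also have "diag_mat (K 0) = map (\<lambda>i. if i = r then Z $$ (r, r) else 1) [0..<Suc r]"
    by (auto simp: diag_mat_def K_def)
  also have "prod_list \<dots> = Z $$ (r, r)"
  proof -
    have "map (\<lambda>i. if i = r then Z $$ (r, r) else 1) [0..<r] = map (\<lambda>i. 1) [0..<r]" by auto
    then have "prod_list (map (\<lambda>i. if i = r then Z $$ (r, r) else 1) [0..<r]) = 1"
      by (simp add: prod_list_replicate map_replicate_const)
    then show ?thesis by simp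
  qed
  finally have q0: "poly q 0 = Z $$ (r, r)" by (simp add: q)
  have "det (rank_form (Suc r) (Suc r) r + t \<cdot>\<^sub>m Z) = poly (pCons 0 q) t" for t
    unfolding row using det_multrow[OF _ Kc, of r t] by (simp add: q)
  moreover have "poly (pderiv (pCons 0 q)) 0 = Z $$ (r, r)" by (simp add: pderiv_pCons q0)
  ultimately show ?thesis using poly_DERIV[of "pCons 0 q" 0] by simp
qed

lemma index_selection_mult:
  fixes X :: "complex mat"
  assumes X: "X \<in> carrier_mat n m" and "\<And>a. a < k \<Longrightarrow> \<sigma> a < n" and "a < k" "j < m"
  shows "(mat k n (\<lambda>(a, l). of_bool (l = \<sigma> a)) * X) $$ (a, j) = X $$ (\<sigma> a, j)"
proof -
  have "(mat k n (\<lambda>(a, l). of_bool (l = \<sigma> a)) * X) $$ (a, j) =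
    (\<Sum>l<n. mat k n (\<lambda>(a, l). of_bool (l = \<sigma> a)) $$ (a, l) * X $$ (l, j))"
    by (rule index_mult_mat_sum[OF _ X]) (use assms in auto)
  also have "\<dots> = (\<Sum>l<n. if l = \<sigma> a then X $$ (\<sigma> a, j) else 0)"
    by (rule sum.cong) (use assms in auto)
  finally show ?thesis using assms by simp
qed

lemma index_mult_selection:
  fixes X :: "complex mat"
  assumes X: "X \<in> carrier_mat m n" and "\<And>a. a < k \<Longrightarrow> \<sigma> a < n" and "a < k" "i < m"
  shows "(X * mat n k (\<lambda>(l, a). of_bool (l = \<sigma> a))) $$ (i, a) = X $$ (i, \<sigma> a)"
proof -
  have "(X * mat n k (\<lambda>(l, a). of_bool (l = \<sigma> a))) $$ (i, a) =
    (\<Sum>l<n. X $$ (i, l) * mat n k (\<lambda>(l, a). of_bool (l = \<sigma> a)) $$ (l, a))"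
    by (rule index_mult_mat_sum[OF X]) (use assms in auto)
  also have "\<dots> = (\<Sum>l<n. if l = \<sigma> a then X $$ (i, \<sigma> a) else 0)"
    by (rule sum.cong) (use assms in auto)
  finally show ?thesis using assms by simp
qed

text \<open>After normalization, the minor on the first \<open>r\<close> rows and columns bordered
  by row \<open>i\<close> and column \<open>j\<close> vanishes on the variety. Its derivative at the
  normal form in the direction \<open>Y\<close> is just the entry at \<open>(i, j)\<close>.\<close>

lemma tangent_space_corner_zero:
  assumes P: "inverse_pair n P P'" and Q: "inverse_pair n Q Q'" and r: "1 \<le> r" "r \<le> n"
    and Y: "Y \<in> carrier_mat n n" and ij: "r \<le> i" "i < n" "r \<le> j" "j < n"
    and tang: "\<And>F. F \<in> vanishing_forms (entries n) (det_variety n r) \<Longrightarrow>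
      (\<Sum>s\<in>entries n. partial_deriv s F (coords n (P * rank_form n n r * Q)) * coords n Y s) = 0"
  shows "(P' * Y * Q') $$ (i, j) = 0"
proof -
  note Pc = inverse_pairD[OF P] and Qc = inverse_pairD[OF Q]
  let ?A = "P * rank_form n n r * Q"
  have A: "?A \<in> carrier_mat n n" by (rule triple_carrier[OF Pc(1) rank_form_carrier(1) Qc(1)])
  define \<sigma> where "\<sigma> = (\<lambda>a. if a < r then a else i)"
  define \<tau> where "\<tau> = (\<lambda>a. if a < r then a else j)"
  define S0 where "S0 = mat (Suc r) n (\<lambda>(a, l). of_bool (l = \<sigma> a) :: complex)"
  define T0 where "T0 = mat n (Suc r) (\<lambda>(l, a). of_bool (l = \<tau> a) :: complex)"
  have S0: "S0 \<in> carrier_mat (Suc r) n" and T0: "T0 \<in> carrier_mat n (Suc r)"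
    by (simp_all add: S0_def T0_def)
  have \<sigma>: "\<sigma> a < n" and \<tau>: "\<tau> a < n" if "a < Suc r" for a using that ij by (auto simp: \<sigma>_def \<tau>_def)
  have S: "S0 * P' \<in> carrier_mat (Suc r) n" and T: "Q' * T0 \<in> carrier_mat n (Suc r)"
    by (rule mult_carrier_mat[OF S0 Pc(2)]) (rule mult_carrier_mat[OF Qc(2) T0])
  have minor: "(S0 * P') * X * (Q' * T0) =
      mat (Suc r) (Suc r) (\<lambda>(a, b). (P' * X * Q') $$ (\<sigma> a, \<tau> b))"
    if X: "X \<in> carrier_mat n n" for X
  proof -
    have PX: "P' * X \<in> carrier_mat n n" and PXQ: "P' * X * Q' \<in> carrier_mat n n"
      using mult_carrier_mat[OF Pc(2) X] triple_carrier[OF Pc(2) X Qc(2)] by auto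
    have "(S0 * P') * X * (Q' * T0) = S0 * (P' * X) * (Q' * T0)"
      using assoc_mult_mat[OF S0 Pc(2) X] by simp
    also have "\<dots> = S0 * (P' * X) * Q' * T0"
      by (rule assoc_mult_mat[OF mult_carrier_mat[OF S0 PX] Qc(2) T0, symmetric])
    also have "S0 * (P' * X) * Q' = S0 * (P' * X * Q')"
      by (rule assoc_mult_mat[OF S0 PX Qc(2)])
    finally have eq: "(S0 * P') * X * (Q' * T0) = S0 * (P' * X * Q') * T0" .
    show ?thesis unfolding eq
    proof (rule eq_matI)
      fix a b
      assume "a < dim_row (mat (Suc r) (Suc r) (\<lambda>(a, b). (P' * X * Q') $$ (\<sigma> a, \<tau> b)))"
        "b < dim_col (mat (Suc r) (Suc r) (\<lambda>(a, b). (P' * X * Q') $$ (\<sigma> a, \<tau> b)))"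
      then have ab: "a < Suc r" "b < Suc r" by auto
      have "(S0 * (P' * X * Q') * T0) $$ (a, b) = (S0 * (P' * X * Q')) $$ (a, \<tau> b)"
        unfolding T0_def by (rule index_mult_selection[OF mult_carrier_mat[OF S0 PXQ] \<tau> ab(2,1)])
      also have "\<dots> = (P' * X * Q') $$ (\<sigma> a, \<tau> b)"
        unfolding S0_def by (rule index_selection_mult[OF PXQ \<sigma> ab(1) \<tau>[OF ab(2)]])
      finally show "(S0 * (P' * X * Q') * T0) $$ (a, b) =
          mat (Suc r) (Suc r) (\<lambda>(a, b). (P' * X * Q') $$ (\<sigma> a, \<tau> b)) $$ (a, b)"
        using ab by simp
    qed (use S0 T0 in auto)
  qed
  define F where "F = (\<lambda>a. det ((S0 * P') * mat n n a * (Q' * T0)))"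
  have F: "F \<in> hforms (entries n) (Suc r)"
    unfolding F_def
  proof (rule hforms_det)
    show "S0 * P' * mat n n a * (Q' * T0) \<in> carrier_mat (Suc r) (Suc r)" for a
      by (rule mult_carrier_mat[OF mult_carrier_mat[OF S mat_carrier] T])
    fix a b assume ab: "a < Suc r" "b < Suc r"
    show "(\<lambda>x. (S0 * P' * mat n n x * (Q' * T0)) $$ (a, b)) \<in> hforms (entries n) 1"
    proof (rule hforms_linear_matrix[OF S T _ _ ab])
      show "(\<lambda>a. mat n n a $$ (k, l)) \<in> hforms (entries n) 1" if "k < n" "l < n" for k l
        using hforms_entry[OF that] that by simp
    qed simp
  qed
  have "F \<in> vanishing_forms (entries n) (det_variety n r)"
  proof (rule vanishing_formsI[OF finite_entries F])
    fix x assume "x \<in> \<Union>(det_variety n r)"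
    then obtain p where p: "p \<in> det_variety n r" "x \<in> p" by blast
    obtain U W where UW: "U \<in> carrier_mat n r" "W \<in> carrier_mat r n" "mat n n x = U * W"
      by (rule mat_rank_leE[OF mat_carrier det_variety_mem(1)[OF p]])
    have "S0 * P' * (U * W) * (Q' * T0) = (S0 * P' * U) * (W * (Q' * T0))"
      using assoc_mult_mat[OF S UW(1,2)] assoc_mult_mat[OF mult_carrier_mat[OF S UW(1)] UW(2) T] by simp
    then show "F x = 0" unfolding F_def UW(3)
      using det_mult_lt[OF mult_carrier_mat[OF S UW(1)] mult_carrier_mat[OF UW(2) T]] by simp
  qed
  from tang[OF this] have der: "((\<lambda>t. F (\<lambda>s. coords n ?A s + t * coords n Y s)) has_field_derivative 0) (at 0)"
    using hforms_directional_derivative[OF finite_entries F, of "coords n ?A" "coords n Y"] by simp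
  define Z where "Z = mat (Suc r) (Suc r) (\<lambda>(a, b). (P' * Y * Q') $$ (\<sigma> a, \<tau> b))"
  have Z: "Z \<in> carrier_mat (Suc r) (Suc r)" by (simp add: Z_def)
  have line: "F (\<lambda>s. coords n ?A s + t * coords n Y s) = det (rank_form (Suc r) (Suc r) r + t \<cdot>\<^sub>m Z)" for t
  proof -
    have AY: "?A + t \<cdot>\<^sub>m Y \<in> carrier_mat n n" using A Y by simp
    have PA: "P' * ?A * Q' = rank_form n n r" by (rule inverse_pair_conjugate[OF P Q rank_form_carrier(1)])
    have "P' * (?A + t \<cdot>\<^sub>m Y) = P' * ?A + t \<cdot>\<^sub>m (P' * Y)"
      using mult_add_distrib_mat[OF Pc(2) A, of "t \<cdot>\<^sub>m Y"] mult_smult_distrib[OF Pc(2) Y, of t] Y by simp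
    then have "P' * (?A + t \<cdot>\<^sub>m Y) * Q' = P' * ?A * Q' + t \<cdot>\<^sub>m (P' * Y * Q')"
      using add_mult_distrib_mat[OF mult_carrier_mat[OF Pc(2) A] smult_carrier_mat[OF mult_carrier_mat[OF Pc(2) Y]] Qc(2), of t]
        mult_smult_assoc_mat[OF mult_carrier_mat[OF Pc(2) Y] Qc(2), of t] by (simp del: assoc_mult_mat)
    then have eq: "P' * (?A + t \<cdot>\<^sub>m Y) * Q' = rank_form n n r + t \<cdot>\<^sub>m (P' * Y * Q')" unfolding PA .
    have PYQ: "P' * Y * Q' \<in> carrier_mat n n" by (rule triple_carrier[OF Pc(2) Y Qc(2)])
    have idx: "(rank_form n n r + t \<cdot>\<^sub>m W) $$ (a, b) = rank_form n n r $$ (a, b) + t * W $$ (a, b)"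
      if "W \<in> carrier_mat n n" "a < n" "b < n" for W a b using that by simp
    have "S0 * P' * (?A + t \<cdot>\<^sub>m Y) * (Q' * T0) = rank_form (Suc r) (Suc r) r + t \<cdot>\<^sub>m Z"
    proof (rule eq_matI)
      fix a b
      assume "a < dim_row (rank_form (Suc r) (Suc r) r + t \<cdot>\<^sub>m Z)"
        "b < dim_col (rank_form (Suc r) (Suc r) r + t \<cdot>\<^sub>m Z)"
      then have ab: "a < Suc r" "b < Suc r" using Z by auto
      have "rank_form n n r $$ (\<sigma> a, \<tau> b) = (rank_form (Suc r) (Suc r) r $$ (a, b) :: complex)"
        using ab ij r by (auto simp: \<sigma>_def \<tau>_def)
      then show "(S0 * P' * (?A + t \<cdot>\<^sub>m Y) * (Q' * T0)) $$ (a, b) =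
          (rank_form (Suc r) (Suc r) r + t \<cdot>\<^sub>m Z) $$ (a, b)"
        unfolding minor[OF AY] eq using ab idx[OF PYQ \<sigma>[OF ab(1)] \<tau>[OF ab(2)]]
        by (simp add: Z_def del: index_mult_mat(1) assoc_mult_mat)
    qed (use minor[OF AY] Z in auto)
    then show ?thesis using coords_add_smult[OF A Y, of t] mat_coords[OF AY] by (simp add: F_def)
  qed
  have "Z $$ (r, r) = 0"
    using DERIV_unique[OF der[unfolded line] diagonal_det_line_derivative[OF Z]] by simp
  then show ?thesis by (simp add: Z_def \<sigma>_def \<tau>_def)
qed

lemma coords_add:
  assumes "X \<in> carrier_mat n n" "Y \<in> carrier_mat n n"
  shows "coords n (X + Y) s = coords n X s + coords n Y s"
  using assms by (cases s) (auto simp: coords_def)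

text \<open>A matrix with zero lower right corner splits into \<open>Zl\<close>, living in the first
  \<open>r\<close> columns, and \<open>Zr\<close>, living in the first \<open>r\<close> rows. Their
  transforms have the shapes X A and A X, so both are directions of lines of rank at most
  \<open>r\<close>. The factor \<open>c\<close> covers all representatives of the point.\<close>

lemma tangent_space_corner_zero_converse:
  assumes P: "inverse_pair n P P'" and Q: "inverse_pair n Q Q'" and r: "1 \<le> r" "r \<le> n"
    and Z: "Z \<in> carrier_mat n n" and corner: "\<And>i j. r \<le> i \<Longrightarrow> i < n \<Longrightarrow> r \<le> j \<Longrightarrow> j < n \<Longrightarrow> Z $$ (i, j) = 0"
    and F: "F \<in> vanishing_forms (entries n) (det_variety n r)"
  shows "(\<Sum>s\<in>entries n. partial_deriv s F (coords n (c \<cdot>\<^sub>m (P * rank_form n n r * Q))) *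
      coords n (P * Z * Q) s) = 0"
proof -
  note Pc = inverse_pairD[OF P] and Qc = inverse_pairD[OF Q]
  let ?E = "rank_form n n r :: complex mat" and ?A = "P * rank_form n n r * Q"
  let ?D = "\<lambda>Y. \<Sum>s\<in>entries n. partial_deriv s F (coords n (c \<cdot>\<^sub>m ?A)) * coords n Y s"
  have A: "?A \<in> carrier_mat n n" by (rule triple_carrier[OF Pc(1) rank_form_carrier(1) Qc(1)])
  have rkA: "mat_rank ?A \<le> r" using mat_rank_normal_form[OF P Q r(2)] by simp
  define Zl where "Zl = Z * ?E"
  define Zr where "Zr = mat n n (\<lambda>(i, j). if j < r then 0 else Z $$ (i, j))"
  have Zr: "Zr \<in> carrier_mat n n" by (simp add: Zr_def)
  have Zl: "Zl \<in> carrier_mat n n" unfolding Zl_def by (rule mult_carrier_mat[OF Z rank_form_carrier(1)])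
  have Zr_eq: "?E * Zr = Zr"
  proof (rule eq_matI)
    fix i j assume "i < dim_row Zr" "j < dim_col Zr"
    then have ij: "i < n" "j < n" using Zr by auto
    have "Zr $$ (i, j) = 0" if "\<not> i < r" using that ij corner by (simp add: Zr_def)
    then show "(?E * Zr) $$ (i, j) = Zr $$ (i, j)" using index_rank_form_mult[OF Zr ij r(2)] by simp
  qed (use Zr in auto)
  have Z_eq: "Z = Zl + Zr"
    unfolding Zl_def
    by (rule eq_matI)
      (use r(2) Z in \<open>auto simp: index_mult_rank_form[OF Z] Zr_def simp del: index_mult_mat(1)\<close>)
  have smult: "c \<cdot>\<^sub>m ?A + t \<cdot>\<^sub>m (X * ?A) = (c \<cdot>\<^sub>m 1\<^sub>m n + t \<cdot>\<^sub>m X) * ?A"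
    "c \<cdot>\<^sub>m ?A + t \<cdot>\<^sub>m (?A * X) = ?A * (c \<cdot>\<^sub>m 1\<^sub>m n + t \<cdot>\<^sub>m X)" if X: "X \<in> carrier_mat n n" for t X
  proof -
    show "c \<cdot>\<^sub>m ?A + t \<cdot>\<^sub>m (X * ?A) = (c \<cdot>\<^sub>m 1\<^sub>m n + t \<cdot>\<^sub>m X) * ?A"
      using add_mult_distrib_mat[OF _ _ A, of "c \<cdot>\<^sub>m 1\<^sub>m n" n "t \<cdot>\<^sub>m X"]
        mult_smult_assoc_mat[OF X A, of t] mult_smult_assoc_mat[OF one_carrier_mat A, of c]
        left_mult_one_mat[OF A] X A
      by (simp del: assoc_mult_mat)
    show "c \<cdot>\<^sub>m ?A + t \<cdot>\<^sub>m (?A * X) = ?A * (c \<cdot>\<^sub>m 1\<^sub>m n + t \<cdot>\<^sub>m X)"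
      using mult_add_distrib_mat[OF A, of "c \<cdot>\<^sub>m 1\<^sub>m n" n "t \<cdot>\<^sub>m X"]
        mult_smult_distrib[OF A X, of t] mult_smult_distrib[OF A one_carrier_mat, of c]
        right_mult_one_mat[OF A] X A
      by (simp del: assoc_mult_mat)
  qed
  have "1 \<le> n" using r by simp
  note dir = directional_derivative_det_variety[OF F r(1) this smult_carrier_mat[OF A]]
  have "P * Zl * Q = (P * Z * P') * ?A"
  proof -
    have "P * Z * P' * ?A = P * Z * (P' * ?A)"
      by (rule assoc_mult_mat[OF mult_carrier_mat[OF Pc(1) Z] Pc(2) A])
    also have "P' * ?A = ?E * Q"
      using inverse_pair_cancel[OF inverse_pair_sym[OF P] mult_carrier_mat[OF rank_form_carrier(1) Qc(1)]]
        assoc_mult_mat[OF Pc(1) rank_form_carrier(1) Qc(1)] by simp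
    also have "P * Z * (?E * Q) = P * Z * ?E * Q"
      by (rule assoc_mult_mat[OF mult_carrier_mat[OF Pc(1) Z] rank_form_carrier(1) Qc(1), symmetric])
    also have "P * Z * ?E = P * Zl" unfolding Zl_def by (rule assoc_mult_mat[OF Pc(1) Z rank_form_carrier(1)])
    finally show ?thesis by simp
  qed
  moreover have PZP: "P * Z * P' \<in> carrier_mat n n" by (rule triple_carrier[OF Pc(1) Z Pc(2)])
  have "?D (P * Z * P' * ?A) = 0"
  proof (rule dir)
    show "P * Z * P' * ?A \<in> carrier_mat n n" by (rule mult_carrier_mat[OF PZP A])
    show "mat_rank (c \<cdot>\<^sub>m ?A + t \<cdot>\<^sub>m (P * Z * P' * ?A)) \<le> r" for t
      unfolding smult(1)[OF PZP] by (rule mat_rank_mult_left_le[OF A _ rkA]) (use PZP in simp)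
  qed
  ultimately have Dl: "?D (P * Zl * Q) = 0" by (simp only:)
  have "P * Zr * Q = ?A * (Q' * Zr * Q)"
  proof -
    have ZrQ: "Zr * Q \<in> carrier_mat n n" by (rule mult_carrier_mat[OF Zr Qc(1)])
    have "?A * (Q' * Zr * Q) = P * ?E * (Q * (Q' * Zr * Q))"
      by (rule assoc_mult_mat[OF mult_carrier_mat[OF Pc(1) rank_form_carrier(1)] Qc(1)
            triple_carrier[OF Qc(2) Zr Qc(1)]])
    also have "Q * (Q' * Zr * Q) = Zr * Q"
      using inverse_pair_cancel[OF Q ZrQ] assoc_mult_mat[OF Qc(2) Zr Qc(1)] by simp
    also have "P * ?E * (Zr * Q) = P * (?E * Zr * Q)"
      using assoc_mult_mat[OF Pc(1) rank_form_carrier(1) ZrQ]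
        assoc_mult_mat[OF rank_form_carrier(1) Zr Qc(1)] by simp
    finally show ?thesis using assoc_mult_mat[OF Pc(1) Zr Qc(1)] by (simp add: Zr_eq)
  qed
  moreover have QZQ: "Q' * Zr * Q \<in> carrier_mat n n" by (rule triple_carrier[OF Qc(2) Zr Qc(1)])
  have "?D (?A * (Q' * Zr * Q)) = 0"
  proof (rule dir)
    show "?A * (Q' * Zr * Q) \<in> carrier_mat n n" by (rule mult_carrier_mat[OF A QZQ])
    show "mat_rank (c \<cdot>\<^sub>m ?A + t \<cdot>\<^sub>m (?A * (Q' * Zr * Q))) \<le> r" for t
      unfolding smult(2)[OF QZQ] by (rule mat_rank_mult_right_le[OF A _ rkA]) (use QZQ in simp)
  qed
  ultimately have Dr: "?D (P * Zr * Q) = 0" by (simp only:)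
  have "P * Z * Q = P * Zl * Q + P * Zr * Q"
    using mult_add_distrib_mat[OF Pc(1) Zl Zr]
      add_mult_distrib_mat[OF mult_carrier_mat[OF Pc(1) Zl] mult_carrier_mat[OF Pc(1) Zr] Qc(1)]
    by (simp add: Z_eq[symmetric] del: assoc_mult_mat)
  then have "coords n (P * Z * Q) s = coords n (P * Zl * Q) s + coords n (P * Zr * Q) s" for s
    using coords_add[OF triple_carrier[OF Pc(1) Zl Qc(1)] triple_carrier[OF Pc(1) Zr Qc(1)], of s]
    by (simp only:)
  then have "?D (P * Z * Q) = ?D (P * Zl * Q) + ?D (P * Zr * Q)"
    by (simp add: distrib_left sum.distrib)
  with Dl Dr show ?thesis by simp
qed

text \<open>Independence of the matrices P E_t Q: conjugating by the inverses gives back the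
  coefficient matrix.\<close>

lemma index_unit_expansion:
  fixes P P' Q Q' :: "complex mat"
  assumes P: "inverse_pair n P P'" and Q: "inverse_pair n Q Q'"
    and "S \<subseteq> entries n" and zero: "\<And>x. (\<Sum>t\<in>S. c t *
      (if x \<in> entries n then P $$ (fst x, fst t) * Q $$ (snd t, snd x) else 0)) = 0"
    and "s \<in> S"
  shows "c s = 0"
proof -
  note Pc = inverse_pairD[OF P] and Qc = inverse_pairD[OF Q]
  define z where "z t = (if t \<in> S then c t else 0)" for t
  have "coords n (P * mat n n z * Q) x = 0" for x
  proof -
    have "coords n (P * mat n n z * Q) x = (\<Sum>t\<in>S. z t *
        (if x \<in> entries n then P $$ (fst x, fst t) * Q $$ (snd t, snd x) else 0))"
      by (rule coords_triple_eq_sum[OF Pc(1) Qc(1) assms(3)]) (simp add: z_def)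
    also have "\<dots> = (\<Sum>t\<in>S. c t *
        (if x \<in> entries n then P $$ (fst x, fst t) * Q $$ (snd t, snd x) else 0))"
      by (rule sum.cong) (auto simp: z_def)
    finally show ?thesis using zero by simp
  qed
  then have "coords n (P * mat n n z * Q) = (\<lambda>i. 0)" by blast
  then have PzQ: "P * mat n n z * Q = 0\<^sub>m n n"
    using coords_eq_zero_iff[OF triple_carrier[OF Pc(1) mat_carrier Qc(1)]] by blast
  have "mat n n z = P' * 0\<^sub>m n n * Q'"
    using inverse_pair_conjugate[OF P Q mat_carrier, of z] unfolding PzQ by simp
  then have "mat n n z = 0\<^sub>m n n" using Pc Qc by simp
  moreover obtain i j where ij: "s = (i, j)" "i < n" "j < n"
    using assms(3,5) by (auto simp: entries_def)
  ultimately have "mat n n z $$ (i, j) = 0" by simp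
  with ij \<open>s \<in> S\<close> show ?thesis by (simp add: z_def)
qed

lemma normal_form_point:
  assumes P: "inverse_pair n P P'" and Q: "inverse_pair n Q Q'" and r: "1 \<le> r" "r \<le> n"
  shows "P * rank_form n n r * Q \<in> carrier_mat n n" "P * rank_form n n r * Q \<noteq> 0\<^sub>m n n"
    "proj_point (coords n (P * rank_form n n r * Q)) \<in> det_variety n r"
proof -
  let ?A = "P * rank_form n n r * Q"
  show A: "?A \<in> carrier_mat n n"
    using inverse_pairD[OF P] inverse_pairD[OF Q] by (intro triple_carrier) auto
  have rk: "mat_rank ?A = r" by (rule mat_rank_normal_form[OF P Q r(2)])
  show nz: "?A \<noteq> 0\<^sub>m n n"
  proof
    assume "?A = 0\<^sub>m n n"
    moreover have "vec_space.rank n (0\<^sub>m n n :: complex mat) = 0" by (rule vec_space.rank_0I)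
    ultimately show False using rk r by (simp add: mat_rank_def)
  qed
  show "proj_point (coords n ?A) \<in> det_variety n r" using det_variety_iff[OF A nz] rk by simp
qed

lemma tangent_space_mem_expansion:
  assumes P: "inverse_pair n P P'" and Q: "inverse_pair n Q Q'" and r: "1 \<le> r" "r \<le> n"
    and y: "y \<in> \<Union>(tangent_space (entries n) (det_variety n r)
      (proj_point (coords n (P * rank_form n n r * Q))))"
  obtains z where "y = (\<lambda>x. \<Sum>t\<in>border n r. z t *
      (if x \<in> entries n then P $$ (fst x, fst t) * Q $$ (snd t, snd x) else 0))"
proof -
  note Pc = inverse_pairD[OF P] and Qc = inverse_pairD[OF Q]
  let ?A = "P * rank_form n n r * Q" and ?Y = "mat n n y"
  obtain q where q: "q \<in> proj_space (entries n)" "y \<in> q" and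
    tang: "\<And>F x. F \<in> vanishing_forms (entries n) (det_variety n r) \<Longrightarrow> x \<in> proj_point (coords n ?A) \<Longrightarrow>
      (\<Sum>i\<in>entries n. partial_deriv i F x * y i) = 0"
    using y by (auto simp: tangent_space_def)
  have Y: "coords n ?Y = y" by (rule coords_mat[OF proj_space_mem(2)[OF q]])
  let ?Z = "P' * ?Y * Q'"
  have corner: "?Z $$ (i, j) = 0" if "r \<le> i" "i < n" "r \<le> j" "j < n" for i j
    by (rule tangent_space_corner_zero[OF P Q r mat_carrier that])
      (unfold Y, rule tang[OF _ self_mem_proj_point])
  define z where "z = (\<lambda>t. ?Z $$ t)"
  have Zc: "?Z \<in> carrier_mat n n" by (rule triple_carrier[OF Pc(2) mat_carrier Qc(2)])
  have "mat n n z = ?Z" unfolding z_def by (rule eq_matI) (use carrier_matD[OF Zc] in auto)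
  then have "P * mat n n z * Q = ?Y"
    using inverse_pair_conjugate[OF inverse_pair_sym[OF P] inverse_pair_sym[OF Q] mat_carrier, of y]
    by (simp only:)
  then have "y x = coords n (P * mat n n z * Q) x" for x by (simp only: Y)
  also have "coords n (P * mat n n z * Q) x = (\<Sum>t\<in>border n r. z t *
      (if x \<in> entries n then P $$ (fst x, fst t) * Q $$ (snd t, snd x) else 0))" for x
  proof (rule coords_triple_eq_sum[OF Pc(1) Qc(1)])
    show "border n r \<subseteq> entries n" by (auto simp: border_def)
    show "z t = 0" if "t \<in> entries n - border n r" for t
      using that corner by (cases t) (auto simp: border_def entries_def z_def)
  qed
  finally show thesis using that by blast
qed

text \<open>The basis consists of the matrices P E_t Q whose position \<open>t\<close> avoids the
  lower right corner. The union of the projective points lacks the zero vector and is no subspace;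
  it suffices that it lies between the basis and its span.\<close>

lemma dim_tangent_space_det_variety:
  assumes P: "inverse_pair n P P'" and Q: "inverse_pair n Q Q'" and r: "1 \<le> r" "r \<le> n"
  shows "fun_space.dim (\<Union>(tangent_space (entries n) (det_variety n r)
    (proj_point (coords n (P * rank_form n n r * Q))))) = card (border n r)"
proof -
  note Pc = inverse_pairD[OF P] and Qc = inverse_pairD[OF Q]
  let ?A = "P * rank_form n n r * Q"
  let ?V = "\<Union>(tangent_space (entries n) (det_variety n r) (proj_point (coords n ?A)))"
  define b where "b t = (\<lambda>x. if x \<in> entries n then P $$ (fst x, fst t) * Q $$ (snd t, snd x) else 0)"
    for t :: "nat \<times> nat"
  have sub: "border n r \<subseteq> entries n" by (auto simp: border_def)
  note A = normal_form_point[OF P Q r]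
  have ind: "inj_on b (border n r)" "fun_space.independent (b ` border n r)"
    using independent_family[OF finite_border, where g = b] index_unit_expansion[OF P Q sub]
    unfolding b_def by blast+
  show ?thesis
  proof (rule fun_space.dim_unique[where B = "b ` border n r"])
    show "fun_space.independent (b ` border n r)" by (rule ind(2))
    show "card (b ` border n r) = card (border n r)" by (rule card_image[OF ind(1)])
    show "?V \<subseteq> fun_space.span (b ` border n r)"
    proof
      fix y assume "y \<in> ?V"
      then obtain z where z: "y = (\<lambda>x. \<Sum>t\<in>border n r. z t * b t x)"
        unfolding b_def by (rule tangent_space_mem_expansion[OF P Q r])
      have "y = (\<Sum>t\<in>border n r. fun_scale (z t) (b t))"
        by (rule ext) (simp add: z sum_fun_eval fun_scale_def)
      then show "y \<in> fun_space.span (b ` border n r)"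
        by (simp add: fun_space.span_sum fun_space.span_scale fun_space.span_base)
    qed
    show "b ` border n r \<subseteq> ?V"
    proof (rule image_subsetI)
      fix s assume s: "s \<in> border n r"
      define Z where "Z = mat n n (\<lambda>t. of_bool (t = s) :: complex)"
      have Z: "Z \<in> carrier_mat n n" by (simp add: Z_def)
      have bs: "b s = coords n (P * Z * Q)"
      proof
        fix x
        have "coords n (P * Z * Q) x = (\<Sum>t\<in>{s}. of_bool (t = s) *
          (if x \<in> entries n then P $$ (fst x, fst t) * Q $$ (snd t, snd x) else 0))"
          unfolding Z_def by (rule coords_triple_eq_sum[OF Pc(1) Qc(1)]) (use s sub in auto)
        then show "b s x = coords n (P * Z * Q) x" by (simp add: b_def)
      qed
      have PZQ: "P * Z * Q \<in> carrier_mat n n" by (rule triple_carrier[OF Pc(1) Z Qc(1)])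
      have nz: "P * Z * Q \<noteq> 0\<^sub>m n n"
      proof
        assume "P * Z * Q = 0\<^sub>m n n"
        then have "b s = (\<lambda>i. 0)" unfolding bs using coords_eq_zero_iff[OF PZQ] by blast
        then have zero: "(\<Sum>t\<in>{s}. 1 * b t x) = 0" for x by simp
        have "(1 :: complex) = 0"
          by (rule index_unit_expansion[OF P Q _ zero[unfolded b_def], of s]) (use s sub in auto)
        then show False by simp
      qed
      have corner: "Z $$ (i, j) = 0" if "r \<le> i" "i < n" "r \<le> j" "j < n" for i j
        using that s by (auto simp: Z_def border_def)
      have "proj_point (b s) \<in> tangent_space (entries n) (det_variety n r) (proj_point (coords n ?A))"
        unfolding bs
      proof (rule tangent_space_det_varietyI[OF A(3) r(1) _ PZQ nz])
        show "1 \<le> n" using r by simp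
        fix F x assume F: "F \<in> vanishing_forms (entries n) (det_variety n r)" and "x \<in> proj_point (coords n ?A)"
        then obtain c where "x = coords n (c \<cdot>\<^sub>m ?A)" by (auto simp: proj_point_def coords_smult[OF A(1)])
        then show "(\<Sum>i\<in>entries n. partial_deriv i F x * coords n (P * Z * Q) i) = 0"
          using tangent_space_corner_zero_converse[OF P Q r Z corner F, of c] by simp
      qed
      then show "b s \<in> ?V" using self_mem_proj_point by blast
    qed
  qed
qed

lemma fun_space_dim_eq: "vector_space.dim (\<lambda>(c::complex) x i. c * x i) = fun_space.dim"
proof -
  have "(\<lambda>(c::complex) (x::'a \<Rightarrow> complex) i. c * x i) = fun_scale" by (simp add: fun_eq_iff fun_scale_def)
  then show ?thesis by simp
qed

text \<open>The position \<open>(0, 0)\<close>, counted by \<open>border\<close> but not by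
  \<open>chart_params\<close>, accounts for the summand 1 in the definition of smoothness.\<close>

lemma smooth_locus_det_variety:
  assumes P: "inverse_pair n P P'" and Q: "inverse_pair n Q Q'" and r: "1 \<le> r" "r \<le> n"
  shows "proj_point (coords n (P * rank_form n n r * Q)) \<in> smooth_locus (entries n) (det_variety n r)"
proof -
  have "1 \<le> n" using r by simp
  then show ?thesis
    using normal_form_point(3)[OF P Q r] r(1)
    by (simp add: smooth_locus_def fun_space_dim_eq dim_tangent_space_det_variety[OF P Q r]
        local_dim_det_variety[OF P Q r] card_border one_enat_def)
qed

lemma normal_form_mult_zero:
  assumes P: "inverse_pair n P P'" and Q: "Q \<in> carrier_mat n n" and X: "X \<in> carrier_mat n n"
    and zero: "P * rank_form n n r * Q * X = 0\<^sub>m n n" and "r \<le> n" "k < r" "j < n"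
  shows "(Q * X) $$ (k, j) = 0"
proof -
  note Pc = inverse_pairD[OF P]
  have QX: "Q * X \<in> carrier_mat n n" by (rule mult_carrier_mat[OF Q X])
  have "P * rank_form n n r * Q * X = P * (rank_form n n r * (Q * X))"
    using assoc_mult_mat[OF mult_carrier_mat[OF Pc(1) rank_form_carrier(1)] Q X]
      assoc_mult_mat[OF Pc(1) rank_form_carrier(1) QX] by simp
  then have "rank_form n n r * (Q * X) = P' * 0\<^sub>m n n"
    using inverse_pair_cancel[OF inverse_pair_sym[OF P] mult_carrier_mat[OF rank_form_carrier(1) QX]]
      zero by simp
  then have "(rank_form n n r * (Q * X)) $$ (k, j) = 0" using Pc assms by simp
  then show ?thesis using index_rank_form_mult[OF QX, of k n j r] assms by simp
qed

text \<open>It suffices to pair B with the basis matrices P E_t Q. The two annihilation conditions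
  kill the first \<open>r\<close> rows of P^T B and of Q B^T, and a position in
  \<open>border n r\<close> has its row or its column index below \<open>r\<close>, so one of the
  two makes the pairing 0.\<close>

lemma tangent_space_subset_hyperplane:
  assumes P: "inverse_pair n P P'" and Q: "inverse_pair n Q Q'" and r: "1 \<le> r" "r \<le> n"
    and h: "h \<in> proj_space (entries n)"
    and left: "\<And>b. b \<in> h \<Longrightarrow> (P * rank_form n n r * Q)\<^sup>T * mat n n b = 0\<^sub>m n n"
    and right: "\<And>b. b \<in> h \<Longrightarrow> P * rank_form n n r * Q * (mat n n b)\<^sup>T = 0\<^sub>m n n"
  shows "tangent_space (entries n) (det_variety n r) (proj_point (coords n (P * rank_form n n r * Q)))
    \<subseteq> hyperplane (entries n) h"
proof
  note Pc = inverse_pairD[OF P] and Qc = inverse_pairD[OF Q]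
  let ?A = "P * rank_form n n r * Q"
  let ?T = "tangent_space (entries n) (det_variety n r) (proj_point (coords n ?A))"
  fix q assume q: "q \<in> ?T"
  have "(\<Sum>x\<in>entries n. y x * b x) = 0" if "y \<in> q" "b \<in> h" for y b
  proof -
    let ?B = "mat n n b"
    have yT: "y \<in> \<Union>?T" using q \<open>y \<in> q\<close> by blast
    obtain z where z: "y = (\<lambda>x. \<Sum>t\<in>border n r. z t *
        (if x \<in> entries n then P $$ (fst x, fst t) * Q $$ (snd t, snd x) else 0))"
      by (rule tangent_space_mem_expansion[OF P Q r yT])
    have PT: "P\<^sup>T \<in> carrier_mat n n" "Q\<^sup>T \<in> carrier_mat n n" using Pc Qc by auto
    have "?A\<^sup>T = Q\<^sup>T * (rank_form n n r * P\<^sup>T)"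
      using transpose_mult[OF mult_carrier_mat[OF Pc(1) rank_form_carrier(1)] Qc(1)]
        transpose_mult[OF Pc(1) rank_form_carrier(1)] by (simp add: transpose_rank_form)
    also have "\<dots> = Q\<^sup>T * rank_form n n r * P\<^sup>T"
      by (rule assoc_mult_mat[OF PT(2) rank_form_carrier(1) PT(1), symmetric])
    finally have AT: "?A\<^sup>T = Q\<^sup>T * rank_form n n r * P\<^sup>T" .
    have PB: "(\<Sum>i<n. P $$ (i, k) * b (i, j)) = 0" if "k < r" "j < n" for k j
    proof -
      have "(P\<^sup>T * ?B) $$ (k, j) = 0"
        by (rule normal_form_mult_zero[OF inverse_pair_transpose[OF Q] PT(1) mat_carrier _ r(2) that])
          (use left[OF \<open>b \<in> h\<close>] AT in simp)
      moreover have "(P\<^sup>T * ?B) $$ (k, j) = (\<Sum>i<n. P\<^sup>T $$ (k, i) * ?B $$ (i, j))"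
        by (rule index_mult_mat_sum[OF PT(1) mat_carrier]) (use that r in auto)
      ultimately show ?thesis using that r Pc by simp
    qed
    have QB: "(\<Sum>j<n. Q $$ (l, j) * b (i, j)) = 0" if "l < r" "i < n" for l i
    proof -
      have BT: "?B\<^sup>T \<in> carrier_mat n n" by simp
      have "(Q * ?B\<^sup>T) $$ (l, i) = 0"
        by (rule normal_form_mult_zero[OF P Qc(1) BT right[OF \<open>b \<in> h\<close>] r(2) that])
      moreover have "(Q * ?B\<^sup>T) $$ (l, i) = (\<Sum>j<n. Q $$ (l, j) * ?B\<^sup>T $$ (j, i))"
        by (rule index_mult_mat_sum[OF Qc(1) BT]) (use that r in auto)
      ultimately show ?thesis using that r Qc by simp
    qed
    have inner: "(\<Sum>i<n. \<Sum>j<n. P $$ (i, fst t) * Q $$ (snd t, j) * b (i, j)) = 0"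
      if t: "t \<in> border n r" for t
    proof (cases "fst t < r")
      case True
      have "(\<Sum>i<n. \<Sum>j<n. P $$ (i, fst t) * Q $$ (snd t, j) * b (i, j)) =
          (\<Sum>j<n. Q $$ (snd t, j) * (\<Sum>i<n. P $$ (i, fst t) * b (i, j)))"
        by (subst sum.swap) (simp add: sum_distrib_left mult_ac)
      also have "\<dots> = 0" using PB[OF True] by simp
      finally show ?thesis .
    next
      case False
      then have "snd t < r" using t by (auto simp: border_def)
      have "(\<Sum>i<n. \<Sum>j<n. P $$ (i, fst t) * Q $$ (snd t, j) * b (i, j)) =
          (\<Sum>i<n. P $$ (i, fst t) * (\<Sum>j<n. Q $$ (snd t, j) * b (i, j)))"
        by (simp add: sum_distrib_left mult_ac)
      also have "\<dots> = 0" using QB[OF \<open>snd t < r\<close>] by simp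
      finally show ?thesis .
    qed
    have "(\<Sum>x\<in>entries n. y x * b x) =
        (\<Sum>x\<in>entries n. \<Sum>t\<in>border n r. z t * (P $$ (fst x, fst t) * Q $$ (snd t, snd x) * b x))"
      unfolding z by (rule sum.cong) (simp_all add: sum_distrib_right mult.assoc)
    also have "\<dots> = (\<Sum>t\<in>border n r. z t * (\<Sum>x\<in>entries n. P $$ (fst x, fst t) * Q $$ (snd t, snd x) * b x))"
      by (subst sum.swap) (simp add: sum_distrib_left)
    also have "\<dots> = 0" using inner by (simp add: sum_entries)
    finally show ?thesis .
  qed
  moreover have "q \<in> proj_space (entries n)" using q by (auto simp: tangent_space_def)
  ultimately show "q \<in> hyperplane (entries n) h" by (auto simp: hyperplane_def)
qed

section \<open>Compound matrices\<close>

lemma inverse_pair_mult: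
  assumes P: "inverse_pair n P P'" and Q: "inverse_pair n Q Q'"
  shows "inverse_pair n (P * Q) (Q' * P')"
proof -
  note Pc = inverse_pairD[OF P] and Qc = inverse_pairD[OF Q]
  have "P * Q * (Q' * P') = P * (Q * (Q' * P'))"
    by (rule assoc_mult_mat[OF Pc(1) Qc(1) mult_carrier_mat[OF Qc(2) Pc(2)]])
  also have "Q * (Q' * P') = P'" by (rule inverse_pair_cancel[OF Q Pc(2)])
  finally have 1: "P * Q * (Q' * P') = 1\<^sub>m n" using Pc(3) by simp
  have "Q' * P' * (P * Q) = Q' * (P' * (P * Q))"
    by (rule assoc_mult_mat[OF Qc(2) Pc(2) mult_carrier_mat[OF Pc(1) Qc(1)]])
  also have "P' * (P * Q) = Q" by (rule inverse_pair_cancel[OF inverse_pair_sym[OF P] Qc(1)])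
  finally have 2: "Q' * P' * (P * Q) = 1\<^sub>m n" using Qc(4) by simp
  show ?thesis unfolding inverse_pair_def
    using 1 2 mult_carrier_mat[OF Pc(1) Qc(1)] mult_carrier_mat[OF Qc(2) Pc(2)] by blast
qed

definition compressible :: "nat \<Rightarrow> nat \<Rightarrow> complex mat \<Rightarrow> bool" where
  "compressible n p B \<longleftrightarrow>
     (\<exists>K C. K \<in> carrier_mat n p \<and> C \<in> carrier_mat p p \<and> B = K * C * K\<^sup>T)"

lemma compressibleI:
  "K \<in> carrier_mat n p \<Longrightarrow> C \<in> carrier_mat p p \<Longrightarrow> B = K * C * K\<^sup>T \<Longrightarrow> compressible n p B"
  unfolding compressible_def by (intro exI conjI)

lemma compressibleE:
  assumes "compressible n p B"
  obtains K C where "K \<in> carrier_mat n p" "C \<in> carrier_mat p p" "B = K * C * K\<^sup>T"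
  using assms unfolding compressible_def by (elim exE conjE) (rule that)

lemma compressible_smult:
  assumes "compressible n p B"
  shows "compressible n p (c \<cdot>\<^sub>m B)"
proof -
  obtain K C where KC: "K \<in> carrier_mat n p" "C \<in> carrier_mat p p" "B = K * C * K\<^sup>T"
    by (rule compressibleE[OF assms])
  have KT: "K\<^sup>T \<in> carrier_mat p n" using KC(1) by simp
  have "K * (c \<cdot>\<^sub>m C) * K\<^sup>T = c \<cdot>\<^sub>m (K * C * K\<^sup>T)"
    using mult_smult_distrib[OF KC(1,2), of c] mult_smult_assoc_mat[OF mult_carrier_mat[OF KC(1,2)] KT, of c]
    by simp
  then show ?thesis using KC by (intro compressibleI[of K n p "c \<cdot>\<^sub>m C"]) auto
qed

text \<open>The hypotheses place the column spaces of B and of its transpose in the span of the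
  first \<open>p\<close> columns of \<open>P\<close>. These columns form \<open>K\<close>, and
  \<open>C\<close> is the leading block of P' B P'^T.\<close>

lemma compressible_if_rows_zero:
  assumes P: "inverse_pair n P P'" and B: "B \<in> carrier_mat n n" and p: "p \<le> n"
    and z1: "\<And>i j. p \<le> i \<Longrightarrow> i < n \<Longrightarrow> j < n \<Longrightarrow> (P' * B) $$ (i, j) = 0"
    and z2: "\<And>i j. p \<le> i \<Longrightarrow> i < n \<Longrightarrow> j < n \<Longrightarrow> (P' * B\<^sup>T) $$ (i, j) = 0"
  shows "compressible n p B"
proof -
  note Pc = inverse_pairD[OF P]
  have PT: "P\<^sup>T \<in> carrier_mat n n" "P'\<^sup>T \<in> carrier_mat n n" using Pc by auto
  have PB: "P' * B \<in> carrier_mat n n" and BP: "B * P'\<^sup>T \<in> carrier_mat n n"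
    by (rule mult_carrier_mat[OF Pc(2) B]) (rule mult_carrier_mat[OF B PT(2)])
  let ?E = "rank_form n n p :: complex mat"
  have E: "?E \<in> carrier_mat n n" by simp
  have 1: "?E * (P' * B) = P' * B"
  proof (rule eq_matI)
    fix i j assume "i < dim_row (P' * B)" "j < dim_col (P' * B)"
    then have ij: "i < n" "j < n" using PB by auto
    show "(?E * (P' * B)) $$ (i, j) = (P' * B) $$ (i, j)"
      unfolding index_rank_form_mult[OF PB ij p] using z1[of i j] ij by auto
  qed (use carrier_matD[OF PB] in auto)
  have "P' * B\<^sup>T \<in> carrier_mat n n" using Pc B by (intro mult_carrier_mat[of _ n n]) auto
  have BPz: "(B * P'\<^sup>T) $$ (i, j) = 0" if "p \<le> j" "i < n" "j < n" for i j
  proof -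
    have "B * P'\<^sup>T = (P' * B\<^sup>T)\<^sup>T" using transpose_mult[OF Pc(2), of "B\<^sup>T" n] B by simp
    then have "(B * P'\<^sup>T) $$ (i, j) = (P' * B\<^sup>T) $$ (j, i)"
      using that carrier_matD[OF \<open>P' * B\<^sup>T \<in> carrier_mat n n\<close>] by (simp only: index_transpose_mat)
    with z2[of j i] that show ?thesis by simp
  qed
  have 2: "B * P'\<^sup>T * ?E = B * P'\<^sup>T"
  proof (rule eq_matI)
    fix i j assume "i < dim_row (B * P'\<^sup>T)" "j < dim_col (B * P'\<^sup>T)"
    then have ij: "i < n" "j < n" using BP by auto
    show "(B * P'\<^sup>T * ?E) $$ (i, j) = (B * P'\<^sup>T) $$ (i, j)"
      unfolding index_mult_rank_form[OF BP ij p] using BPz[of j i] ij by auto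
  qed (use carrier_matD[OF BP] in auto)
  define X where "X = P' * B * P'\<^sup>T"
  have X: "X \<in> carrier_mat n n" unfolding X_def by (rule triple_carrier[OF Pc(2) B PT(2)])
  have EX: "?E * X = X"
    unfolding X_def using assoc_mult_mat[OF E PB PT(2)] 1 by simp
  have "X = P' * (B * P'\<^sup>T)" unfolding X_def by (rule assoc_mult_mat[OF Pc(2) B PT(2)])
  then have XE: "X * ?E = X" using assoc_mult_mat[OF Pc(2) BP E] 2 by simp
  have PX: "P * X \<in> carrier_mat n n" by (rule mult_carrier_mat[OF Pc(1) X])
  have "P * X * P\<^sup>T = B"
    unfolding X_def
    by (rule inverse_pair_conjugate[OF inverse_pair_sym[OF P] inverse_pair_sym[OF inverse_pair_transpose[OF P]] B])
  define K where "K = P * rank_form n p p"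
  define C where "C = rank_form p n p * X * rank_form n p p"
  have K: "K \<in> carrier_mat n p" unfolding K_def by (rule mult_carrier_mat[OF Pc(1) rank_form_carrier(1)])
  have C: "C \<in> carrier_mat p p" unfolding C_def
    by (rule mult_carrier_mat[OF mult_carrier_mat[OF rank_form_carrier(1) X] rank_form_carrier(1)])
  have KT: "K\<^sup>T = rank_form p n p * P\<^sup>T"
    unfolding K_def using transpose_mult[OF Pc(1) rank_form_carrier(1)] by (simp add: transpose_rank_form)
  have RX: "rank_form p n p * X \<in> carrier_mat p n" by (rule mult_carrier_mat[OF rank_form_carrier(1) X])
  have "K * C = P * (rank_form n p p * C)"
    unfolding K_def by (rule assoc_mult_mat[OF Pc(1) rank_form_carrier(1) C])
  also have "rank_form n p p * C = rank_form n p p * (rank_form p n p * X) * rank_form n p p"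
    unfolding C_def by (rule assoc_mult_mat[OF rank_form_carrier(1) RX rank_form_carrier(1), symmetric])
  also have "rank_form n p p * (rank_form p n p * X) = X"
    using assoc_mult_mat[OF rank_form_carrier(1) rank_form_carrier(1) X, of n p p p] EX
    by (simp add: rank_form_mult)
  finally have KC: "K * C = P * (X * rank_form n p p)" .
  have "K * C * K\<^sup>T = P * X * rank_form n p p * K\<^sup>T"
    unfolding KC using assoc_mult_mat[OF Pc(1) X rank_form_carrier(1)] by simp
  also have "\<dots> = P * X * rank_form n p p * rank_form p n p * P\<^sup>T"
    unfolding KT by (rule assoc_mult_mat[OF mult_carrier_mat[OF PX rank_form_carrier(1)] rank_form_carrier(1) PT(1), symmetric])
  also have "P * X * rank_form n p p * rank_form p n p = P * X * ?E"
    using assoc_mult_mat[OF PX rank_form_carrier(1) rank_form_carrier(1), of p p n p] by (simp add: rank_form_mult)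
  also have "P * X * ?E = P * X" using assoc_mult_mat[OF Pc(1) X E] XE by simp
  finally have "B = K * C * K\<^sup>T" using \<open>P * X * P\<^sup>T = B\<close> by simp
  with K C show ?thesis by (rule compressibleI)
qed

text \<open>Turns the existential \<open>K\<close> and \<open>C\<close> into a rank condition on a
  matrix of linear forms. Conversely, the left factor \<open>U\<close> may have rank below
  \<open>p\<close>, so the common subspace comes from the basis \<open>P\<close> of its normal form,
  for which \<open>P' * U\<close> has no entries below row \<open>p\<close>.\<close>

lemma compressible_iff_factorization:
  assumes B: "B \<in> carrier_mat n n" and p: "p \<le> n"
  shows "compressible n p B \<longleftrightarrow> (\<exists>U W. U \<in> carrier_mat n p \<and> W \<in> carrier_mat p (2 * n) \<and>
    mat n (2 * n) (\<lambda>(i, j). if j < n then B $$ (i, j) else B $$ (j - n, i)) = U * W)"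
    (is "_ \<longleftrightarrow> (\<exists>U W. _ \<and> _ \<and> ?M = U * W)")
proof
  assume "compressible n p B"
  then obtain K C where KC: "K \<in> carrier_mat n p" "C \<in> carrier_mat p p" "B = K * C * K\<^sup>T"
    by (rule compressibleE)
  have KT: "K\<^sup>T \<in> carrier_mat p n" and CT: "C\<^sup>T \<in> carrier_mat p p" using KC by auto
  have CK: "C * K\<^sup>T \<in> carrier_mat p n" and CTK: "C\<^sup>T * K\<^sup>T \<in> carrier_mat p n"
    by (rule mult_carrier_mat[OF KC(2) KT]) (rule mult_carrier_mat[OF CT KT])
  have B1: "B = K * (C * K\<^sup>T)" using assoc_mult_mat[OF KC(1,2) KT] KC(3) by simp
  have "B\<^sup>T = (C * K\<^sup>T)\<^sup>T * K\<^sup>T" unfolding B1 by (rule transpose_mult[OF KC(1) CK])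
  also have "(C * K\<^sup>T)\<^sup>T = K * C\<^sup>T" using transpose_mult[OF KC(2) KT] by simp
  finally have B2: "B\<^sup>T = K * (C\<^sup>T * K\<^sup>T)" using assoc_mult_mat[OF KC(1) CT KT] by simp
  define W where "W = mat p (2 * n) (\<lambda>(k, j). if j < n then (C * K\<^sup>T) $$ (k, j) else (C\<^sup>T * K\<^sup>T) $$ (k, j - n))"
  have W: "W \<in> carrier_mat p (2 * n)" by (simp add: W_def)
  have "?M = K * W"
  proof (rule eq_matI)
    fix i j assume "i < dim_row (K * W)" "j < dim_col (K * W)"
    then have ij: "i < n" "j < 2 * n" using KC W by auto
    have KW: "(K * W) $$ (i, j) = (\<Sum>k<p. K $$ (i, k) * W $$ (k, j))"
      by (rule index_mult_mat_sum[OF KC(1) W ij])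
    show "?M $$ (i, j) = (K * W) $$ (i, j)"
    proof (cases "j < n")
      case True
      have "B $$ (i, j) = (\<Sum>k<p. K $$ (i, k) * (C * K\<^sup>T) $$ (k, j))"
        using index_mult_mat_sum[OF KC(1) CK ij(1) True] B1 by simp
      also have "\<dots> = (\<Sum>k<p. K $$ (i, k) * W $$ (k, j))"
        by (rule sum.cong) (use True ij in \<open>auto simp: W_def simp del: index_mult_mat\<close>)
      finally show ?thesis using KW True ij by (simp del: index_mult_mat(1))
    next
      case False
      then have j: "j - n < n" using ij by simp
      have "B $$ (j - n, i) = B\<^sup>T $$ (i, j - n)" using j ij B by simp
      also have "\<dots> = (\<Sum>k<p. K $$ (i, k) * (C\<^sup>T * K\<^sup>T) $$ (k, j - n))"
        unfolding B2 by (rule index_mult_mat_sum[OF KC(1) CTK ij(1) j])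
      also have "\<dots> = (\<Sum>k<p. K $$ (i, k) * W $$ (k, j))"
        by (rule sum.cong) (use False ij in \<open>auto simp: W_def simp del: index_mult_mat\<close>)
      finally show ?thesis using KW False ij by (simp del: index_mult_mat(1))
    qed
  qed (use KC W in auto)
  with KC(1) W show "\<exists>U W. U \<in> carrier_mat n p \<and> W \<in> carrier_mat p (2 * n) \<and> ?M = U * W"
    by (intro exI conjI)
next
  assume "\<exists>U W. U \<in> carrier_mat n p \<and> W \<in> carrier_mat p (2 * n) \<and> ?M = U * W"
  then obtain U W where UW: "U \<in> carrier_mat n p" "W \<in> carrier_mat p (2 * n)" "?M = U * W"
    by (elim exE conjE)
  obtain q P P' Q Q' where q: "q \<le> n" "q \<le> p" and P: "inverse_pair n P P'" and Q: "inverse_pair p Q Q'"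
    and U: "U = P * rank_form n p q * Q" by (rule rank_normal_form[OF UW(1)])
  note Pc = inverse_pairD[OF P] and Qc = inverse_pairD[OF Q]
  have RQ: "rank_form n p q * Q \<in> carrier_mat n p" by (rule mult_carrier_mat[OF rank_form_carrier(1) Qc(1)])
  have PU: "P' * U = rank_form n p q * Q"
    using inverse_pair_cancel[OF inverse_pair_sym[OF P] RQ] assoc_mult_mat[OF Pc(1) rank_form_carrier(1) Qc(1)] U
    by simp
  have zero: "(P' * (U * V)) $$ (i, j) = 0"
    if V: "V \<in> carrier_mat p n" and ij: "p \<le> i" "i < n" "j < n" for V i j
  proof -
    have QV: "Q * V \<in> carrier_mat p n" by (rule mult_carrier_mat[OF Qc(1) V])
    have "P' * (U * V) = P' * U * V" by (rule assoc_mult_mat[OF Pc(2) UW(1) V, symmetric])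
    also have "\<dots> = rank_form n p q * (Q * V)"
      unfolding PU by (rule assoc_mult_mat[OF rank_form_carrier(1) Qc(1) V])
    finally show ?thesis using index_rank_form_mult[OF QV ij(2,3) q(2)] ij q by simp
  qed
  define W1 where "W1 = mat p n (\<lambda>(k, j). W $$ (k, j))"
  define W2 where "W2 = mat p n (\<lambda>(k, j). W $$ (k, n + j))"
  have Wc: "W1 \<in> carrier_mat p n" "W2 \<in> carrier_mat p n" by (auto simp: W1_def W2_def)
  have entry: "?M $$ (i, j) = (\<Sum>k<p. U $$ (i, k) * W $$ (k, j))" if "i < n" "j < 2 * n" for i j
    unfolding UW(3) by (rule index_mult_mat_sum[OF UW(1,2) that])
  have "B = U * W1"
  proof (rule eq_matI)
    fix i j assume "i < dim_row (U * W1)" "j < dim_col (U * W1)"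
    then have ij: "i < n" "j < n" using UW Wc by auto
    have "B $$ (i, j) = (\<Sum>k<p. U $$ (i, k) * W $$ (k, j))" using entry[of i j] ij by simp
    also have "\<dots> = (\<Sum>k<p. U $$ (i, k) * W1 $$ (k, j))"
      by (rule sum.cong) (use ij in \<open>auto simp: W1_def\<close>)
    finally show "B $$ (i, j) = (U * W1) $$ (i, j)" using index_mult_mat_sum[OF UW(1) Wc(1) ij] by simp
  qed (use B UW Wc in auto)
  moreover have "B\<^sup>T = U * W2"
  proof (rule eq_matI)
    fix i j assume "i < dim_row (U * W2)" "j < dim_col (U * W2)"
    then have ij: "i < n" "j < n" using UW Wc by auto
    have "B\<^sup>T $$ (i, j) = (\<Sum>k<p. U $$ (i, k) * W $$ (k, n + j))" using entry[of i "n + j"] ij B by simp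
    also have "\<dots> = (\<Sum>k<p. U $$ (i, k) * W2 $$ (k, j))"
      by (rule sum.cong) (use ij in \<open>auto simp: W2_def\<close>)
    finally show "B\<^sup>T $$ (i, j) = (U * W2) $$ (i, j)" using index_mult_mat_sum[OF UW(1) Wc(2) ij] by simp
  qed (use B UW Wc in auto)
  ultimately show "compressible n p B"
    using zero[OF Wc(1)] zero[OF Wc(2)] by (intro compressible_if_rows_zero[OF P B p]) simp_all
qed

definition compressible_locus :: "nat \<Rightarrow> nat \<Rightarrow> (nat \<times> nat \<Rightarrow> complex) set set" where
  "compressible_locus n p = {h \<in> proj_space (entries n). \<forall>b\<in>h. compressible n p (mat n n b)}"

lemma zariski_closed_compressible_locus:
  assumes p: "p \<le> n"
  shows "zariski_closed (entries n) (compressible_locus n p)"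
proof -
  let ?M = "\<lambda>b :: nat \<times> nat \<Rightarrow> complex. mat n (2 * n) (\<lambda>(i, j). if j < n then b (i, j) else b (j - n, i))"
  have M: "mat n (2 * n) (\<lambda>(i, j). if j < n then mat n n b $$ (i, j) else mat n n b $$ (j - n, i)) = ?M b" for b :: "nat \<times> nat \<Rightarrow> complex"
    by (rule eq_matI) auto
  have "(\<lambda>b. ?M b $$ (k, l)) \<in> hforms (entries n) 1" if "k < n" "l < 2 * n" for k l
    using that hforms_entry[of k n l] hforms_entry[of "l - n" n k] by (cases "l < n") auto
  from zariski_closed_factorization[OF _ finite_entries this, where q = p]
  show ?thesis
    unfolding compressible_locus_def compressible_iff_factorization[OF mat_carrier p] M by simp
qed

section \<open>Maximal minors and the symmetry of the compound matrix\<close>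

lemma mem_p_subsets: "I \<in> set (p_subsets n p) \<longleftrightarrow> I \<subseteq> {0..<n} \<and> card I = p"
proof
  assume "I \<in> set (p_subsets n p)"
  then obtain xs where xs: "xs \<in> set (subseqs [0..<n])" "length xs = p" "I = set xs"
    by (auto simp: p_subsets_def)
  have "distinct xs" using subseqs_distinctD[OF xs(1)] by simp
  moreover have "set xs \<subseteq> {0..<n}" using subseqs_powset[of "[0..<n]"] xs(1) by auto
  ultimately show "I \<subseteq> {0..<n} \<and> card I = p" using xs by (auto simp: distinct_card)
next
  assume I: "I \<subseteq> {0..<n} \<and> card I = p"
  then have "I \<in> set ` set (subseqs [0..<n])" using subseqs_powset[of "[0..<n]"] by auto
  then obtain xs where xs: "xs \<in> set (subseqs [0..<n])" "I = set xs" by auto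
  have "distinct xs" using subseqs_distinctD[OF xs(1)] by simp
  then have "length xs = p" using I xs(2) by (simp add: distinct_card)
  with xs show "I \<in> set (p_subsets n p)" by (auto simp: p_subsets_def)
qed

lemma symmetric_compound_iff:
  assumes B: "B \<in> carrier_mat n n"
  shows "symmetric_matrix (compound_matrix p B) \<longleftrightarrow>
    (\<forall>I\<in>set (p_subsets n p). \<forall>J\<in>set (p_subsets n p). det (submatrix B I J) = det (submatrix B J I))"
proof -
  let ?L = "p_subsets n p" and ?m = "n choose p"
  have len: "length ?L = ?m" by (rule length_p_subsets)
  have C: "compound_matrix p B = mat ?m ?m (\<lambda>(i, j). det (submatrix B (?L ! i) (?L ! j)))"
    using B by (simp add: compound_matrix_def Let_def)
  have "symmetric_matrix (compound_matrix p B) \<longleftrightarrow>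
    (\<forall>i<?m. \<forall>j<?m. det (submatrix B (?L ! i) (?L ! j)) = det (submatrix B (?L ! j) (?L ! i)))"
    unfolding symmetric_matrix_def C by (auto simp: mat_eq_iff)
  also have "\<dots> \<longleftrightarrow> (\<forall>I\<in>set ?L. \<forall>J\<in>set ?L. det (submatrix B I J) = det (submatrix B J I))"
    by (simp add: all_set_conv_all_nth len)
  finally show ?thesis .
qed

text \<open>The selection may be unsorted and may repeat rows. Cramer's rule needs this, since it
  replaces a single selected index by an arbitrary one.\<close>

definition row_select :: "nat \<Rightarrow> 'a mat \<Rightarrow> (nat \<Rightarrow> nat) \<Rightarrow> 'a mat" where
  "row_select p U \<alpha> = mat p p (\<lambda>(a, k). U $$ (\<alpha> a, k))"

lemma row_select_carrier [simp]: "row_select p U \<alpha> \<in> carrier_mat p p"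
  by (simp add: row_select_def)

lemma det_submatrix_eq:
  fixes B :: "complex mat"
  assumes B: "B \<in> carrier_mat n n" and "I \<subseteq> {0..<n}" "card I = p" "J \<subseteq> {0..<n}" "card J = p"
  shows "submatrix B I J = mat p p (\<lambda>(a, b). B $$ (pick I a, pick J b))"
proof -
  have "{i. i < n \<and> i \<in> I} = I" "{j. j < n \<and> j \<in> J} = J" using assms by auto
  with assms show ?thesis by (simp add: submatrix_def)
qed

lemma pick_less:
  assumes "I \<subseteq> {0..<n}" "card I = p" "a < p"
  shows "pick I a < n"
  using pick_in_set_le[of a I] assms by auto

lemma minor_of_product:
  fixes U C V :: "complex mat"
  assumes "U \<in> carrier_mat n p" "C \<in> carrier_mat p p" "V \<in> carrier_mat n p"
    and "\<And>a. a < p \<Longrightarrow> \<alpha> a < n" "\<And>a. a < p \<Longrightarrow> \<beta> a < n"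
  shows "mat p p (\<lambda>(a, b). (U * C * V\<^sup>T) $$ (\<alpha> a, \<beta> b)) = row_select p U \<alpha> * C * (row_select p V \<beta>)\<^sup>T"
proof (rule eq_matI)
  have VT: "V\<^sup>T \<in> carrier_mat p n" and sV: "(row_select p V \<beta>)\<^sup>T \<in> carrier_mat p p"
    using assms(3) by auto
  have dims: "row_select p U \<alpha> * C * (row_select p V \<beta>)\<^sup>T \<in> carrier_mat p p"
    by (rule triple_carrier[OF row_select_carrier assms(2) sV])
  fix i j assume "i < dim_row (row_select p U \<alpha> * C * (row_select p V \<beta>)\<^sup>T)"
    "j < dim_col (row_select p U \<alpha> * C * (row_select p V \<beta>)\<^sup>T)"
  then have ij: "i < p" "j < p" using carrier_matD[OF dims] by auto
  have "(U * C * V\<^sup>T) $$ (\<alpha> i, \<beta> j) = (\<Sum>k<p. \<Sum>l<p. U $$ (\<alpha> i, k) * C $$ (k, l) * V\<^sup>T $$ (l, \<beta> j))"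
    by (rule index_triple_mult[OF assms(1,2) VT assms(4)[OF ij(1)] assms(5)[OF ij(2)]])
  also have "\<dots> = (\<Sum>k<p. \<Sum>l<p. row_select p U \<alpha> $$ (i, k) * C $$ (k, l) * (row_select p V \<beta>)\<^sup>T $$ (l, j))"
    by (intro sum.cong refl) (use ij assms(3) assms(5)[OF ij(2)] in \<open>auto simp: row_select_def\<close>)
  also have "\<dots> = (row_select p U \<alpha> * C * (row_select p V \<beta>)\<^sup>T) $$ (i, j)"
    by (rule index_triple_mult[OF row_select_carrier assms(2) sV ij, symmetric])
  finally show "mat p p (\<lambda>(a, b). (U * C * V\<^sup>T) $$ (\<alpha> a, \<beta> b)) $$ (i, j) =
      (row_select p U \<alpha> * C * (row_select p V \<beta>)\<^sup>T) $$ (i, j)" using ij by simp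
qed (use assms(2) in \<open>auto simp: row_select_def\<close>)

text \<open>A case of the Cauchy-Binet formula with a single summand: the inner dimension equals the
  size of the minor.\<close>

lemma det_minor_of_product:
  fixes U C V :: "complex mat"
  assumes "U \<in> carrier_mat n p" "C \<in> carrier_mat p p" "V \<in> carrier_mat n p"
    and "\<And>a. a < p \<Longrightarrow> \<alpha> a < n" "\<And>a. a < p \<Longrightarrow> \<beta> a < n"
  shows "det (mat p p (\<lambda>(a, b). (U * C * V\<^sup>T) $$ (\<alpha> a, \<beta> b))) =
    det (row_select p U \<alpha>) * det C * det (row_select p V \<beta>)"
proof -
  have sV: "(row_select p V \<beta>)\<^sup>T \<in> carrier_mat p p" by simp
  have "det (row_select p U \<alpha> * C * (row_select p V \<beta>)\<^sup>T) =
      det (row_select p U \<alpha>) * det C * det ((row_select p V \<beta>)\<^sup>T)"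
    using det_mult[OF mult_carrier_mat[OF row_select_carrier assms(2)] sV]
      det_mult[OF row_select_carrier assms(2)] by simp
  also have "det ((row_select p V \<beta>)\<^sup>T) = det (row_select p V \<beta>)" by (rule det_transpose[OF row_select_carrier])
  finally show ?thesis using minor_of_product[OF assms] by simp
qed

text \<open>The minor at \<open>I\<close> and \<open>J\<close> is the product of the maximal minors
  of \<open>K\<close> at \<open>I\<close> and at \<open>J\<close> and of \<open>det C\<close>, which
  is symmetric in \<open>I\<close> and \<open>J\<close>.\<close>

lemma compressible_symmetric_compound:
  assumes "compressible n p B"
  shows "symmetric_matrix (compound_matrix p B)"
proof -
  obtain K C where KC: "K \<in> carrier_mat n p" "C \<in> carrier_mat p p" "B = K * C * K\<^sup>T"
    by (rule compressibleE[OF assms])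
  have KT: "K\<^sup>T \<in> carrier_mat p n" using KC(1) by simp
  have B: "B \<in> carrier_mat n n"
    unfolding KC(3) by (rule mult_carrier_mat[OF mult_carrier_mat[OF KC(1,2)] KT])
  have "det (submatrix B I J) = det (submatrix B J I)"
    if "I \<in> set (p_subsets n p)" "J \<in> set (p_subsets n p)" for I J
  proof -
    have I: "I \<subseteq> {0..<n}" "card I = p" and J: "J \<subseteq> {0..<n}" "card J = p"
      using that by (auto simp: mem_p_subsets)
    show ?thesis
      unfolding det_submatrix_eq[OF B I J] det_submatrix_eq[OF B J I] unfolding KC(3)
      using det_minor_of_product[OF KC(1,2,1) pick_less[OF I] pick_less[OF J]]
        det_minor_of_product[OF KC(1,2,1) pick_less[OF J] pick_less[OF I]] by simp
  qed
  then show ?thesis unfolding symmetric_compound_iff[OF B] by blast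
qed

text \<open>Multilinearity in the rows writes \<open>det (S * U)\<close> as a combination of the
  determinants of row selections of \<open>U\<close>.\<close>

lemma exists_nonzero_minor:
  fixes U :: "complex mat"
  assumes S: "S \<in> carrier_mat p n" and U: "U \<in> carrier_mat n p" and nz: "det (S * U) \<noteq> 0"
  obtains \<alpha> where "\<And>a. a < p \<Longrightarrow> \<alpha> a < n" "det (row_select p U \<alpha>) \<noteq> 0"
proof -
  have rowU: "row U k \<in> carrier_vec p" for k using U by (simp add: row_carrier_vec carrier_vecI)
  let ?a = "\<lambda>i k. S $$ (i, k) \<cdot>\<^sub>v row U k"
  let ?F = "{f. (\<forall>i\<in>{0..<p}. f i \<in> {0..<n}) \<and> (\<forall>i. i \<notin> {0..<p} \<longrightarrow> f i = i)}"
  have "det (S * U) = (\<Sum>f\<in>?F. det (mat\<^sub>r p p (\<lambda>i. ?a i (f i))))"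
    unfolding mat_mul_finsum_alt[OF S U]
    by (rule det_linear_rows_sum) (use rowU in auto)
  with nz obtain f where f: "f \<in> ?F" "det (mat\<^sub>r p p (\<lambda>i. ?a i (f i))) \<noteq> 0"
    by (metis (no_types, lifting) sum.neutral)
  have "det (mat\<^sub>r p p (\<lambda>i. ?a i (f i))) = (\<Prod>i\<in>{0..<p}. S $$ (i, f i)) * det (mat\<^sub>r p p (\<lambda>i. row U (f i)))"
    by (rule det_rows_mul) (use rowU in auto)
  with f(2) have "det (mat\<^sub>r p p (\<lambda>i. row U (f i))) \<noteq> 0" by auto
  moreover have "mat\<^sub>r p p (\<lambda>i. row U (f i)) = row_select p U f"
    by (rule eq_matI) (use U f(1) in \<open>auto simp: row_select_def\<close>)
  ultimately show thesis using that[of f] f(1) by auto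
qed

text \<open>Relates arbitrary injective selections to the increasing ones that index the compound
  matrix; \<open>\<pi> a\<close> is the number of selected indices below
  \<open>\<alpha> a\<close>.\<close>

lemma injective_selection_sorted:
  assumes "\<And>a. a < p \<Longrightarrow> \<alpha> a < n" and inj: "inj_on \<alpha> {0..<p}"
  shows "\<exists>I \<pi>. I \<subseteq> {0..<n} \<and> card I = p \<and> \<pi> permutes {0..<p} \<and> (\<forall>a<p. \<alpha> a = pick I (\<pi> a))"
proof -
  define I where "I = \<alpha> ` {0..<p}"
  have I: "I \<subseteq> {0..<n}" "card I = p" "finite I" using assms by (auto simp: I_def card_image)
  define \<pi> where "\<pi> a = (if a < p then card {x \<in> I. x < \<alpha> a} else a)" for a
  have pick: "\<alpha> a = pick I (\<pi> a)" if "a < p" for a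
    using pick_card_in_set[of "\<alpha> a" I] that by (simp add: \<pi>_def I_def)
  have less: "\<pi> a < p" if "a < p" for a
  proof -
    have "{x \<in> I. x < \<alpha> a} \<subset> I" using that by (auto simp: I_def)
    from psubset_card_mono[OF I(3) this] show ?thesis using that I(2) by (simp add: \<pi>_def)
  qed
  have "inj_on \<pi> {0..<p}"
  proof (rule inj_onI)
    fix a b assume ab: "a \<in> {0..<p}" "b \<in> {0..<p}" "\<pi> a = \<pi> b"
    then have "\<alpha> a = \<alpha> b" using pick by simp
    with inj ab show "a = b" by (simp add: inj_on_def)
  qed
  moreover from this have "\<pi> ` {0..<p} = {0..<p}"
    by (intro endo_inj_surj) (use less in auto)
  ultimately have "\<pi> permutes {0..<p}"
    by (intro bij_imp_permutes) (auto simp: bij_betw_def \<pi>_def)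
  with I pick show ?thesis by blast
qed

lemma det_row_select_permute:
  fixes U :: "complex mat"
  assumes "\<pi> permutes {0..<p}" "\<And>a. a < p \<Longrightarrow> \<alpha> a = \<beta> (\<pi> a)"
  shows "det (row_select p U \<alpha>) = signof \<pi> * det (row_select p U \<beta>)"
proof -
  have less: "\<pi> a < p" if "a < p" for a
    using permutes_in_image[OF assms(1), of a] that by simp
  have "row_select p U \<alpha> = mat p p (\<lambda>(i, j). row_select p U \<beta> $$ (\<pi> i, j))"
    by (rule eq_matI) (use assms(2) less in \<open>auto simp: row_select_def\<close>)
  then show ?thesis using det_permute_rows[OF row_select_carrier assms(1), of U \<beta>] by simp
qed

lemma det_row_select_not_inj:
  fixes U :: "complex mat"
  assumes "\<not> inj_on \<alpha> {0..<p}"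
  shows "det (row_select p U \<alpha>) = 0"
proof -
  obtain a b where ab: "a < p" "b < p" "a \<noteq> b" "\<alpha> a = \<alpha> b" using assms by (auto simp: inj_on_def)
  then have "row (row_select p U \<alpha>) a = row (row_select p U \<alpha>) b"
    by (intro eq_vecI) (auto simp: row_select_def)
  then show ?thesis using det_identical_rows[OF row_select_carrier ab(3,1,2)] by blast
qed

text \<open>Cramer's rule: the coefficients depend on the maximal minors only up to a common factor.\<close>

lemma factor_through_row_select:
  fixes U :: "complex mat"
  assumes U: "U \<in> carrier_mat n p" and \<alpha>: "\<And>a. a < p \<Longrightarrow> \<alpha> a < n" and nz: "det (row_select p U \<alpha>) \<noteq> 0"
  shows "U = mat n p (\<lambda>(i, k). det (row_select p U (\<alpha>(k := i))) / det (row_select p U \<alpha>)) * row_select p U \<alpha>"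
proof -
  let ?X = "row_select p U \<alpha>"
  obtain X' where X': "inverse_pair p ?X X'" by (rule inverse_pair_exists[OF row_select_carrier nz])
  note Xc = inverse_pairD[OF X']
  define Y where "Y = U * X'"
  have Y: "Y \<in> carrier_mat n p" unfolding Y_def by (rule mult_carrier_mat[OF U Xc(2)])
  have UY: "U = Y * ?X"
    unfolding Y_def by (rule inverse_pair_cancel_right[OF inverse_pair_sym[OF X'] U, symmetric])
  have "Y $$ (i, k) = det (row_select p U (\<alpha>(k := i))) / det ?X" if ik: "i < n" "k < p" for i k
  proof -
    let ?x = "vec p (\<lambda>k. Y $$ (i, k))"
    have XT: "?X\<^sup>T \<in> carrier_mat p p" by simp
    have "(?X\<^sup>T *\<^sub>v ?x) $ j = U $$ (i, j)" if "j < p" for j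
    proof -
      have "U $$ (i, j) = (\<Sum>l<p. Y $$ (i, l) * ?X $$ (l, j))"
        using index_mult_mat_sum[OF Y row_select_carrier[of p U \<alpha>] ik(1) that] UY by simp
      moreover have "(?X\<^sup>T *\<^sub>v ?x) $ j = (\<Sum>l<p. ?X $$ (l, j) * Y $$ (i, l))"
        using that by (simp add: scalar_prod_def row_select_def atLeast0LessThan)
      ultimately show ?thesis by (simp add: mult.commute)
    qed
    \<comment> \<open>Row \<open>i\<close> of \<open>U\<close> is the combination of the selected
      rows with coefficient vector \<open>?x\<close>, so the replaced column is the selection in
      which \<open>i\<close> takes the place of the entry \<open>k\<close>.\<close>
    then have "replace_col (?X\<^sup>T) (?X\<^sup>T *\<^sub>v ?x) k = (row_select p U (\<alpha>(k := i)))\<^sup>T"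
      by (intro eq_matI) (auto simp: replace_col_def row_select_def simp del: index_mult_mat_vec)
    moreover have "det (replace_col (?X\<^sup>T) (?X\<^sup>T *\<^sub>v ?x) k) = ?x $ k * det (?X\<^sup>T)"
      by (rule cramer_lemma_mat[OF XT _ ik(2)]) simp
    ultimately have "det (row_select p U (\<alpha>(k := i))) = Y $$ (i, k) * det ?X"
      using ik det_transpose[OF row_select_carrier, of p U \<alpha>]
        det_transpose[OF row_select_carrier, of p U "\<alpha>(k := i)"] by simp
    with nz show ?thesis by simp
  qed
  then have "Y = mat n p (\<lambda>(i, k). det (row_select p U (\<alpha>(k := i))) / det ?X)"
    using Y by (intro eq_matI) auto
  with UY show ?thesis by simp
qed

text \<open>Write B as \<open>U\<close> times the transpose of \<open>V\<close>. Symmetry of the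
  compound matrix says that u(I) v(J) = u(J) v(I) for the maximal minors of \<open>U\<close> and
  \<open>V\<close>, so the two families of minors are proportional. By Cramer's rule the quotients
  of minors determine \<open>U\<close> and \<open>V\<close> up to an invertible right factor, and
  both equal the same \<open>K\<close> times a square matrix.\<close>

lemma symmetric_compound_compressible:
  assumes B: "B \<in> carrier_mat n n" and p: "1 \<le> p" and rank: "mat_rank B = p"
    and sym: "symmetric_matrix (compound_matrix p B)"
  shows "compressible n p B"
proof -
  obtain U W where UW: "U \<in> carrier_mat n p" "W \<in> carrier_mat p n" "B = U * W"
    by (rule mat_rank_leE[OF B, of p]) (use rank in simp)
  define V where "V = W\<^sup>T"
  have V: "V \<in> carrier_mat n p" using UW by (simp add: V_def)
  have VT: "V\<^sup>T \<in> carrier_mat p n" using V by simp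
  have BUV: "B = U * 1\<^sub>m p * V\<^sup>T" using UW by (simp add: V_def)
  let ?u = "\<lambda>\<alpha>. det (row_select p U \<alpha>)" and ?v = "\<lambda>\<alpha>. det (row_select p V \<alpha>)"
  have minor: "det (mat p p (\<lambda>(a, b). B $$ (\<alpha> a, \<beta> b))) = ?u \<alpha> * ?v \<beta>"
    if "\<And>a. a < p \<Longrightarrow> \<alpha> a < n" "\<And>a. a < p \<Longrightarrow> \<beta> a < n" for \<alpha> \<beta>
    unfolding BUV using det_minor_of_product[OF UW(1) one_carrier_mat V that] by simp
  have sorted: "?u (pick I) * ?v (pick J) = ?u (pick J) * ?v (pick I)"
    if I: "I \<subseteq> {0..<n}" "card I = p" and J: "J \<subseteq> {0..<n}" "card J = p" for I J
  proof -
    have "det (submatrix B I J) = det (submatrix B J I)"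
      using sym I J unfolding symmetric_compound_iff[OF B] by (simp add: mem_p_subsets)
    then show ?thesis
      unfolding det_submatrix_eq[OF B I J] det_submatrix_eq[OF B J I]
      using minor[OF pick_less[OF I] pick_less[OF J]] minor[OF pick_less[OF J] pick_less[OF I]] by simp
  qed
  \<comment> \<open>Extends the relation from increasing to arbitrary selections: a permutation
    contributes the same sign to \<open>?u\<close> and to \<open>?v\<close>, and a repeated row
    gives 0 on both sides.\<close>
  have all: "?u \<alpha> * ?v \<beta> = ?u \<beta> * ?v \<alpha>"
    if \<alpha>: "\<And>a. a < p \<Longrightarrow> \<alpha> a < n" and \<beta>: "\<And>a. a < p \<Longrightarrow> \<beta> a < n" for \<alpha> \<beta>
  proof (cases "inj_on \<alpha> {0..<p} \<and> inj_on \<beta> {0..<p}")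
    case True
    have "\<exists>I \<pi>. I \<subseteq> {0..<n} \<and> card I = p \<and> \<pi> permutes {0..<p} \<and> (\<forall>a<p. \<alpha> a = pick I (\<pi> a))"
      by (rule injective_selection_sorted) (use \<alpha> True in auto)
    then obtain I \<pi> where I: "I \<subseteq> {0..<n}" "card I = p" "\<pi> permutes {0..<p}" "\<forall>a<p. \<alpha> a = pick I (\<pi> a)"
      by blast
    have "\<exists>J \<sigma>. J \<subseteq> {0..<n} \<and> card J = p \<and> \<sigma> permutes {0..<p} \<and> (\<forall>a<p. \<beta> a = pick J (\<sigma> a))"
      by (rule injective_selection_sorted) (use \<beta> True in auto)
    then obtain J \<sigma> where J: "J \<subseteq> {0..<n}" "card J = p" "\<sigma> permutes {0..<p}" "\<forall>a<p. \<beta> a = pick J (\<sigma> a)"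
      by blast
    have d: "det (row_select p X \<alpha>) = signof \<pi> * det (row_select p X (pick I))"
      "det (row_select p X \<beta>) = signof \<sigma> * det (row_select p X (pick J))" for X :: "complex mat"
      using I(4) J(4) det_row_select_permute[OF I(3), of \<alpha> "pick I" X]
        det_row_select_permute[OF J(3), of \<beta> "pick J" X] by auto
    show ?thesis unfolding d using sorted[OF I(1,2) J(1,2)] by (simp add: algebra_simps)
  next
    case False
    then show ?thesis using det_row_select_not_inj[of \<alpha> p] det_row_select_not_inj[of \<beta> p] by auto
  qed
  \<comment> \<open>Rank \<open>p\<close> means that B does not factor through \<open>p - 1\<close>.
    A nonzero determinant of \<open>S * B * T\<close> then splits into nonzero determinants for
    \<open>U\<close> and for \<open>V\<close>.\<close>
  obtain S T where ST: "S \<in> carrier_mat p n" "T \<in> carrier_mat n p" "det (S * B * T) \<noteq> 0"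
  proof -
    have "\<not> mat_rank B \<le> p - 1" using rank p by simp
    then have "\<exists>S\<in>carrier_mat (Suc (p - 1)) n. \<exists>T\<in>carrier_mat n (Suc (p - 1)). det (S * B * T) \<noteq> 0"
      using mat_rank_le_iff[OF B] factorization_iff_dets_zero[OF B] by blast
    then obtain S T where "S \<in> carrier_mat p n" "T \<in> carrier_mat n p" "det (S * B * T) \<noteq> 0"
      using p by auto
    then show thesis by (rule that)
  qed
  have SU: "S * U \<in> carrier_mat p p" and WT: "W * T \<in> carrier_mat p p"
    by (rule mult_carrier_mat[OF ST(1) UW(1)]) (rule mult_carrier_mat[OF UW(2) ST(2)])
  have "S * B * T = (S * U) * (W * T)"
    using assoc_mult_mat[OF ST(1) UW(1,2)] assoc_mult_mat[OF SU UW(2) ST(2)] UW(3) by simp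
  then have nz: "det (S * U) \<noteq> 0" "det (W * T) \<noteq> 0" using ST(3) det_mult[OF SU WT] by auto
  have TT: "T\<^sup>T \<in> carrier_mat p n" using ST(2) by simp
  have "det (T\<^sup>T * V) = det (W * T)"
    using transpose_mult[OF UW(2) ST(2)] det_transpose[OF WT] by (simp add: V_def)
  with nz have nzV: "det (T\<^sup>T * V) \<noteq> 0" by simp
  obtain \<alpha> where \<alpha>: "\<And>a. a < p \<Longrightarrow> \<alpha> a < n" "?u \<alpha> \<noteq> 0"
    by (rule exists_nonzero_minor[OF ST(1) UW(1) nz(1)]) blast
  obtain \<beta> where \<beta>: "\<And>a. a < p \<Longrightarrow> \<beta> a < n" "?v \<beta> \<noteq> 0"
    by (rule exists_nonzero_minor[OF TT V nzV]) blast
  \<comment> \<open>Proportionality makes one selection work for both matrices: the left side is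
    nonzero, hence so is \<open>?v \<alpha>\<close>.\<close>
  have "?u \<alpha> * ?v \<beta> = ?u \<beta> * ?v \<alpha>" by (rule all) (use \<alpha>(1) \<beta>(1) in auto)
  with \<alpha>(2) \<beta>(2) have v\<alpha>: "?v \<alpha> \<noteq> 0" by auto
  define K where "K = mat n p (\<lambda>(i, k). ?u (\<alpha>(k := i)) / ?u \<alpha>)"
  have K: "K \<in> carrier_mat n p" by (simp add: K_def)
  have "mat n p (\<lambda>(i, k). ?v (\<alpha>(k := i)) / ?v \<alpha>) = K"
    unfolding K_def
  proof (rule eq_matI)
    fix i k assume "i < dim_row (mat n p (\<lambda>(i, k). ?u (\<alpha>(k := i)) / ?u \<alpha>))"
      "k < dim_col (mat n p (\<lambda>(i, k). ?u (\<alpha>(k := i)) / ?u \<alpha>))"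
    then have ik: "i < n" "k < p" by auto
    have "?u (\<alpha>(k := i)) * ?v \<alpha> = ?u \<alpha> * ?v (\<alpha>(k := i))"
      by (rule all) (use \<alpha>(1) ik in auto)
    then have "?v (\<alpha>(k := i)) / ?v \<alpha> = ?u (\<alpha>(k := i)) / ?u \<alpha>"
      using \<alpha>(2) v\<alpha> by (simp add: field_simps)
    with ik show "mat n p (\<lambda>(i, k). ?v (\<alpha>(k := i)) / ?v \<alpha>) $$ (i, k) =
        mat n p (\<lambda>(i, k). ?u (\<alpha>(k := i)) / ?u \<alpha>) $$ (i, k)" by simp
  qed auto
  then have VK: "V = K * row_select p V \<alpha>" using factor_through_row_select[OF V \<alpha>(1) v\<alpha>] by simp
  have UK: "U = K * row_select p U \<alpha>"
    unfolding K_def by (rule factor_through_row_select[OF UW(1) \<alpha>])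
  have KT: "K\<^sup>T \<in> carrier_mat p n" and sT: "(row_select p V \<alpha>)\<^sup>T \<in> carrier_mat p p" using K by auto
  have "V\<^sup>T = (row_select p V \<alpha>)\<^sup>T * K\<^sup>T"
    using transpose_mult[OF K row_select_carrier, of V \<alpha>] VK by simp
  moreover have "B = U * V\<^sup>T" using UW by (simp add: V_def)
  ultimately have "B = U * (row_select p V \<alpha>)\<^sup>T * K\<^sup>T"
    using assoc_mult_mat[OF UW(1) sT KT] by simp
  also have "U * (row_select p V \<alpha>)\<^sup>T = K * (row_select p U \<alpha> * (row_select p V \<alpha>)\<^sup>T)"
    using assoc_mult_mat[OF K row_select_carrier sT, of U \<alpha>] UK by simp
  finally show ?thesis
    by (rule compressibleI[OF K mult_carrier_mat[OF row_select_carrier sT]])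
qed

section \<open>Relative dual varieties\<close>

text \<open>Reverses the coordinates. The kernel of \<open>rank_form n n r\<close> is spanned by the
  last \<open>n - r\<close> unit vectors, while \<open>compressible\<close> and the normal forms are
  set up for the first ones.\<close>

definition exchange :: "nat \<Rightarrow> complex mat" where
  "exchange n = mat n n (\<lambda>(a, l). of_bool (l = n - 1 - a))"

lemma exchange_carrier [simp]: "exchange n \<in> carrier_mat n n"
  by (simp add: exchange_def)

lemma index_exchange_mult:
  assumes "X \<in> carrier_mat n m" "i < n" "j < m"
  shows "(exchange n * X) $$ (i, j) = X $$ (n - 1 - i, j)"
  unfolding exchange_def by (rule index_selection_mult[OF assms(1) _ assms(2,3)]) simp

lemma inverse_pair_exchange: "inverse_pair n (exchange n) (exchange n)"
proof -
  have "exchange n * exchange n = 1\<^sub>m n"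
  proof (rule eq_matI)
    fix i j assume "i < dim_row (1\<^sub>m n :: complex mat)" "j < dim_col (1\<^sub>m n :: complex mat)"
    then have ij: "i < n" "j < n" by auto
    then have "n - 1 - i < n" "n - 1 - (n - 1 - i) = i" by auto
    then show "(exchange n * exchange n) $$ (i, j) = 1\<^sub>m n $$ (i, j)"
      unfolding index_exchange_mult[OF exchange_carrier ij] using ij by (auto simp: exchange_def)
  qed (auto simp: exchange_def)
  then show ?thesis by (simp add: inverse_pair_def)
qed

lemma transpose_exchange: "(exchange n)\<^sup>T = exchange n"
  by (rule eq_matI) (auto simp: exchange_def)

text \<open>With A in normal form, a matrix is annihilated by A only if the first \<open>r\<close>
  rows of its product with \<open>Q\<close> vanish. Reversing the coordinates moves these zero rows
  to the bottom, where \<open>compressible_if_rows_zero\<close> expects them.\<close>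

lemma compressible_if_annihilated:
  assumes A: "A \<in> carrier_mat n n" "mat_rank A = r" and B: "B \<in> carrier_mat n n"
    and "A * B = 0\<^sub>m n n" "A * B\<^sup>T = 0\<^sub>m n n"
  shows "compressible n (n - r) B"
proof -
  obtain P P' Q Q' where P: "inverse_pair n P P'" and Q: "inverse_pair n Q Q'"
    and r: "r \<le> n" and eq: "A = P * rank_form n n r * Q"
    using mat_rank_normal_formE[OF A(1)] A(2) by metis
  note Qc = inverse_pairD[OF Q]
  have zero: "(exchange n * Q * X) $$ (i, j) = 0"
    if X: "X \<in> carrier_mat n n" "A * X = 0\<^sub>m n n" and ij: "n - r \<le> i" "i < n" "j < n" for X i j
  proof -
    have QX: "Q * X \<in> carrier_mat n n" by (rule mult_carrier_mat[OF Qc(1) X(1)])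
    have "(exchange n * Q * X) $$ (i, j) = (exchange n * (Q * X)) $$ (i, j)"
      using assoc_mult_mat[OF exchange_carrier Qc(1) X(1)] by simp
    also have "\<dots> = (Q * X) $$ (n - 1 - i, j)" by (rule index_exchange_mult[OF QX ij(2,3)])
    also have "\<dots> = 0"
      by (rule normal_form_mult_zero[OF P Qc(1) X(1) X(2)[unfolded eq] r]) (use ij r in auto)
    finally show ?thesis .
  qed
  have BT: "B\<^sup>T \<in> carrier_mat n n" using B by simp
  show ?thesis
    by (rule compressible_if_rows_zero[OF inverse_pair_mult[OF inverse_pair_sym[OF Q] inverse_pair_exchange] B _
          zero[OF B assms(4)] zero[OF BT assms(5)]]) auto
qed

text \<open>Left multiplication by \<open>R'\<close> puts the columns of \<open>K\<close> into the
  first \<open>n - r\<close> coordinates. Reversing \<open>J * rank_form n n r\<close> gives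
  \<open>F\<close>, which sees only the last \<open>r\<close> coordinates, and the annihilator is
  R'^T F R'. Being a congruence, it keeps the symmetry type of \<open>F\<close>. The choices of
  \<open>P\<close> and \<open>Q\<close> display it in normal form.\<close>

lemma eps_symmetric_annihilator:
  fixes K J :: "complex mat"
  assumes K: "K \<in> carrier_mat n (n - r)" and r: "r \<le> n" and J: "inverse_pair n J J'"
    and eps: "(J * rank_form n n r)\<^sup>T = \<epsilon> \<cdot>\<^sub>m (J * rank_form n n r)"
  obtains P P' Q Q' where "inverse_pair n P P'" "inverse_pair n Q Q'"
    "(P * rank_form n n r * Q)\<^sup>T = \<epsilon> \<cdot>\<^sub>m (P * rank_form n n r * Q)"
    "P * rank_form n n r * Q * K = 0\<^sub>m n (n - r)"
proof -
  let ?E = "rank_form n n r :: complex mat" and ?X = "exchange n"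
  obtain q R R' T T' where q: "q \<le> n" "q \<le> n - r" and R: "inverse_pair n R R'"
    and T: "inverse_pair (n - r) T T'" and eq: "K = R * rank_form n (n - r) q * T"
    by (rule rank_normal_form[OF K])
  note Rc = inverse_pairD[OF R] and Tc = inverse_pairD[OF T] and Jc = inverse_pairD[OF J]
  have E: "?E \<in> carrier_mat n n" and X: "?X \<in> carrier_mat n n" by simp_all
  define G where "G = J * ?E"
  have G: "G \<in> carrier_mat n n" unfolding G_def by (rule mult_carrier_mat[OF Jc(1) E])
  define F where "F = ?X * G * ?X"
  have F: "F \<in> carrier_mat n n" unfolding F_def by (rule triple_carrier[OF X G X])
  have RT: "R'\<^sup>T \<in> carrier_mat n n" using Rc by simp
  let ?P = "R'\<^sup>T * ?X * J" and ?Q = "?X * R'"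
  have P: "inverse_pair n ?P (J' * (?X * R\<^sup>T))"
    by (rule inverse_pair_mult[OF inverse_pair_mult[OF inverse_pair_transpose[OF inverse_pair_sym[OF R]]
            inverse_pair_exchange] J])
  have Q: "inverse_pair n ?Q (R * ?X)"
    by (rule inverse_pair_mult[OF inverse_pair_exchange inverse_pair_sym[OF R]])
  have RX: "R'\<^sup>T * ?X \<in> carrier_mat n n" and XR: "?X * R' \<in> carrier_mat n n" and XG: "?X * G \<in> carrier_mat n n"
    using mult_carrier_mat[OF RT X] mult_carrier_mat[OF X Rc(2)] mult_carrier_mat[OF X G] by auto
  have PEQ: "?P * ?E * ?Q = R'\<^sup>T * F * R'"
  proof -
    have "?P * ?E = R'\<^sup>T * ?X * G" unfolding G_def by (rule assoc_mult_mat[OF RX Jc(1) E])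
    also have "\<dots> = R'\<^sup>T * (?X * G)" by (rule assoc_mult_mat[OF RT X G])
    finally have "?P * ?E * ?Q = R'\<^sup>T * (?X * G) * (?X * R')" by simp
    also have "\<dots> = R'\<^sup>T * (?X * G * (?X * R'))" by (rule assoc_mult_mat[OF RT XG XR])
    also have "?X * G * (?X * R') = F * R'"
      unfolding F_def by (rule assoc_mult_mat[OF XG X Rc(2), symmetric])
    also have "R'\<^sup>T * (F * R') = R'\<^sup>T * F * R'" by (rule assoc_mult_mat[OF RT F Rc(2), symmetric])
    finally show ?thesis .
  qed
  have "F\<^sup>T = ?X * (G\<^sup>T * ?X)"
    unfolding F_def using transpose_mult[OF XG X] transpose_mult[OF X G] by (simp add: transpose_exchange)
  also have "G\<^sup>T = \<epsilon> \<cdot>\<^sub>m G" using eps by (simp add: G_def)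
  also have "?X * (\<epsilon> \<cdot>\<^sub>m G * ?X) = \<epsilon> \<cdot>\<^sub>m (?X * (G * ?X))"
    using mult_smult_assoc_mat[OF G X, of \<epsilon>] mult_smult_distrib[OF X mult_carrier_mat[OF G X], of \<epsilon>] by simp
  also have "?X * (G * ?X) = F" unfolding F_def by (rule assoc_mult_mat[OF X G X, symmetric])
  finally have FT: "F\<^sup>T = \<epsilon> \<cdot>\<^sub>m F" .
  have RF: "R'\<^sup>T * F \<in> carrier_mat n n" by (rule mult_carrier_mat[OF RT F])
  have "(R'\<^sup>T * F * R')\<^sup>T = R'\<^sup>T * (F\<^sup>T * R')"
    using transpose_mult[OF RF Rc(2)] transpose_mult[OF RT F] by simp
  also have "\<dots> = \<epsilon> \<cdot>\<^sub>m (R'\<^sup>T * (F * R'))"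
    unfolding FT using mult_smult_assoc_mat[OF F Rc(2), of \<epsilon>]
      mult_smult_distrib[OF RT mult_carrier_mat[OF F Rc(2)], of \<epsilon>] by simp
  also have "R'\<^sup>T * (F * R') = R'\<^sup>T * F * R'" by (rule assoc_mult_mat[OF RT F Rc(2), symmetric])
  finally have sym: "(?P * ?E * ?Q)\<^sup>T = \<epsilon> \<cdot>\<^sub>m (?P * ?E * ?Q)" unfolding PEQ .
  have RK: "R' * K \<in> carrier_mat n (n - r)" by (rule mult_carrier_mat[OF Rc(2) K])
  have RKz: "(R' * K) $$ (i, j) = 0" if "n - r \<le> i" "i < n" "j < n - r" for i j
  proof -
    have fT: "rank_form n (n - r) q * T \<in> carrier_mat n (n - r)"
      by (rule mult_carrier_mat[OF rank_form_carrier(1) Tc(1)])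
    have "R' * K = rank_form n (n - r) q * T"
      using inverse_pair_cancel[OF inverse_pair_sym[OF R] fT] assoc_mult_mat[OF Rc(1) rank_form_carrier(1) Tc(1)]
        eq by simp
    then show ?thesis using index_rank_form_mult[OF Tc(1) that(2,3) q(2)] that q by simp
  qed
  have XRK: "?X * (R' * K) \<in> carrier_mat n (n - r)" by (rule mult_carrier_mat[OF X RK])
  have "?E * (?X * (R' * K)) = 0\<^sub>m n (n - r)"
  proof (rule eq_matI)
    fix i j assume "i < dim_row (0\<^sub>m n (n - r) :: complex mat)" "j < dim_col (0\<^sub>m n (n - r) :: complex mat)"
    then have ij: "i < n" "j < n - r" by auto
    have "(?E * (?X * (R' * K))) $$ (i, j) = (if i < r then (?X * (R' * K)) $$ (i, j) else 0)"
      by (rule index_rank_form_mult[OF XRK ij r])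
    also have "(?X * (R' * K)) $$ (i, j) = (R' * K) $$ (n - 1 - i, j)" by (rule index_exchange_mult[OF RK ij])
    finally show "(?E * (?X * (R' * K))) $$ (i, j) = 0\<^sub>m n (n - r) $$ (i, j)"
      using RKz[of "n - 1 - i" j] ij r by auto
  qed (use carrier_matD[OF mult_carrier_mat[OF E XRK]] in auto)
  moreover have "?P * ?E * ?Q * K = ?P * (?E * (?X * (R' * K)))"
  proof -
    note Pc = inverse_pairD[OF P]
    have PE: "?P * ?E \<in> carrier_mat n n" by (rule mult_carrier_mat[OF Pc(1) E])
    have "?P * ?E * ?Q * K = ?P * ?E * (?Q * K)" by (rule assoc_mult_mat[OF PE XR K])
    also have "?Q * K = ?X * (R' * K)" by (rule assoc_mult_mat[OF X Rc(2) K])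
    also have "?P * ?E * (?X * (R' * K)) = ?P * (?E * (?X * (R' * K)))"
      by (rule assoc_mult_mat[OF Pc(1) E XRK])
    finally show ?thesis .
  qed
  ultimately have "?P * ?E * ?Q * K = 0\<^sub>m n (n - r)"
    using right_mult_zero_mat[OF inverse_pairD(1)[OF P], of "n - r"] by simp
  with that[OF P Q sym] show thesis .
qed

text \<open>In the first \<open>r\<close> coordinates this is the antidiagonal with opposite signs
  in its two halves, a nondegenerate skew form when \<open>r\<close> is even. The identity on the
  remaining coordinates makes the whole matrix invertible.\<close>

definition skew_unit :: "nat \<Rightarrow> nat \<Rightarrow> complex mat" where
  "skew_unit n r = mat n n (\<lambda>(i, k).
     (if i < r \<and> r \<le> 2 * i then -1 else 1) * of_bool (k = (if i < r then r - 1 - i else i)))"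

lemma skew_unit_properties:
  assumes r: "r \<le> n" "even r"
  shows "inverse_pair n (skew_unit n r) ((skew_unit n r)\<^sup>T)"
    and "(skew_unit n r * rank_form n n r)\<^sup>T = (-1) \<cdot>\<^sub>m (skew_unit n r * rank_form n n r)"
proof -
  let ?J = "skew_unit n r"
  have J: "?J \<in> carrier_mat n n" "?J\<^sup>T \<in> carrier_mat n n" by (simp_all add: skew_unit_def)
  let ?s = "\<lambda>i. if i < r \<and> r \<le> 2 * i then -1 else (1 :: complex)"
  let ?\<sigma> = "\<lambda>i. if i < r then r - 1 - i else i"
  have "?J * ?J\<^sup>T = 1\<^sub>m n"
  proof (rule eq_matI)
    fix i j assume "i < dim_row (1\<^sub>m n :: complex mat)" "j < dim_col (1\<^sub>m n :: complex mat)"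
    then have ij: "i < n" "j < n" by auto
    have "(?J * ?J\<^sup>T) $$ (i, j) = (\<Sum>k<n. ?J $$ (i, k) * ?J\<^sup>T $$ (k, j))"
      by (rule index_mult_mat_sum[OF J ij])
    also have "\<dots> = (\<Sum>k<n. if k = ?\<sigma> i then ?s i * ?s j * of_bool (?\<sigma> i = ?\<sigma> j) else 0)"
      by (rule sum.cong) (use ij in \<open>auto simp: skew_unit_def\<close>)
    also have "\<dots> = ?s i * ?s j * of_bool (?\<sigma> i = ?\<sigma> j)"
    proof -
      have "?\<sigma> i < n" using ij r by auto
      then show ?thesis by (simp only: sum.delta finite_lessThan lessThan_iff if_True)
    qed
    also have "\<dots> = of_bool (i = j)" by (auto split: if_splits)
    finally show "(?J * ?J\<^sup>T) $$ (i, j) = 1\<^sub>m n $$ (i, j)" using ij by simp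
  qed (auto simp: skew_unit_def)
  then show "inverse_pair n ?J (?J\<^sup>T)"
    using mat_mult_left_right_inverse[OF J] J by (simp add: inverse_pair_def)
  have JE: "?J * rank_form n n r \<in> carrier_mat n n" by (rule mult_carrier_mat[OF J(1) rank_form_carrier(1)])
  show "(?J * rank_form n n r)\<^sup>T = (-1) \<cdot>\<^sub>m (?J * rank_form n n r)"
  proof (rule eq_matI)
    fix i j assume "i < dim_row ((-1) \<cdot>\<^sub>m (?J * rank_form n n r))" "j < dim_col ((-1) \<cdot>\<^sub>m (?J * rank_form n n r))"
    then have ij: "i < n" "j < n" using carrier_matD[OF JE] by auto
    have idx: "(?J * rank_form n n r) $$ (a, b) = (if b < r then ?J $$ (a, b) else 0)" if "a < n" "b < n" for a b
      by (rule index_mult_rank_form[OF J(1) that r(1)])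
    obtain m where m: "r = 2 * m" using r(2) by (rule evenE)
    have "(if i < r then ?J $$ (j, i) else 0) = - (if j < r then ?J $$ (i, j) else 0)"
      using ij m by (auto simp: skew_unit_def)
    then have "(?J * rank_form n n r) $$ (j, i) = - (?J * rank_form n n r) $$ (i, j)"
      unfolding idx[OF ij] idx[OF ij(2,1)] .
    then show "(?J * rank_form n n r)\<^sup>T $$ (i, j) = ((-1) \<cdot>\<^sub>m (?J * rank_form n n r)) $$ (i, j)"
      using ij carrier_matD[OF JE] by (simp only: index_transpose_mat index_smult_mat mult_minus1)
  qed (use carrier_matD[OF JE] in auto)
qed

text \<open>The congruence by \<open>Q'\<close> turns A into \<open>Z\<close>, which lives in the
  first r columns, with r the rank, and by skewness also in the first r rows. For odd r its leading
  block \<open>S\<close> is skew of odd size, so it is singular and factors through r - 1,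
  contradicting the rank of \<open>Z\<close>.\<close>

lemma skew_rank_even:
  assumes A: "A \<in> carrier_mat n n" and skew: "A\<^sup>T = - A"
  shows "even (mat_rank A)"
proof (rule ccontr)
  let ?r = "mat_rank A"
  assume odd: "odd ?r"
  then have r1: "1 \<le> ?r" by (auto intro: Suc_leI odd_pos)
  obtain P P' Q Q' where P: "inverse_pair n P P'" and Q: "inverse_pair n Q Q'"
    and r: "?r \<le> n" and eq: "A = P * rank_form n n ?r * Q"
    by (rule mat_rank_normal_formE[OF A])
  note Pc = inverse_pairD[OF P] and Qc = inverse_pairD[OF Q]
  let ?E = "rank_form n n ?r :: complex mat"
  define M where "M = Q'\<^sup>T * P"
  have QT: "Q'\<^sup>T \<in> carrier_mat n n" using Qc by simp
  have M: "inverse_pair n M (P' * Q\<^sup>T)"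
    unfolding M_def by (rule inverse_pair_mult[OF inverse_pair_transpose[OF inverse_pair_sym[OF Q]] P])
  note Mc = inverse_pairD[OF M]
  define Z where "Z = M * ?E"
  have Z: "Z \<in> carrier_mat n n" unfolding Z_def by (rule mult_carrier_mat[OF Mc(1) rank_form_carrier(1)])
  have one: "inverse_pair n (1\<^sub>m n) (1\<^sub>m n :: complex mat)" by (simp add: inverse_pair_def)
  have rkZ: "mat_rank Z = ?r" using mat_rank_normal_form[OF M one r] Z by (simp add: Z_def)
  have QA: "Q'\<^sup>T * A \<in> carrier_mat n n" by (rule mult_carrier_mat[OF QT A])
  have Zeq: "Q'\<^sup>T * A * Q' = Z"
  proof -
    have PE: "P * ?E \<in> carrier_mat n n" by (rule mult_carrier_mat[OF Pc(1) rank_form_carrier(1)])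
    have "Q'\<^sup>T * A * Q' = Q'\<^sup>T * (A * Q')" by (rule assoc_mult_mat[OF QT A Qc(2)])
    also have "A * Q' = P * ?E" unfolding eq[symmetric]
      by (subst eq) (rule inverse_pair_cancel_right[OF Q PE])
    also have "Q'\<^sup>T * (P * ?E) = Z" unfolding Z_def M_def
      by (rule assoc_mult_mat[OF QT Pc(1) rank_form_carrier(1), symmetric])
    finally show ?thesis .
  qed
  have skewZ: "Z\<^sup>T = - Z"
  proof -
    have "Z\<^sup>T = Q'\<^sup>T * (A\<^sup>T * Q')"
      unfolding Zeq[symmetric] using transpose_mult[OF QA Qc(2)] transpose_mult[OF QT A] by simp
    also have "\<dots> = Q'\<^sup>T * ((-1) \<cdot>\<^sub>m A * Q')"
    proof -
      have "A\<^sup>T = (-1) \<cdot>\<^sub>m A" unfolding skew by (rule eq_matI) auto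
      then show ?thesis by simp
    qed
    also have "\<dots> = (-1) \<cdot>\<^sub>m (Q'\<^sup>T * (A * Q'))"
      using mult_smult_assoc_mat[OF A Qc(2), of "-1"] mult_smult_distrib[OF QT mult_carrier_mat[OF A Qc(2)], of "-1"]
      by simp
    also have "Q'\<^sup>T * (A * Q') = Z" using Zeq assoc_mult_mat[OF QT A Qc(2)] by simp
    also have "(-1) \<cdot>\<^sub>m Z = - Z" by (rule eq_matI) auto
    finally show ?thesis .
  qed
  have skew_idx: "Z $$ (j, i) = - Z $$ (i, j)" if "i < n" "j < n" for i j
  proof -
    have "Z\<^sup>T $$ (i, j) = (- Z) $$ (i, j)" unfolding skewZ ..
    with that Z show ?thesis by simp
  qed
  have Zcol: "Z $$ (i, j) = 0" if "i < n" "j < n" "?r \<le> j" for i j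
    unfolding Z_def using index_mult_rank_form[OF Mc(1) that(1,2) r] that by simp
  have Zrow: "Z $$ (i, j) = 0" if "i < n" "j < n" "?r \<le> i" for i j
    using skew_idx[OF that(2,1)] Zcol[OF that(2,1,3)] by simp
  define S where "S = mat ?r ?r (\<lambda>(i, j). Z $$ (i, j))"
  have S: "S \<in> carrier_mat ?r ?r" by (simp add: S_def)
  have "S\<^sup>T = - S"
  proof (rule eq_matI)
    fix i j assume "i < dim_row (- S)" "j < dim_col (- S)"
    then have ij: "i < ?r" "j < ?r" using S by auto
    then have "Z $$ (j, i) = - Z $$ (i, j)" using r by (intro skew_idx) auto
    with ij show "S\<^sup>T $$ (i, j) = (- S) $$ (i, j)" by (simp add: S_def)
  qed (use S in auto)
  then have detS: "det S = 0" by (rule det_skew_odd[OF S _ odd])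
  have "\<forall>X\<in>carrier_mat (Suc (?r - 1)) ?r. \<forall>Y\<in>carrier_mat ?r (Suc (?r - 1)). det (X * S * Y) = 0"
  proof (intro ballI)
    fix X Y :: "complex mat" assume "X \<in> carrier_mat (Suc (?r - 1)) ?r" "Y \<in> carrier_mat ?r (Suc (?r - 1))"
    then have XY: "X \<in> carrier_mat ?r ?r" "Y \<in> carrier_mat ?r ?r" using r1 by auto
    show "det (X * S * Y) = 0"
      using det_mult[OF mult_carrier_mat[OF XY(1) S] XY(2)] det_mult[OF XY(1) S] detS by simp
  qed
  then have "\<exists>U W. U \<in> carrier_mat ?r (?r - 1) \<and> W \<in> carrier_mat (?r - 1) ?r \<and> S = U * W"
    unfolding factorization_iff_dets_zero[OF S] .
  then obtain U W where UW: "U \<in> carrier_mat ?r (?r - 1)" "W \<in> carrier_mat (?r - 1) ?r" "S = U * W"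
    by (elim exE conjE)
  have RS: "rank_form n ?r ?r * S \<in> carrier_mat n ?r" by (rule mult_carrier_mat[OF rank_form_carrier(1) S])
  have "Z = rank_form n ?r ?r * S * rank_form ?r n ?r"
  proof (rule eq_matI)
    fix i j assume "i < dim_row (rank_form n ?r ?r * S * rank_form ?r n ?r)"
      "j < dim_col (rank_form n ?r ?r * S * rank_form ?r n ?r)"
    then have ij: "i < n" "j < n" by auto
    have "(rank_form n ?r ?r * S * rank_form ?r n ?r) $$ (i, j) =
        (if j < ?r then (rank_form n ?r ?r * S) $$ (i, j) else 0)"
      by (rule index_mult_rank_form[OF RS ij order_refl])
    also have "\<dots> = (if j < ?r then if i < ?r then S $$ (i, j) else 0 else 0)"
      using index_rank_form_mult[OF S ij(1), of j ?r] by simp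
    also have "\<dots> = Z $$ (i, j)" using Zcol[OF ij] Zrow[OF ij] by (auto simp: S_def)
    finally show "Z $$ (i, j) = (rank_form n ?r ?r * S * rank_form ?r n ?r) $$ (i, j)" by simp
  qed (use Z in auto)
  also have "\<dots> = rank_form n ?r ?r * U * W * rank_form ?r n ?r"
    unfolding UW(3) using assoc_mult_mat[OF rank_form_carrier(1) UW(1,2)] by simp
  also have "\<dots> = (rank_form n ?r ?r * U) * (W * rank_form ?r n ?r)"
    by (rule assoc_mult_mat[OF mult_carrier_mat[OF rank_form_carrier(1) UW(1)] UW(2) rank_form_carrier(1)])
  finally have "Z = (rank_form n ?r ?r * U) * (W * rank_form ?r n ?r)" .
  then have "mat_rank Z \<le> ?r - 1"
    using mat_rank_mult_le[OF mult_carrier_mat[OF rank_form_carrier(1) UW(1)]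
        mult_carrier_mat[OF UW(2) rank_form_carrier(1)]] by simp
  with rkZ r1 show False by simp
qed

text \<open>A form in the second variable is a biform of degree 0 in the first. Closed conditions on
  the second component are therefore inherited by the closure of a set of pairs.\<close>

lemma zariski_closed_prod_snd:
  assumes "finite I" and "zariski_closed J Z"
  shows "zariski_closed_prod I J {(p, q) \<in> proj_space I \<times> proj_space J. q \<in> Z}"
proof -
  obtain \<F> where \<F>: "\<F> \<subseteq> forms J" "Z = zero_locus J \<F>" using assms(2) by (auto simp: zariski_closed_iff)
  have exp0: "exponents I 0 = {\<lambda>i. 0}"
    using assms(1) by (auto simp: exponents_def fun_eq_iff)
  have "(\<lambda>x y. F y) \<in> biforms I J" if "F \<in> forms J" for F
  proof -
    obtain e c where "F = (\<lambda>y. \<Sum>\<beta>\<in>exponents J e. c \<beta> * monomial_at J \<beta> y)"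
      using \<open>F \<in> forms J\<close> unfolding forms_def by blast
    then have "(\<lambda>x y. F y) = (\<lambda>x y. \<Sum>\<alpha>\<in>exponents I 0. \<Sum>\<beta>\<in>exponents J e.
        c \<beta> * monomial_at I \<alpha> x * monomial_at J \<beta> y)"
      by (simp add: exp0 monomial_at_def)
    then show ?thesis unfolding biforms_def
      by (intro CollectI exI[of _ 0] exI[of _ e] exI[of _ "\<lambda>\<alpha> \<beta>. c \<beta>"])
  qed
  then have "(\<lambda>F x y. F y) ` \<F> \<subseteq> biforms I J" using \<F>(1) by blast
  moreover have "{(p, q) \<in> proj_space I \<times> proj_space J. q \<in> Z} =
      {(p, q) \<in> proj_space I \<times> proj_space J. \<forall>G\<in>(\<lambda>F x y. F y) ` \<F>. \<forall>x\<in>p. \<forall>y\<in>q. G x y = 0}"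
  proof -
    have "p \<noteq> {}" if "p \<in> proj_space I" for p :: "('a \<Rightarrow> complex) set"
      using that self_mem_proj_point by (auto simp: proj_space_def)
    then show ?thesis using \<F>(2) by (fastforce simp: zero_locus_def)
  qed
  ultimately show ?thesis unfolding zariski_closed_prod_def by blast
qed

lemma zero_locus_forms:
  assumes "finite I"
  shows "zero_locus I (forms I) = {}"
proof (rule ccontr)
  assume "zero_locus I (forms I) \<noteq> {}"
  then obtain p where p: "p \<in> proj_space I" "\<forall>F\<in>forms I. \<forall>x\<in>p. F x = 0" by (auto simp: zero_locus_def)
  obtain x where x: "p = proj_point x" "x \<in> coord_vectors I" "x \<noteq> (\<lambda>i. 0)" by (rule proj_spaceE[OF p(1)])
  then obtain i where i: "x i \<noteq> 0" by auto
  with x(2) have "i \<in> I" by (auto simp: coord_vectors_def)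
  then have "(\<lambda>x. x i) \<in> hforms I 1" by (rule hforms_var[OF assms])
  then have "(\<lambda>x. x i) \<in> forms I" unfolding forms_eq_hforms[OF assms] by (rule UN_I[OF UNIV_I])
  from bspec[OF bspec[OF p(2) this], of x] i self_mem_proj_point[of x] show False by (simp add: x(1))
qed

text \<open>The hull of the empty set is empty because the empty set is itself closed, as the common
  zero set of all forms.\<close>

lemma zariski_closure_prod_empty:
  assumes "finite I"
  shows "zariski_closure_prod I I {} = {}"
proof -
  have "zariski_closed I {}"
    using zariski_closed_zero_locus[of "forms I" I] zero_locus_forms[OF assms] by simp
  from zariski_closed_prod_snd[OF assms this] have "zariski_closed_prod I I {}" by simp
  then show ?thesis unfolding zariski_closure_prod_def by (rule hull_same)
qed

text \<open>The set whose closure appears in the theorem. The name anticipates that, for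
  \<open>p \<ge> 1\<close>, it is the part of \<open>compressible_locus n p\<close> where the rank
  has its largest possible value \<open>p\<close>.\<close>

definition maximal_compressible_locus :: "nat \<Rightarrow> nat \<Rightarrow> (nat \<times> nat \<Rightarrow> complex) set set" where
  "maximal_compressible_locus n p = {h \<in> proj_space (entries n). \<forall>b\<in>h.
     mat_rank (mat n n b) = p \<and> symmetric_matrix (compound_matrix p (mat n n b))}"

lemma mem_maximal_compressible_locus:
  assumes B: "B \<in> carrier_mat n n" "B \<noteq> 0\<^sub>m n n" and "compressible n p B" "mat_rank B = p"
  shows "proj_point (coords n B) \<in> maximal_compressible_locus n p"
proof -
  have "mat_rank (mat n n (\<lambda>i. c * coords n B i)) = p \<and>
      symmetric_matrix (compound_matrix p (mat n n (\<lambda>i. c * coords n B i)))" if "c \<noteq> 0" for c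
    unfolding mat_scale mat_coords[OF B(1)]
    using mat_rank_smult[OF B(1) that] assms(4)
      compressible_symmetric_compound[OF compressible_smult[OF assms(3), of c]] by simp
  with proj_point_coords_mem[OF B] show ?thesis
    by (auto simp: maximal_compressible_locus_def proj_point_def)
qed

text \<open>Cutting out the leading block gives a product of three invertible matrices of size
  \<open>p\<close>. The two conditions are nonvanishing determinants, so perturbing \<open>K\<close>
  and \<open>C\<close> violates them only for finitely many parameters.\<close>

lemma mat_rank_compressed:
  assumes K: "K \<in> carrier_mat n p" and C: "C \<in> carrier_mat p p" and p: "1 \<le> p" "p \<le> n"
    and "det (rank_form p n p * K) \<noteq> 0" "det C \<noteq> 0"
  shows "mat_rank (K * C * K\<^sup>T) = p"
proof (rule antisym)
  have KT: "K\<^sup>T \<in> carrier_mat p n" using K by simp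
  have KC: "K * C \<in> carrier_mat n p" by (rule mult_carrier_mat[OF K C])
  show "mat_rank (K * C * K\<^sup>T) \<le> p" by (rule mat_rank_mult_le[OF KC KT])
  let ?B = "K * C * K\<^sup>T" and ?S = "rank_form p n p :: complex mat" and ?T = "rank_form n p p :: complex mat"
  have B: "?B \<in> carrier_mat n n" by (rule mult_carrier_mat[OF KC KT])
  let ?X = "?S * K"
  have X: "?X \<in> carrier_mat p p" and XT: "?X\<^sup>T \<in> carrier_mat p p"
    using mult_carrier_mat[OF rank_form_carrier(1) K] by auto
  have KTT: "K\<^sup>T * ?T = ?X\<^sup>T" using transpose_mult[OF rank_form_carrier(1) K, of p p] by (simp add: transpose_rank_form)
  have "?S * ?B * ?T = ?S * (?B * ?T)" by (rule assoc_mult_mat[OF rank_form_carrier(1) B rank_form_carrier(1)])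
  also have "?B * ?T = K * C * (K\<^sup>T * ?T)" by (rule assoc_mult_mat[OF KC KT rank_form_carrier(1)])
  also have "?S * (K * C * (K\<^sup>T * ?T)) = ?S * (K * C) * ?X\<^sup>T"
    unfolding KTT by (rule assoc_mult_mat[OF rank_form_carrier(1) KC XT, symmetric])
  also have "?S * (K * C) = ?X * C" by (rule assoc_mult_mat[OF rank_form_carrier(1) K C, symmetric])
  finally have "det (?S * ?B * ?T) = det ?X * det C * det (?X\<^sup>T)"
    using det_mult[OF mult_carrier_mat[OF X C] XT] det_mult[OF X C] by simp
  with assms det_transpose[OF X] have nz: "det (?S * ?B * ?T) \<noteq> 0" by simp
  show "p \<le> mat_rank ?B"
  proof (rule ccontr)
    assume "\<not> p \<le> mat_rank ?B"
    then have "mat_rank ?B \<le> p - 1" by simp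
    then have "\<forall>S\<in>carrier_mat (Suc (p - 1)) n. \<forall>T\<in>carrier_mat n (Suc (p - 1)). det (S * ?B * T) = 0"
      using mat_rank_le_iff[OF B] factorization_iff_dets_zero[OF B] by blast
    with nz p show False by simp
  qed
qed

lemma compressible_locus_subset_closure:
  assumes p: "1 \<le> p" "p \<le> n"
  shows "compressible_locus n p \<subseteq> zariski_closure (entries n) (maximal_compressible_locus n p)"
proof
  let ?R = "maximal_compressible_locus n p"
  have Rsub: "?R \<subseteq> proj_space (entries n)" by (auto simp: maximal_compressible_locus_def)
  fix h assume "h \<in> compressible_locus n p"
  then have h: "h \<in> proj_space (entries n)" "\<And>b. b \<in> h \<Longrightarrow> compressible n p (mat n n b)"
    by (auto simp: compressible_locus_def)
  obtain B where B: "B \<in> carrier_mat n n" "B \<noteq> 0\<^sub>m n n" "h = proj_point (coords n B)"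
    by (rule proj_space_entriesE[OF h(1)])
  have "compressible n p B"
    using h(2)[of "coords n B"] self_mem_proj_point[of "coords n B"] B by (simp add: mat_coords)
  then obtain K C where KC: "K \<in> carrier_mat n p" "C \<in> carrier_mat p p" "B = K * C * K\<^sup>T"
    by (rule compressibleE)
  \<comment> \<open>The shifts are chosen so that the leading block of \<open>Kt t\<close> and the
    matrix \<open>Ct t\<close> both have the form of a fixed matrix plus \<open>t\<close> times the
    identity; \<open>finite_det_add_scalar_zero\<close> then applies to both.\<close>
  define Kt where "Kt t = K + t \<cdot>\<^sub>m rank_form n p p" for t
  define Ct where "Ct t = C + t \<cdot>\<^sub>m 1\<^sub>m p" for t
  define Bt where "Bt t = Kt t * Ct t * (Kt t)\<^sup>T" for t
  have Kt: "Kt t \<in> carrier_mat n p" "(Kt t)\<^sup>T \<in> carrier_mat p n" and Ct: "Ct t \<in> carrier_mat p p" for t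
    using KC by (auto simp: Kt_def Ct_def)
  have Bt: "Bt t \<in> carrier_mat n n" for t
    unfolding Bt_def by (rule mult_carrier_mat[OF mult_carrier_mat[OF Kt(1) Ct] Kt(2)])
  have curve: "poly_curve (\<lambda>t. coords n (Bt t))"
    unfolding poly_curve_iff
  proof
    fix i show "poly_fun (\<lambda>t. coords n (Bt t) i)"
    proof (cases "i \<in> entries n")
      case True
      then obtain a b where ab: "i = (a, b)" "a < n" "b < n" by (auto simp: entries_def)
      have "poly_fun (\<lambda>t. (Bt t) $$ (a, b))"
        unfolding Bt_def
      proof (rule poly_fun_mult_mat[OF mult_carrier_mat[OF Kt(1) Ct] Kt(2) _ _ ab(2,3)])
        show "poly_fun (\<lambda>t. (Kt t * Ct t) $$ (i, k))" if "i < n" "k < p" for i k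
          by (rule poly_fun_mult_mat[OF Kt(1) Ct _ _ that])
            (use KC in \<open>auto simp: Kt_def Ct_def intro!: poly_fun_add poly_fun_mult poly_fun_const poly_fun_id\<close>)
        show "poly_fun (\<lambda>t. (Kt t)\<^sup>T $$ (k, j))" if "k < p" "j < n" for k j
          using that KC by (auto simp: Kt_def intro!: poly_fun_add poly_fun_mult poly_fun_const poly_fun_id)
      qed
      with ab show ?thesis by (simp add: coords_def)
    next
      case False
      then have "(\<lambda>t. coords n (Bt t) i) = (\<lambda>t. 0)" by (auto simp: coords_def entries_def split: prod.splits)
      then show ?thesis by auto
    qed
  qed
  define V where "V = rank_form p n p * K"
  have V: "V \<in> carrier_mat p p" unfolding V_def by (rule mult_carrier_mat[OF rank_form_carrier(1) KC(1)])
  have top: "rank_form p n p * Kt t = V + t \<cdot>\<^sub>m 1\<^sub>m p" for t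
  proof -
    have "rank_form p n p * (t \<cdot>\<^sub>m rank_form n p p) = t \<cdot>\<^sub>m (rank_form p n p * rank_form n p p)"
      by (rule mult_smult_distrib[OF rank_form_carrier(1) rank_form_carrier(1)])
    also have "rank_form p n p * rank_form n p p = (1\<^sub>m p :: complex mat)"
      using p by (simp add: rank_form_mult rank_form_one)
    finally show ?thesis
      unfolding Kt_def V_def
      using mult_add_distrib_mat[OF rank_form_carrier(1) KC(1), of "t \<cdot>\<^sub>m rank_form n p p" p p] by simp
  qed
  let ?bad = "{t. det (V + t \<cdot>\<^sub>m 1\<^sub>m p) = 0} \<union> {t. det (C + t \<cdot>\<^sub>m 1\<^sub>m p) = 0}"
  have fin: "finite ?bad"
    using finite_det_add_scalar_zero[OF V] finite_det_add_scalar_zero[OF KC(2)] by simp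
  have good: "proj_point (coords n (Bt t)) \<in> ?R" if "t \<notin> ?bad" for t
  proof -
    have rk: "mat_rank (Bt t) = p"
      unfolding Bt_def by (rule mat_rank_compressed[OF Kt(1) Ct p]) (use that in \<open>auto simp: top Ct_def\<close>)
    have "Bt t \<noteq> 0\<^sub>m n n"
    proof
      assume "Bt t = 0\<^sub>m n n"
      moreover have "vec_space.rank n (0\<^sub>m n n :: complex mat) = 0" by (rule vec_space.rank_0I)
      ultimately show False using rk p by (simp add: mat_rank_def)
    qed
    then show ?thesis
      by (rule mem_maximal_compressible_locus[OF Bt _ compressibleI[OF Kt(1) Ct Bt_def] rk])
  qed
  have "F (coords n B) = 0" if F: "F \<in> vanishing_forms (entries n) ?R" for F
  proof -
    obtain d where d: "F \<in> hforms (entries n) d"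
      using F forms_eq_hforms[OF finite_entries] by (auto simp: vanishing_forms_def)
    have "F (coords n (Bt t)) = 0" if "t \<notin> ?bad" for t
      using F good[OF that] self_mem_proj_point by (auto simp: vanishing_forms_def)
    then have "F (coords n (Bt 0)) = 0"
      by (rule hforms_zero_on_curve[where \<gamma> = "\<lambda>t. coords n (Bt t)", OF d curve fin])
    moreover have "Kt 0 = K" "Ct 0 = C" using KC by (auto simp: Kt_def Ct_def intro!: eq_matI)
    ultimately show ?thesis by (simp add: Bt_def KC(3))
  qed
  then have "\<forall>b\<in>h. F b = 0" if "F \<in> vanishing_forms (entries n) ?R" for F
    using that forms_vanish_proj_point[OF finite_entries, of F n "coords n B"] B(3)
    by (auto simp: vanishing_forms_def)
  with h(1) show "h \<in> zariski_closure (entries n) ?R"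
    unfolding zariski_closure_eq[OF Rsub] zero_locus_def by blast
qed

lemma closure_maximal_compressible_locus:
  assumes p: "1 \<le> p" "p \<le> n"
  shows "zariski_closure (entries n) (maximal_compressible_locus n p) = compressible_locus n p"
proof
  show "zariski_closure (entries n) (maximal_compressible_locus n p) \<subseteq> compressible_locus n p"
  proof (rule zariski_closure_minimal[OF _ zariski_closed_compressible_locus[OF p(2)]])
    show "maximal_compressible_locus n p \<subseteq> compressible_locus n p"
      unfolding maximal_compressible_locus_def compressible_locus_def
      using symmetric_compound_compressible[OF mat_carrier p(1)] by blast
  qed
  show "compressible_locus n p \<subseteq> zariski_closure (entries n) (maximal_compressible_locus n p)"
    by (rule compressible_locus_subset_closure[OF p])
qed

section \<open>Conormal pairs over matrices of given symmetry type\<close>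

definition conormal_pairs :: "nat \<Rightarrow> nat \<Rightarrow> (nat \<times> nat \<Rightarrow> complex) set set \<Rightarrow>
    ((nat \<times> nat \<Rightarrow> complex) set \<times> (nat \<times> nat \<Rightarrow> complex) set) set" where
  "conormal_pairs n r Z = {(p, h) \<in> proj_space (entries n) \<times> proj_space (entries n).
     p \<in> smooth_locus (entries n) (det_variety n r) \<inter> Z \<and>
     tangent_space (entries n) (det_variety n r) p \<subseteq> hyperplane (entries n) h}"

lemma dual_variety_eq:
  "dual_variety (entries n) (det_variety n r) Z =
    snd ` zariski_closure_prod (entries n) (entries n) (conormal_pairs n r Z)"
  by (simp add: dual_variety_def conormal_variety_def conormal_pairs_def)

text \<open>The values 1 and -1 of \<open>\<epsilon>\<close> treat the symmetric and the
  skew-symmetric matrices in one argument.\<close>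

definition eps_det_variety :: "complex \<Rightarrow> nat \<Rightarrow> nat \<Rightarrow> (nat \<times> nat \<Rightarrow> complex) set set" where
  "eps_det_variety \<epsilon> n r = {p \<in> det_variety n r. \<forall>a\<in>p. (mat n n a)\<^sup>T = \<epsilon> \<cdot>\<^sub>m mat n n a}"

lemma sym_det_variety_eq: "sym_det_variety n r = eps_det_variety 1 n r"
proof -
  have "1 \<cdot>\<^sub>m mat n n a = (mat n n a :: complex mat)" for a by (rule eq_matI) auto
  then show ?thesis by (simp add: sym_det_variety_def eps_det_variety_def symmetric_matrix_def)
qed

lemma skew_det_variety_eq: "skew_det_variety n r = eps_det_variety (-1) n r"
proof -
  have "(-1) \<cdot>\<^sub>m mat n n a = - (mat n n a :: complex mat)" for a by (rule eq_matI) auto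
  then show ?thesis by (simp add: skew_det_variety_def eps_det_variety_def skew_symmetric_matrix_def)
qed

text \<open>The symmetry of A turns A^T B = 0 into A B = 0, so both B and its transpose are
  annihilated by A on the left. The first conclusion is what excludes skew-symmetric matrices for
  odd \<open>r\<close>.\<close>

lemma conormal_pairsD:
  assumes ph: "(p, h) \<in> conormal_pairs n r (eps_det_variety \<epsilon> n r)" and r: "1 \<le> r" "1 \<le> n"
    and \<epsilon>: "\<epsilon> \<noteq> 0"
  shows "\<exists>x\<in>p. mat_rank (mat n n x) = r \<and> (mat n n x)\<^sup>T = \<epsilon> \<cdot>\<^sub>m mat n n x"
    and "h \<in> compressible_locus n (n - r)"
proof -
  have h: "p \<in> proj_space (entries n)" "h \<in> proj_space (entries n)"
    and p: "p \<in> det_variety n r" and eps: "\<And>a. a \<in> p \<Longrightarrow> (mat n n a)\<^sup>T = \<epsilon> \<cdot>\<^sub>m mat n n a"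
    and tang: "tangent_space (entries n) (det_variety n r) p \<subseteq> hyperplane (entries n) h"
    using ph by (auto simp: conormal_pairs_def eps_det_variety_def)
  obtain x where x: "x \<in> p" using h(1) self_mem_proj_point by (auto elim!: proj_spaceE)
  obtain b where b: "b \<in> h" using h(2) self_mem_proj_point by (auto elim!: proj_spaceE)
  note facts = tangent_hyperplane_imp[OF p r tang h(2)]
  show "\<exists>x\<in>p. mat_rank (mat n n x) = r \<and> (mat n n x)\<^sup>T = \<epsilon> \<cdot>\<^sub>m mat n n x"
    using facts(1)[OF b x] eps[OF x] x by blast
  have "compressible n (n - r) (mat n n b)" if "b \<in> h" for b
  proof -
    let ?A = "mat n n x" and ?B = "mat n n b"
    have "\<epsilon> \<cdot>\<^sub>m (?A * ?B) = ?A\<^sup>T * ?B"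
      unfolding eps[OF x] by (rule mult_smult_assoc_mat[symmetric]) auto
    then have "\<epsilon> \<cdot>\<^sub>m (?A * ?B) = 0\<^sub>m n n" using facts(2)[OF that x] by simp
    then have "inverse \<epsilon> \<cdot>\<^sub>m (\<epsilon> \<cdot>\<^sub>m (?A * ?B)) = 0\<^sub>m n n" by (simp add: smult_zero_mat)
    moreover have "inverse \<epsilon> \<cdot>\<^sub>m (\<epsilon> \<cdot>\<^sub>m (?A * ?B)) = ?A * ?B"
      by (rule eq_matI) (use \<epsilon> in auto)
    ultimately have "?A * ?B = 0\<^sub>m n n" by simp
    then show ?thesis
      using facts(1,3)[OF that x] by (intro compressible_if_annihilated[of ?A n r ?B]) auto
  qed
  with h(2) show "h \<in> compressible_locus n (n - r)" by (simp add: compressible_locus_def)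
qed

text \<open>Every point of the locus, also one of rank below \<open>n - r\<close>, occurs in a
  conormal pair before any closure is taken: the annihilator is constructed for an arbitrary
  \<open>K\<close>, of full rank or not, and still has rank exactly \<open>r\<close>.\<close>

lemma compressible_locus_conormal_pair:
  assumes r: "1 \<le> r" "r \<le> n" and J: "inverse_pair n J J'"
    and eps: "(J * rank_form n n r)\<^sup>T = \<epsilon> \<cdot>\<^sub>m (J * rank_form n n r)"
    and h: "h \<in> compressible_locus n (n - r)"
  shows "\<exists>p. (p, h) \<in> conormal_pairs n r (eps_det_variety \<epsilon> n r)"
proof -
  have hp: "h \<in> proj_space (entries n)" using h by (simp add: compressible_locus_def)
  obtain B where B: "B \<in> carrier_mat n n" "B \<noteq> 0\<^sub>m n n" "h = proj_point (coords n B)"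
    by (rule proj_space_entriesE[OF hp])
  have "compressible n (n - r) B"
    using h self_mem_proj_point[of "coords n B"] B by (auto simp: compressible_locus_def mat_coords)
  then obtain K C where KC: "K \<in> carrier_mat n (n - r)" "C \<in> carrier_mat (n - r) (n - r)" "B = K * C * K\<^sup>T"
    by (rule compressibleE)
  obtain P P' Q Q' where P: "inverse_pair n P P'" and Q: "inverse_pair n Q Q'"
    and sym: "(P * rank_form n n r * Q)\<^sup>T = \<epsilon> \<cdot>\<^sub>m (P * rank_form n n r * Q)"
    and AK: "P * rank_form n n r * Q * K = 0\<^sub>m n (n - r)"
    by (rule eps_symmetric_annihilator[OF KC(1) r(2) J eps])
  define A where "A = P * rank_form n n r * Q"
  note A = normal_form_point[OF P Q r, folded A_def]
  note sym = sym[folded A_def] and AK = AK[folded A_def]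
  have KT: "K\<^sup>T \<in> carrier_mat (n - r) n" and CT: "C\<^sup>T \<in> carrier_mat (n - r) (n - r)" using KC by auto
  have kill: "A * (K * X * K\<^sup>T) = 0\<^sub>m n n" if X: "X \<in> carrier_mat (n - r) (n - r)" for X
  proof -
    have XK: "X * K\<^sup>T \<in> carrier_mat (n - r) n" by (rule mult_carrier_mat[OF X KT])
    have "A * (K * X * K\<^sup>T) = A * (K * (X * K\<^sup>T))" using assoc_mult_mat[OF KC(1) X KT] by simp
    also have "\<dots> = A * K * (X * K\<^sup>T)" by (rule assoc_mult_mat[OF A(1) KC(1) XK, symmetric])
    also have "\<dots> = 0\<^sub>m n n" unfolding AK by (rule left_mult_zero_mat[OF XK])
    finally show ?thesis .
  qed
  have BT: "B\<^sup>T = K * C\<^sup>T * K\<^sup>T"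
    unfolding KC(3) using transpose_mult[OF mult_carrier_mat[OF KC(1,2)] KT] transpose_mult[OF KC(1,2)]
      assoc_mult_mat[OF KC(1) CT KT] by simp
  have AB: "A * B = 0\<^sub>m n n" "A * B\<^sup>T = 0\<^sub>m n n" using kill[OF KC(2)] kill[OF CT] KC(3) BT by simp_all
  have hb: "\<exists>c. mat n n b = c \<cdot>\<^sub>m B" if "b \<in> h" for b
    using that unfolding B(3) proj_point_def by (auto simp: mat_scale mat_coords[OF B(1)])
  have zero: "c \<cdot>\<^sub>m 0\<^sub>m n n = (0\<^sub>m n n :: complex mat)" for c by (rule eq_matI) auto
  have left: "A\<^sup>T * mat n n b = 0\<^sub>m n n" if b: "b \<in> h" for b
  proof -
    obtain c where c: "mat n n b = c \<cdot>\<^sub>m B" using hb[OF b] by blast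
    have "A\<^sup>T * mat n n b = \<epsilon> \<cdot>\<^sub>m (A * (c \<cdot>\<^sub>m B))"
      unfolding sym c by (rule mult_smult_assoc_mat[OF A(1) smult_carrier_mat[OF B(1)]])
    also have "A * (c \<cdot>\<^sub>m B) = c \<cdot>\<^sub>m (A * B)" by (rule mult_smult_distrib[OF A(1) B(1)])
    finally show ?thesis by (simp add: AB zero)
  qed
  have right: "A * (mat n n b)\<^sup>T = 0\<^sub>m n n" if b: "b \<in> h" for b
  proof -
    obtain c where c: "mat n n b = c \<cdot>\<^sub>m B" using hb[OF b] by blast
    have "(c \<cdot>\<^sub>m B)\<^sup>T = c \<cdot>\<^sub>m B\<^sup>T" by (rule eq_matI) auto
    moreover have "A * (c \<cdot>\<^sub>m B\<^sup>T) = c \<cdot>\<^sub>m (A * B\<^sup>T)"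
      by (rule mult_smult_distrib[OF A(1) transpose_carrier_mat[THEN iffD2, OF B(1)]])
    ultimately show ?thesis by (simp add: c AB zero)
  qed
  let ?p = "proj_point (coords n A)"
  have "?p \<in> smooth_locus (entries n) (det_variety n r)"
    unfolding A_def by (rule smooth_locus_det_variety[OF P Q r])
  moreover have "?p \<in> eps_det_variety \<epsilon> n r"
  proof -
    have "(c \<cdot>\<^sub>m A)\<^sup>T = \<epsilon> \<cdot>\<^sub>m (c \<cdot>\<^sub>m A)" for c
    proof -
      have "(c \<cdot>\<^sub>m A)\<^sup>T = c \<cdot>\<^sub>m A\<^sup>T" by (rule eq_matI) auto
      also have "\<dots> = \<epsilon> \<cdot>\<^sub>m (c \<cdot>\<^sub>m A)" unfolding sym by (rule eq_matI) auto
      finally show ?thesis .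
    qed
    then show ?thesis
      using A(3) by (auto simp: eps_det_variety_def proj_point_def mat_scale mat_coords[OF A(1)])
  qed
  moreover have "tangent_space (entries n) (det_variety n r) ?p \<subseteq> hyperplane (entries n) h"
    unfolding A_def
    by (rule tangent_space_subset_hyperplane[OF P Q r hp left[unfolded A_def] right[unfolded A_def]])
  moreover have "?p \<in> proj_space (entries n)" by (rule proj_point_coords_mem[OF A(1,2)])
  ultimately have "(?p, h) \<in> conormal_pairs n r (eps_det_variety \<epsilon> n r)"
    using hp by (simp add: conormal_pairs_def)
  then show ?thesis by blast
qed

text \<open>The pairs lie over a closed set in the second factor, so their closure does too; and
  they already project onto all of that set. Hence the projection of the closure is squeezed between
  equal sets.\<close>

lemma dual_variety_eps_det_variety:
  assumes r: "1 \<le> r" "r < n" and J: "inverse_pair n J J'" and \<epsilon>: "\<epsilon> \<noteq> 0"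
    and eps: "(J * rank_form n n r)\<^sup>T = \<epsilon> \<cdot>\<^sub>m (J * rank_form n n r)"
  shows "dual_variety (entries n) (det_variety n r) (eps_det_variety \<epsilon> n r) = compressible_locus n (n - r)"
proof
  let ?W = "conormal_pairs n r (eps_det_variety \<epsilon> n r)" and ?D = "compressible_locus n (n - r)"
  let ?T = "{(p, h) \<in> proj_space (entries n) \<times> proj_space (entries n). h \<in> ?D}"
  have n: "1 \<le> n" using r by simp
  have "?W \<subseteq> ?T"
  proof (rule subrelI)
    fix p h assume ph: "(p, h) \<in> ?W"
    from conormal_pairsD(2)[OF ph r(1) n \<epsilon>] ph show "(p, h) \<in> ?T" by (auto simp: conormal_pairs_def)
  qed
  moreover have "zariski_closed_prod (entries n) (entries n) ?T"
    by (rule zariski_closed_prod_snd[OF finite_entries zariski_closed_compressible_locus]) simp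
  ultimately have "zariski_closure_prod (entries n) (entries n) ?W \<subseteq> ?T"
    unfolding zariski_closure_prod_def by (rule hull_minimal)
  then show "dual_variety (entries n) (det_variety n r) (eps_det_variety \<epsilon> n r) \<subseteq> ?D"
    unfolding dual_variety_eq by auto
  show "?D \<subseteq> dual_variety (entries n) (det_variety n r) (eps_det_variety \<epsilon> n r)"
  proof
    fix h assume "h \<in> ?D"
    then obtain p where "(p, h) \<in> ?W"
      using compressible_locus_conormal_pair[OF r(1) less_imp_le[OF r(2)] J eps] by blast
    then have "(p, h) \<in> zariski_closure_prod (entries n) (entries n) ?W"
      unfolding zariski_closure_prod_def by (rule hull_inc)
    then show "h \<in> dual_variety (entries n) (det_variety n r) (eps_det_variety \<epsilon> n r)"
      unfolding dual_variety_eq by force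
  qed
qed

lemma dual_variety_sym:
  assumes r: "1 \<le> r" "r < n"
  shows "dual_variety (entries n) (det_variety n r) (sym_det_variety n r) = compressible_locus n (n - r)"
  unfolding sym_det_variety_eq
proof (rule dual_variety_eps_det_variety[OF r])
  show "inverse_pair n (1\<^sub>m n) (1\<^sub>m n :: complex mat)" by (simp add: inverse_pair_def)
  have "1 \<cdot>\<^sub>m rank_form n n r = (rank_form n n r :: complex mat)" by (rule eq_matI) auto
  then show "(1\<^sub>m n * rank_form n n r)\<^sup>T = 1 \<cdot>\<^sub>m (1\<^sub>m n * rank_form n n r :: complex mat)"
    by (simp add: transpose_rank_form)
qed simp

lemma dual_variety_skew_even:
  assumes r: "1 \<le> r" "r < n" and "even r"
  shows "dual_variety (entries n) (det_variety n r) (skew_det_variety n r) = compressible_locus n (n - r)"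
  unfolding skew_det_variety_eq
  by (rule dual_variety_eps_det_variety[OF r skew_unit_properties(1) _ skew_unit_properties(2)])
    (use assms in auto)

lemma dual_variety_skew_odd:
  assumes r: "1 \<le> r" "r < n" and "odd r"
  shows "dual_variety (entries n) (det_variety n r) (skew_det_variety n r) = {}"
proof -
  have "1 \<le> n" using r by simp
  have "conormal_pairs n r (eps_det_variety (-1) n r) = {}"
  proof (rule ccontr)
    assume "conormal_pairs n r (eps_det_variety (-1) n r) \<noteq> {}"
    then obtain p h where ph: "(p, h) \<in> conormal_pairs n r (eps_det_variety (-1) n r)" by auto
    obtain x where x: "mat_rank (mat n n x) = r" "(mat n n x)\<^sup>T = (-1) \<cdot>\<^sub>m (mat n n x :: complex mat)"
      using conormal_pairsD(1)[OF ph r(1) \<open>1 \<le> n\<close>] by auto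
    have "(-1) \<cdot>\<^sub>m mat n n x = - (mat n n x :: complex mat)" by (rule eq_matI) auto
    with x skew_rank_even[of "mat n n x" n] \<open>odd r\<close> show False by simp
  qed
  then show ?thesis
    unfolding skew_det_variety_eq dual_variety_eq by (simp add: zariski_closure_prod_empty[OF finite_entries])
qed

theorem proposition4p4:
  fixes N r :: nat
  assumes "1 \<le> r" and "r \<le> N"
  shows
    "dual_variety (entries (N + 1)) (det_variety (N + 1) r) (sym_det_variety (N + 1) r) =
       zariski_closure (entries (N + 1))
         {p \<in> proj_space (entries (N + 1)). \<forall>b\<in>p.
            mat_rank (mat (N + 1) (N + 1) b) = N + 1 - r \<and>
            symmetric_matrix (compound_matrix (N + 1 - r) (mat (N + 1) (N + 1) b))} \<and>
     (even r \<longrightarrow>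
       dual_variety (entries (N + 1)) (det_variety (N + 1) r) (skew_det_variety (N + 1) r) =
       dual_variety (entries (N + 1)) (det_variety (N + 1) r) (sym_det_variety (N + 1) r)) \<and>
     (odd r \<longrightarrow>
       dual_variety (entries (N + 1)) (det_variety (N + 1) r) (skew_det_variety (N + 1) r) = {})"
proof -
  have r: "1 \<le> r" "r < N + 1" using assms by auto
  have "zariski_closure (entries (N + 1)) (maximal_compressible_locus (N + 1) (N + 1 - r)) =
      compressible_locus (N + 1) (N + 1 - r)"
    by (rule closure_maximal_compressible_locus) (use r in auto)
  with dual_variety_sym[OF r] dual_variety_skew_even[OF r] dual_variety_skew_odd[OF r]
  show ?thesis unfolding maximal_compressible_locus_def by simp
qed

end
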